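(* Let $\theta\in\mathbb{R}\setminus\mathbb{Q}$ be Diophantine, and let $F$ be a holomorphic automorphism of $\mathbb{C}^2$ of the form $$F(z,w)=\left(z+f(w)z^2+O(z^3, z^3w),\; e^{2\pi i \theta} w +g(w)z+O(z^2, z^2w)\right),$$ where $f,g:\mathbb{C}\to\mathbb{C}$ are entire functions with $f(0)\neq 0$ and $g(w)=O(w^2)$ (i.e. $g(0)=g'(0)=0$). Then there exists a parabolic cylinder $\Omega$ for $F$ that is biholomorphically equivalent to $\mathbb{C}^2$. Moreover, every limit map of $F$ on $\Omega$ has image $\{0\}\times\mathbb{C}$.
   Context: Diophantine: with $\lambda=e^{2\pi i\theta}$, there exist $c,r>0$ such that $|\lambda^n-1|\ge c\,n^{-r}$ for every integer $n\ge 1$. The symbols $O(z^3,z^3w)$ and $O(z^2,z^2w)$ denote holomorphic remainders of the form $z^3 a(z,w)$, respectively $z^2 b(z,w)$, with $a,b$ entire on $\mathbb{C}^2$. The Fatou set of $F$ is the set of points having an open neighborhood on which the sequence of iterates $\{F^{\circ n}\}_{n\ge 0}$ is a normal family (every sequence of iterates has a subsequence which either converges uniformly on compacta or compactly diverges to $\infty$). A Fatou component is a connected component of the Fatou set. A Fatou component $\Omega$ is invariant if $F(\Omega)=\Omega$; an invariant Fatou component is non-recurrent if every orbit in it eventually leaves every compact subset of it. A limit map of $F$ on $\Omega$ is a map $h:\Omega\to\mathbb{C}^2\cup\{\infty\}$ for which some subsequence $\{F^{\circ n_k}\}$ converges to $h$ uniformly on compacta of $\Omega$ (with $h\equiv\infty$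 if $\{F^{\circ n_k}\}$ compactly diverges to $\infty$). The $\omega$-limit set of $F$ on $\Omega$ is the set of all accumulation points in $\mathbb{C}^2$ of orbits of points of $\Omega$. Univalent means holomorphic and injective. An invariant non-recurrent Fatou component $\Omega$ of an automorphism $F$ of $\mathbb{C}^2$ is called a parabolic cylinder if: (1) the closure of the $\omega$-limit set of $F$ on $\Omega$ contains an isolated fixed point of $F$; (2) there exists a univalent map $\Phi:\Omega\to\mathbb{C}^2$ conjugating $F$ to the translation $(z,w)\mapsto(z+1,w)$, that is, $\Phi(F(p))=\Phi(p)+(1,0)$ for all $p\in\Omega$; (3) all limit maps of $F$ on $\Omega$ have dimension one (i.e. have one-dimensional image). *)

theory Defs
  imports "HOL-Complex_Analysis.Complex_Analysis"
begin

type_synonym complex2 = "complex \<times> complex"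

text \<open>
  The product type carries only a real vector space structure, so complex differentiability is
  real (Frechet) differentiability with a complex-linear derivative.  As for
  \<open>holomorphic_on\<close>, the derivative is taken within the set; this is used for open sets only.
\<close>

definition cscale2 :: "complex \<Rightarrow> complex2 \<Rightarrow> complex2" where
  "cscale2 c v = (c * fst v, c * snd v)"

definition holo_fun :: "(complex2 \<Rightarrow> complex) \<Rightarrow> complex2 set \<Rightarrow> bool" where
  "holo_fun u S \<longleftrightarrow>
     (\<forall>p\<in>S. \<exists>D. (u has_derivative D) (at p within S) \<and> (\<forall>c v. D (cscale2 c v) = c * D v))"

definition holo_map :: "(complex2 \<Rightarrow> complex2) \<Rightarrow> complex2 set \<Rightarrow> bool" where
  "holo_map G S \<longleftrightarrow> holo_fun (\<lambda>p. fst (G p)) S \<and> holo_fun (\<lambda>p. snd (G p)) S"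

definition univalent :: "(complex2 \<Rightarrow> complex2) \<Rightarrow> complex2 set \<Rightarrow> bool" where
  "univalent G S \<longleftrightarrow> holo_map G S \<and> inj_on G S"

definition biholomorphic_map ::
    "(complex2 \<Rightarrow> complex2) \<Rightarrow> complex2 set \<Rightarrow> complex2 set \<Rightarrow> bool" where
  "biholomorphic_map G S T \<longleftrightarrow>
     holo_map G S \<and> bij_betw G S T \<and> holo_map (inv_into S G) T"

definition biholomorphic_sets :: "complex2 set \<Rightarrow> complex2 set \<Rightarrow> bool" where
  "biholomorphic_sets S T \<longleftrightarrow> (\<exists>G. biholomorphic_map G S T)"

definition automorphism_C2 :: "(complex2 \<Rightarrow> complex2) \<Rightarrow> bool" where
  "automorphism_C2 F \<longleftrightarrow> biholomorphic_map F UNIV UNIV"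

definition converges_on_compacta ::
    "complex2 set \<Rightarrow> (nat \<Rightarrow> complex2 \<Rightarrow> complex2) \<Rightarrow> (complex2 \<Rightarrow> complex2) \<Rightarrow> bool" where
  "converges_on_compacta U G h \<longleftrightarrow>
     (\<forall>K. compact K \<and> K \<subseteq> U \<longrightarrow> uniform_limit K G h sequentially)"

definition compactly_diverges :: "complex2 set \<Rightarrow> (nat \<Rightarrow> complex2 \<Rightarrow> complex2) \<Rightarrow> bool" where
  "compactly_diverges U G \<longleftrightarrow>
     (\<forall>K L. compact K \<and> K \<subseteq> U \<and> compact L \<longrightarrow> (\<forall>\<^sub>F n in sequentially. G n ` K \<inter> L = {}))"

definition normal_family :: "complex2 set \<Rightarrow> (complex2 \<Rightarrow> complex2) set \<Rightarrow> bool" where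
  "normal_family U \<F> \<longleftrightarrow>
     (\<forall>G. (\<forall>k. G k \<in> \<F>) \<longrightarrow>
        (\<exists>r::nat \<Rightarrow> nat. strict_mono r \<and>
           ((\<exists>h. converges_on_compacta U (G \<circ> r) h) \<or> compactly_diverges U (G \<circ> r))))"

definition fatou_set :: "(complex2 \<Rightarrow> complex2) \<Rightarrow> complex2 set" where
  "fatou_set F = {p. \<exists>U. open U \<and> p \<in> U \<and> normal_family U (range (\<lambda>n. F ^^ n))}"

definition fatou_component :: "(complex2 \<Rightarrow> complex2) \<Rightarrow> complex2 set \<Rightarrow> bool" where
  "fatou_component F \<Omega> \<longleftrightarrow> \<Omega> \<in> components (fatou_set F)"

definition invariant_fatou_component :: "(complex2 \<Rightarrow> complex2) \<Rightarrow> complex2 set \<Rightarrow> bool" where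
  "invariant_fatou_component F \<Omega> \<longleftrightarrow> fatou_component F \<Omega> \<and> F ` \<Omega> = \<Omega>"

definition non_recurrent :: "(complex2 \<Rightarrow> complex2) \<Rightarrow> complex2 set \<Rightarrow> bool" where
  "non_recurrent F \<Omega> \<longleftrightarrow>
     (\<forall>p\<in>\<Omega>. \<forall>K. compact K \<and> K \<subseteq> \<Omega> \<longrightarrow> (\<forall>\<^sub>F n in sequentially. (F ^^ n) p \<notin> K))"

text \<open>
  Limit maps take values in the one-point compactification of the plane \<open>complex2\<close>,
  with \<open>None\<close> as the point at infinity.  Values outside \<open>\<Omega>\<close> are irrelevant.
\<close>

definition limit_map ::
    "(complex2 \<Rightarrow> complex2) \<Rightarrow> complex2 set \<Rightarrow> (complex2 \<Rightarrow> complex2 option) \<Rightarrow> bool" where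
  "limit_map F \<Omega> h \<longleftrightarrow>
     (\<exists>n::nat \<Rightarrow> nat. strict_mono n \<and>
        ((\<exists>h'. converges_on_compacta \<Omega> (\<lambda>k. F ^^ n k) h' \<and> (\<forall>p\<in>\<Omega>. h p = Some (h' p))) \<or>
         (compactly_diverges \<Omega> (\<lambda>k. F ^^ n k) \<and> (\<forall>p\<in>\<Omega>. h p = None))))"

definition omega_limit_set :: "(complex2 \<Rightarrow> complex2) \<Rightarrow> complex2 set \<Rightarrow> complex2 set" where
  "omega_limit_set F \<Omega> =
     {q. \<exists>p\<in>\<Omega>. \<exists>n::nat \<Rightarrow> nat. strict_mono n \<and> (\<lambda>k. (F ^^ n k) p) \<longlonglongrightarrow> q}"

definition regular_disc :: "(complex \<Rightarrow> complex2) \<Rightarrow> bool" where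
  "regular_disc \<phi> \<longleftrightarrow>
     (\<lambda>t. fst (\<phi> t)) holomorphic_on ball 0 1 \<and> (\<lambda>t. snd (\<phi> t)) holomorphic_on ball 0 1 \<and>
     inj_on \<phi> (ball 0 1) \<and>
     (\<forall>t\<in>ball 0 1. deriv (\<lambda>t. fst (\<phi> t)) t \<noteq> 0 \<or> deriv (\<lambda>t. snd (\<phi> t)) t \<noteq> 0)"

text \<open>
  The complex dimension of a subset of the plane \<open>complex2\<close> is the largest dimension of a
  complex submanifold contained in it: two-dimensional submanifolds are the nonempty open sets,
  and a one-dimensional submanifold is contained in the set iff an embedded disc is.  For images of
  holomorphic maps this is the maximal rank of the differential.  The empty set gets dimension 0.
\<close>

definition cdim :: "complex2 set \<Rightarrow> nat" where
  "cdim S =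
     (if interior S \<noteq> {} then 2
      else if \<exists>\<phi>. regular_disc \<phi> \<and> \<phi> ` ball 0 1 \<subseteq> S then 1
      else 0)"

text \<open>
  In the last condition, a limit map that is constantly infinity has finite part \<open>{}\<close> of its image,
  hence is not one-dimensional.
\<close>

definition parabolic_cylinder :: "(complex2 \<Rightarrow> complex2) \<Rightarrow> complex2 set \<Rightarrow> bool" where
  "parabolic_cylinder F \<Omega> \<longleftrightarrow>
     automorphism_C2 F \<and> invariant_fatou_component F \<Omega> \<and> non_recurrent F \<Omega> \<and>
     (\<exists>p \<in> closure (omega_limit_set F \<Omega>). p isolated_in {q. F q = q}) \<and>
     (\<exists>\<Phi>. univalent \<Phi> \<Omega> \<and> (\<forall>p\<in>\<Omega>. \<Phi> (F p) = \<Phi> p + (1, 0))) \<and>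
     (\<forall>h. limit_map F \<Omega> h \<longrightarrow> cdim (Some -` (h ` \<Omega>)) = 1)"

definition multiplier :: "real \<Rightarrow> complex" where
  "multiplier \<theta> = exp (2 * of_real pi * \<i> * of_real \<theta>)"

definition diophantine :: "real \<Rightarrow> bool" where
  "diophantine \<theta> \<longleftrightarrow>
     (\<exists>c>0. \<exists>r>0. \<forall>n::nat. n \<ge> 1 \<longrightarrow> norm (multiplier \<theta> ^ n - 1) \<ge> c * real n powr (- r))"

end

theory Submission
  imports Defs
begin

text \<open>
  On the invariant line \<open>z = 0\<close> the map \<open>F\<close> is the rotation by \<open>\<rho> = multiplier \<theta>\<close>, and
  transversally to it \<open>F\<close> is parabolic.  In the coordinate \<open>u = - 1 / (\<kappa> * z)\<close> with \<open>\<kappa> = f 0\<close> the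
  first component reads \<open>u + f w / \<kappa> + O(1 / u)\<close>.  Since the rotation averages \<open>f w / \<kappa>\<close> to \<open>1\<close>,
  orbits near the line with \<open>Re u\<close> large drift to the right with unit speed, so that
  \<open>z\<close> tends to \<open>0\<close> like \<open>1 / n\<close> while \<open>w\<close> rotates.

  The averaging is made exact with the arithmetic hypothesis: for entire \<open>h\<close> the equation
  \<open>H (\<rho> * w) - H w = h w - h 0\<close> has an entire solution, because the small divisors \<open>\<rho> ^ n - 1\<close>
  are at worst polynomially small and the Taylor coefficients of \<open>h\<close> decay faster than any
  geometric sequence (\<open>coboundary_entire\<close>).  Solving three such equations gives functions \<open>A\<close> and \<open>Y\<close>
  near the line, asymptotic to \<open>u\<close> and \<open>w\<close>, with \<open>A (F p) = A p + 1 + O(z\<^sup>2)\<close> and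
  \<open>Y (F p) = \<rho> * Y p + O(z\<^sup>2)\<close>; the hypothesis \<open>g w = O(w\<^sup>2)\<close> makes the equation for \<open>Y\<close> solvable.
  The errors are summable along orbits, so that \<open>\<Phi>1 = lim (A (F\<^sup>n p) - n)\<close> and
  \<open>\<Phi>2 = lim (Y (F\<^sup>n p) / \<rho>\<^sup>n)\<close> exist and conjugate \<open>F\<close> to \<open>(x, y) \<mapsto> (x + 1, \<rho> * y)\<close>.

  The component \<open>\<Omega>\<close> is the set of all points off the line whose orbit has \<open>z \<longlonglongrightarrow> 0\<close> and \<open>w\<close> bounded.
  Every such orbit enters the region where the normal form is valid
  (\<open>eventually_in_sector\<close>): once \<open>z\<close> is small, each step moves \<open>u\<close>, corrected by a bounded function
  of \<open>w\<close>, by almost \<open>1\<close>.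

  In suitable coordinates the map \<open>(\<Phi>1, \<Phi>2)\<close> is the identity plus a contraction on a half plane times a
  disc; this follows from Cauchy estimates, one variable at a time (\<open>chart_exists\<close>).  So it is
  injective there, its inverse is holomorphic, and the contraction principle shows that its image is large.
  Pulling back by iterates of the automorphism \<open>F\<close> gives a biholomorphic map from \<open>\<Omega>\<close> onto
  the whole plane (\<open>inj_\<Phi>\<close>, \<open>surj_\<Phi>\<close>, \<open>holo_\<Phi>_inverse\<close>).

  On \<open>\<Omega>\<close> the iterates are locally uniformly close to \<open>(0, \<rho>\<^sup>n * \<Phi>2)\<close>.  This yields normality and the
  form \<open>(0, \<mu> * \<Phi>2)\<close> of all limit maps.  That \<open>\<Omega>\<close> is a whole component is the statement
  \<open>fatou_boundary_point\<close>: near a Fatou point in the closure of \<open>\<Omega>\<close> every limit of iterates has vanishing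
  first component by the identity theorem, so the orbit of this point has \<open>z \<longlonglongrightarrow> 0\<close> and \<open>w\<close> bounded.
  The point is off the line, because on the line all iterates have transversal derivative \<open>1\<close>,
  which is incompatible with uniform convergence of \<open>z\<close> to \<open>0\<close> on a neighbourhood.
\<close>

section \<open>Holomorphic functions of two variables\<close>

lemma holo_funI:
  assumes "\<And>p. p \<in> S \<Longrightarrow> \<exists>D. (u has_derivative D) (at p) \<and> (\<forall>c v. D (cscale2 c v) = c * D v)"
  shows "holo_fun u S"
  unfolding holo_fun_def using assms has_derivative_at_withinI by blast

lemma holo_funD:
  assumes "holo_fun u S" "open S" "p \<in> S"
  obtains D where "(u has_derivative D) (at p)" "\<And>c v. D (cscale2 c v) = c * D v"
  using assms unfolding holo_fun_def by (metis at_within_open)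

lemma holo_fun_subset:
  assumes "holo_fun u S" "T \<subseteq> S"
  shows "holo_fun u T"
  using assms unfolding holo_fun_def by (meson has_derivative_subset subsetD)

lemma holo_fun_cong:
  assumes "holo_fun u S" "\<And>p. p \<in> S \<Longrightarrow> u p = v p"
  shows "holo_fun v S"
  unfolding holo_fun_def
proof
  fix p assume p: "p \<in> S"
  then obtain D where D: "(u has_derivative D) (at p within S)" "\<forall>c v. D (cscale2 c v) = c * D v"
    using assms(1) unfolding holo_fun_def by blast
  have "(v has_derivative D) (at p within S)"
    using has_derivative_transform[OF p _ D(1)] assms(2) by metis
  with D(2) show "\<exists>D. (v has_derivative D) (at p within S) \<and> (\<forall>c v. D (cscale2 c v) = c * D v)"
    by blast
qed

lemma holo_fun_local:
  assumes "\<And>p. p \<in> S \<Longrightarrow> \<exists>U. open U \<and> p \<in> U \<and> holo_fun u U"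
  shows "holo_fun u S"
  by (rule holo_funI) (metis assms holo_funD)

lemma holo_fun_continuous_on:
  assumes "holo_fun u S" shows "continuous_on S u"
  using assms unfolding holo_fun_def continuous_on_eq_continuous_within
  by (meson has_derivative_continuous)

lemma holo_fun_fst: "holo_fun fst S"
  unfolding holo_fun_def
  by (auto intro!: exI[of _ fst] derivative_eq_intros simp: cscale2_def)

lemma holo_fun_snd: "holo_fun snd S"
  unfolding holo_fun_def
  by (auto intro!: exI[of _ snd] derivative_eq_intros simp: cscale2_def)

lemma holo_fun_add:
  assumes "holo_fun u S" "holo_fun v S"
  shows "holo_fun (\<lambda>p. u p + v p) S"
  unfolding holo_fun_def
proof
  fix p assume "p \<in> S"
  with assms obtain D E where "(u has_derivative D) (at p within S)" "\<forall>c v. D (cscale2 c v) = c * D v"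
    "(v has_derivative E) (at p within S)" "\<forall>c v. E (cscale2 c v) = c * E v"
    unfolding holo_fun_def by blast
  then show "\<exists>D. ((\<lambda>p. u p + v p) has_derivative D) (at p within S) \<and> (\<forall>c v. D (cscale2 c v) = c * D v)"
    by (intro exI[of _ "\<lambda>h. D h + E h"]) (auto intro: has_derivative_add simp: algebra_simps)
qed

lemma holo_fun_mult:
  assumes "holo_fun u S" "holo_fun v S"
  shows "holo_fun (\<lambda>p. u p * v p) S"
  unfolding holo_fun_def
proof
  fix p assume "p \<in> S"
  with assms obtain D E where "(u has_derivative D) (at p within S)" "\<forall>c v. D (cscale2 c v) = c * D v"
    "(v has_derivative E) (at p within S)" "\<forall>c v. E (cscale2 c v) = c * E v"
    unfolding holo_fun_def by blast
  then show "\<exists>D. ((\<lambda>p. u p * v p) has_derivative D) (at p within S) \<and> (\<forall>c v. D (cscale2 c v) = c * D v)"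
    using has_derivative_mult[of u D p S v E]
    by (intro exI[of _ "\<lambda>h. u p * E h + D h * v p"]) (auto simp: algebra_simps)
qed

lemma holo_fun_comp:
  assumes "holo_fun u S" "h holomorphic_on T" "u ` S \<subseteq> T"
  shows "holo_fun (\<lambda>p. h (u p)) S"
  unfolding holo_fun_def
proof
  fix p assume p: "p \<in> S"
  with assms obtain D where D: "(u has_derivative D) (at p within S)" "\<forall>c v. D (cscale2 c v) = c * D v"
    unfolding holo_fun_def by blast
  obtain d where "(h has_field_derivative d) (at (u p) within T)"
    using assms(2,3) p unfolding holomorphic_on_def field_differentiable_def by blast
  then have "(h has_derivative (\<lambda>x. d * x)) (at (u p) within u ` S)"
    unfolding has_field_derivative_def using assms(3) has_derivative_subset by blast
  from has_derivative_in_compose[OF D(1) this] D(2)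
  show "\<exists>D. ((\<lambda>p. h (u p)) has_derivative D) (at p within S) \<and> (\<forall>c v. D (cscale2 c v) = c * D v)"
    by (intro exI[of _ "\<lambda>h. d * D h"]) auto
qed

lemma holo_fun_constant: "holo_fun (\<lambda>p. c) S"
  unfolding holo_fun_def by (auto intro!: exI[of _ "\<lambda>_. 0"])

lemma holo_fun_uminus:
  assumes "holo_fun u S" shows "holo_fun (\<lambda>p. - u p) S"
  using holo_fun_comp[OF assms, of uminus UNIV] by (simp add: holomorphic_on_minus holomorphic_on_ident)

lemma holo_fun_diff:
  assumes "holo_fun u S" "holo_fun v S"
  shows "holo_fun (\<lambda>p. u p - v p) S"
  using holo_fun_add[OF assms(1) holo_fun_uminus[OF assms(2)]] by simp

lemma holo_fun_power:
  assumes "holo_fun u S" shows "holo_fun (\<lambda>p. u p ^ n) S"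
  using holo_fun_comp[OF assms, of "\<lambda>z. z ^ n" UNIV] by (simp add: holomorphic_on_power holomorphic_on_ident)

lemma holo_fun_entire:
  assumes "h holomorphic_on UNIV" "holo_fun u S"
  shows "holo_fun (\<lambda>p. h (u p)) S"
  using holo_fun_comp[OF assms(2,1)] by simp

lemma holo_fun_divide:
  assumes "holo_fun u S" "holo_fun v S" "\<And>p. p \<in> S \<Longrightarrow> v p \<noteq> 0"
  shows "holo_fun (\<lambda>p. u p / v p) S"
proof -
  have "holo_fun (\<lambda>p. inverse (v p)) S"
    by (rule holo_fun_comp[OF assms(2), of inverse "- {0}"]) (use assms(3) in \<open>auto intro!: holomorphic_intros\<close>)
  from holo_fun_mult[OF assms(1) this] show ?thesis by (simp add: divide_inverse)
qed

lemma holo_fun_compose: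
  assumes "holo_fun u T" "holo_map G S" "G ` S \<subseteq> T"
  shows "holo_fun (\<lambda>p. u (G p)) S"
  unfolding holo_fun_def
proof
  fix p assume p: "p \<in> S"
  with assms obtain D E where D: "((\<lambda>p. fst (G p)) has_derivative D) (at p within S)" "\<forall>c v. D (cscale2 c v) = c * D v"
    and E: "((\<lambda>p. snd (G p)) has_derivative E) (at p within S)" "\<forall>c v. E (cscale2 c v) = c * E v"
    unfolding holo_map_def holo_fun_def by blast
  have G: "(G has_derivative (\<lambda>h. (D h, E h))) (at p within S)"
    using has_derivative_Pair[OF D(1) E(1)] by simp
  obtain L where L: "(u has_derivative L) (at (G p) within T)" "\<forall>c v. L (cscale2 c v) = c * L v"
    using assms(1,3) p unfolding holo_fun_def by blast
  have "(u has_derivative L) (at (G p) within G ` S)"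
    using L(1) assms(3) has_derivative_subset by blast
  from has_derivative_in_compose[OF G this]
  have "((\<lambda>p. u (G p)) has_derivative (\<lambda>h. L (D h, E h))) (at p within S)" .
  moreover have "L (D (cscale2 c v), E (cscale2 c v)) = c * L (D v, E v)" for c v
    using L(2)[rule_format, of c "(D v, E v)"] D(2) E(2) by (simp add: cscale2_def)
  ultimately show "\<exists>D. ((\<lambda>p. u (G p)) has_derivative D) (at p within S) \<and> (\<forall>c v. D (cscale2 c v) = c * D v)"
    by blast
qed

lemma holo_map_Pair:
  assumes "holo_fun u S" "holo_fun v S"
  shows "holo_map (\<lambda>p. (u p, v p)) S"
  using assms by (simp add: holo_map_def)

lemma holo_map_compose:
  assumes "holo_map H T" "holo_map G S" "G ` S \<subseteq> T"
  shows "holo_map (\<lambda>p. H (G p)) S"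
  using assms holo_fun_compose[OF _ assms(2,3)] unfolding holo_map_def by blast

lemma holo_map_subset: "holo_map G S \<Longrightarrow> T \<subseteq> S \<Longrightarrow> holo_map G T"
  unfolding holo_map_def using holo_fun_subset by blast

lemma holo_map_continuous_on: "holo_map G S \<Longrightarrow> continuous_on S G"
  unfolding holo_map_def
  using continuous_on_Pair[OF holo_fun_continuous_on holo_fun_continuous_on, of "\<lambda>p. fst (G p)" S "\<lambda>p. snd (G p)"]
  by simp

lemma holo_map_funpow:
  assumes "holo_map F UNIV"
  shows "holo_map (F ^^ n) UNIV"
proof (induction n)
  case 0
  then show ?case by (simp add: holo_map_def holo_fun_fst holo_fun_snd)
next
  case (Suc n)
  then show ?case using holo_map_compose[OF assms Suc] by (simp add: o_def)
qed

lemmas holo_fun_intros = holo_fun_constant holo_fun_fst holo_fun_snd holo_fun_add holo_fun_mult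
  holo_fun_uminus holo_fun_diff holo_fun_power

text \<open>
  The bridge to one complex variable: the derivative in the direction of a vector \<open>(v, v')\<close> is
  complex linear in the parameter, so restrictions to complex lines are holomorphic.
\<close>

lemma holo_fun_on_line:
  assumes "holo_fun u S" "open S" "\<And>t. t \<in> T \<Longrightarrow> (z + t * v, w + t * v') \<in> S"
  shows "(\<lambda>t. u (z + t * v, w + t * v')) holomorphic_on T"
  unfolding holomorphic_on_def
proof
  fix t assume t: "t \<in> T"
  obtain D where D: "(u has_derivative D) (at (z + t * v, w + t * v'))" "\<And>c v. D (cscale2 c v) = c * D v"
    using holo_funD[OF assms(1,2) assms(3)[OF t]] by blast
  have "((\<lambda>t. (z + t * v, w + t * v')) has_derivative (\<lambda>t. (t * v, t * v'))) (at t within T)"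
    by (auto intro!: derivative_eq_intros)
  from has_derivative_compose[OF this D(1)]
  have "((\<lambda>t. u (z + t * v, w + t * v')) has_derivative (\<lambda>t. D (t * v, t * v'))) (at t within T)" .
  moreover have "D (t * v, t * v') = D (v, v') * t" for t
    using D(2)[of t "(v,v')"] by (simp add: cscale2_def)
  ultimately show "(\<lambda>t. u (z + t * v, w + t * v')) field_differentiable at t within T"
    unfolding field_differentiable_def has_field_derivative_def by auto
qed

lemma holo_fun_fst_slice:
  assumes "holo_fun u S" "open S" "\<And>t. t \<in> T \<Longrightarrow> (t, w) \<in> S"
  shows "(\<lambda>t. u (t, w)) holomorphic_on T"
  using holo_fun_on_line[OF assms(1,2), of T 0 1 w 0] assms(3) by simp

lemma holo_fun_snd_slice:
  assumes "holo_fun u S" "open S" "\<And>t. t \<in> T \<Longrightarrow> (z, t) \<in> S"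
  shows "(\<lambda>t. u (z, t)) holomorphic_on T"
  using holo_fun_on_line[OF assms(1,2), of T z 0 0 1] assms(3) by simp

lemma holomorphic_deriv_bound:
  assumes "h holomorphic_on T" "cball x r \<subseteq> T" "r > 0" "\<And>y. y \<in> cball x r \<Longrightarrow> norm (h y) \<le> B"
  shows "norm (deriv h x) \<le> B / r"
  using Cauchy_inequality[of h x r B 1] assms
  by (auto simp: dist_norm holomorphic_on_subset[OF assms(1)] holomorphic_on_imp_continuous_on
      subset_iff intro!: holomorphic_on_imp_continuous_on holomorphic_on_subset[OF assms(1)])

text \<open>
  Osgood's lemma.  The second partial derivative is continuous: the difference of its values
  at two points is the derivative of \<open>t \<mapsto> u (x, y + t) - u (z0, w0 + t)\<close> at \<open>0\<close>, which a Cauchy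
  estimate bounds by the modulus of continuity of \<open>u\<close>.  One existing partial derivative and one
  continuous one give total differentiability.
\<close>

lemma holo_fun_separately:
  assumes S: "open S" and cont: "continuous_on S u"
    and d1: "\<And>z w. (z, w) \<in> S \<Longrightarrow> (\<lambda>t. u (t, w)) field_differentiable at z"
    and d2: "\<And>z w. (z, w) \<in> S \<Longrightarrow> (\<lambda>t. u (z, t)) field_differentiable at w"
  shows "holo_fun u S"
proof (rule holo_funI)
  fix p assume p: "p \<in> S"
  obtain z0 w0 where p0: "p = (z0, w0)" by (cases p)
  obtain A0 B0 where AB: "open A0" "open B0" "z0 \<in> A0" "w0 \<in> B0" "A0 \<times> B0 \<subseteq> S"
    using open_prod_elim[OF S p] p0 by (metis mem_Sigma_iff)
  obtain r1 where r1: "r1 > 0" "cball z0 r1 \<subseteq> A0" using AB open_contains_cball by metis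
  obtain r2 where r2: "r2 > 0" "cball w0 r2 \<subseteq> B0" using AB open_contains_cball by metis
  define r where "r = min r1 r2 / 2"
  have r: "r > 0" "cball z0 (2*r) \<subseteq> A0" "cball w0 (2*r) \<subseteq> B0"
    using r1 r2 by (auto simp: r_def subset_iff min_def)
  define K where "K = cball z0 (2*r) \<times> cball w0 (2*r)"
  have KS: "K \<subseteq> S" using r AB by (auto simp: K_def)
  have Kc: "compact K" by (auto simp: K_def intro: compact_Times)
  have uc: "uniformly_continuous_on K u"
    using compact_uniformly_continuous[OF continuous_on_subset[OF cont KS] Kc] .
  define d where "d = (\<lambda>p. deriv (\<lambda>t. u (fst p, t)) (snd p))"
  define X where "X = ball z0 r"
  define Y where "Y = ball w0 r"
  have XYS: "(x, y) \<in> S" if "x \<in> X" "y \<in> Y" for x y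
    using that KS r by (force simp: X_def Y_def K_def)
  have dc: "continuous (at (z0,w0) within X \<times> Y) d"
    unfolding continuous_within_eps_delta
  proof (intro allI impI)
    fix e :: real assume e: "e > 0"
    then have "e * r / 2 > 0" using r by simp
    then obtain \<delta> where \<delta>: "\<delta> > 0" "\<And>p q. p \<in> K \<Longrightarrow> q \<in> K \<Longrightarrow> dist q p < \<delta> \<Longrightarrow> dist (u q) (u p) < e * r / 2"
      using uc unfolding uniformly_continuous_on_def by metis
    have "dist (d q) (d (z0, w0)) < e" if q: "q \<in> X \<times> Y" "dist q (z0, w0) < \<delta>" for q
    proof -
      obtain x y where xy: "q = (x, y)" "x \<in> X" "y \<in> Y" using q by auto
      define k where "k = (\<lambda>t. u (x, y + t) - u (z0, w0 + t))"
      have in1: "(x, y + t) \<in> K" "(z0, w0 + t) \<in> K" if "t \<in> cball 0 r" for t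
      proof -
        have "dist w0 (y + t) \<le> dist w0 y + norm t"
          using norm_triangle_ineq4[of "w0 - y" t] by (simp add: dist_norm algebra_simps)
        then show "(x, y + t) \<in> K" "(z0, w0 + t) \<in> K"
          using that xy r by (auto simp: K_def X_def Y_def dist_norm)
      qed
      have der: "((\<lambda>t. u (a, b + t)) has_field_derivative deriv (\<lambda>t. u (a, t)) (b + t)) (at t)"
        if "(a, b + t) \<in> S" for a b t
      proof -
        have "((\<lambda>t. u (a, t)) has_field_derivative deriv (\<lambda>t. u (a, t)) (b + t)) (at (t + b))"
          using d2[OF that] by (simp add: field_differentiable_derivI add.commute)
        then show ?thesis
          using DERIV_shift[of "\<lambda>t. u (a, t)" _ t b] by (simp add: add.commute)
      qed
      have kd: "(k has_field_derivative (deriv (\<lambda>t. u (x, t)) (y + t) - deriv (\<lambda>t. u (z0, t)) (w0 + t))) (at t)"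
        if "t \<in> cball 0 r" for t
        unfolding k_def using in1[OF that] KS by (intro derivative_intros der) auto
      have "k holomorphic_on cball 0 r"
        unfolding holomorphic_on_def field_differentiable_def
        using kd DERIV_subset by blast
      moreover have "norm (k t) \<le> e * r / 2" if "t \<in> cball 0 r" for t
      proof -
        have "dist (x, y + t) (z0, w0 + t) = dist (x, y) (z0, w0)"
          by (simp add: dist_Pair_Pair dist_norm)
        then show ?thesis
          using \<delta>(2)[OF in1(2)[OF that] in1(1)[OF that]] q xy unfolding k_def by (simp add: dist_norm)
      qed
      ultimately have "norm (deriv k 0) \<le> (e * r / 2) / r"
        using r by (intro holomorphic_deriv_bound[of k "cball 0 r"]) auto
      also have "\<dots> < e" using r e by simp
      finally have "norm (deriv k 0) < e" .
      moreover have "deriv k 0 = d q - d (z0, w0)"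
        using DERIV_imp_deriv[OF kd[of 0]] r by (simp add: d_def xy)
      ultimately show ?thesis by (simp add: dist_norm)
    qed
    then show "\<exists>\<delta>>0. \<forall>q\<in>X \<times> Y. dist q (z0, w0) < \<delta> \<longrightarrow> dist (d q) (d (z0, w0)) < e"
      using \<delta>(1) by blast
  qed
  define fy where "fy = (\<lambda>x y. blinfun_mult_right (d (x, y)))"
  obtain c where c: "((\<lambda>t. u (t, w0)) has_field_derivative c) (at z0)"
    using d1 p p0 field_differentiable_def by blast
  have "((\<lambda>(x, y). u (x, y)) has_derivative (\<lambda>(tx, ty). c * tx + fy z0 w0 ty)) (at (z0, w0) within X \<times> Y)"
  proof (rule has_derivative_partialsI)
    show "((\<lambda>x. u (x, w0)) has_derivative (*) c) (at z0 within X)"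
      using c has_derivative_at_withinI unfolding has_field_derivative_def by blast
    show "((\<lambda>y. u (x, y)) has_derivative blinfun_apply (fy x y)) (at y within Y)" if "x \<in> X" "y \<in> Y" for x y
    proof -
      have "((\<lambda>t. u (x, t)) has_field_derivative d (x, y)) (at y)"
        using d2[OF XYS[OF that]] by (simp add: field_differentiable_derivI d_def)
      then show ?thesis
        unfolding fy_def has_field_derivative_def using has_derivative_at_withinI by fastforce
    qed
    have "continuous (at (z0,w0) within X \<times> Y) (\<lambda>q. blinfun_mult_right (d q))"
      using dc unfolding continuous_within
      by (rule bounded_linear.tendsto[OF bounded_linear_blinfun_mult_right])
    then show "continuous (at (z0, w0) within X \<times> Y) (\<lambda>(x, y). fy x y)"
      by (simp add: fy_def case_prod_unfold)
  qed (use r in \<open>auto simp: Y_def\<close>)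
  then have "(u has_derivative (\<lambda>(tx, ty). c * tx + d (z0, w0) * ty)) (at (z0, w0) within X \<times> Y)"
    by (simp add: fy_def case_prod_unfold)
  moreover have "open (X \<times> Y)" "(z0, w0) \<in> X \<times> Y" using r by (auto simp: X_def Y_def open_Times)
  ultimately have "(u has_derivative (\<lambda>(tx, ty). c * tx + d (z0, w0) * ty)) (at p)"
    using at_within_open p0 by metis
  then show "\<exists>D. (u has_derivative D) (at p) \<and> (\<forall>c v. D (cscale2 c v) = c * D v)"
    by (intro exI[of _ "\<lambda>(tx, ty). c * tx + d (z0, w0) * ty"] conjI)
      (auto simp: cscale2_def case_prod_unfold algebra_simps)
qed

text \<open>
  Continuity and holomorphy in each variable pass to uniform limits, so Osgood's lemma applies
  to the limit.
\<close>

lemma holo_fun_uniform_limit: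
  assumes S: "open S" and h: "\<And>n. holo_fun (U n) S" and lim: "uniform_limit S U v sequentially"
  shows "holo_fun v S"
proof (rule holo_fun_separately[OF S])
  show "continuous_on S v"
    by (rule uniform_limit_theorem[OF _ lim]) (use h holo_fun_continuous_on in auto)
next
  fix z w assume zw: "(z, w) \<in> S"
  define T where "T = (\<lambda>t. (t, w)) -` S"
  have T: "open T" unfolding T_def by (intro open_vimage S continuous_intros)
  have "(\<lambda>t. v (t, w)) holomorphic_on T"
  proof (rule holomorphic_uniform_sequence[OF T])
    show "(\<lambda>t. U n (t, w)) holomorphic_on T" for n
      by (rule holo_fun_fst_slice[OF h S]) (simp add: T_def)
    show "\<exists>d>0. cball x d \<subseteq> T \<and> uniform_limit (cball x d) (\<lambda>n t. U n (t, w)) (\<lambda>t. v (t, w)) sequentially"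
      if x: "x \<in> T" for x
    proof -
      obtain d where d: "d > 0" "cball x d \<subseteq> T" using T x open_contains_cball by metis
      then have "uniform_limit (cball x d) (\<lambda>n t. U n (t, w)) (\<lambda>t. v (t, w)) sequentially"
        using uniform_limit_compose'[OF lim, of "\<lambda>t. (t, w)" "cball x d"] by (auto simp: T_def)
      with d show ?thesis by blast
    qed
  qed
  then show "(\<lambda>t. v (t, w)) field_differentiable at z"
    using T zw by (metis T_def holomorphic_on_imp_differentiable_at vimage_eq)
next
  fix z w assume zw: "(z, w) \<in> S"
  define T where "T = (\<lambda>t. (z, t)) -` S"
  have T: "open T" unfolding T_def by (intro open_vimage S continuous_intros)
  have "(\<lambda>t. v (z, t)) holomorphic_on T"
  proof (rule holomorphic_uniform_sequence[OF T])
    show "(\<lambda>t. U n (z, t)) holomorphic_on T" for n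
      by (rule holo_fun_snd_slice[OF h S]) (simp add: T_def)
    show "\<exists>d>0. cball x d \<subseteq> T \<and> uniform_limit (cball x d) (\<lambda>n t. U n (z, t)) (\<lambda>t. v (z, t)) sequentially"
      if x: "x \<in> T" for x
    proof -
      obtain d where d: "d > 0" "cball x d \<subseteq> T" using T x open_contains_cball by metis
      then have "uniform_limit (cball x d) (\<lambda>n t. U n (z, t)) (\<lambda>t. v (z, t)) sequentially"
        using uniform_limit_compose'[OF lim, of "\<lambda>t. (z, t)" "cball x d"] by (auto simp: T_def)
      with d show ?thesis by blast
    qed
  qed
  then show "(\<lambda>t. v (z, t)) field_differentiable at w"
    using T zw by (metis T_def holomorphic_on_imp_differentiable_at vimage_eq)
qed

section \<open>Cauchy estimates\<close>

lemma holomorphic_Lipschitz: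
  assumes "h holomorphic_on T" "open T" "convex A" "r > 0" "\<And>x. x \<in> A \<Longrightarrow> cball x r \<subseteq> T"
    "\<And>x. x \<in> T \<Longrightarrow> norm (h x) \<le> B" "x \<in> A" "y \<in> A"
  shows "norm (h x - h y) \<le> B / r * norm (x - y)"
proof (rule field_differentiable_bound[OF assms(3)])
  show "(h has_field_derivative deriv h z) (at z within A)" if "z \<in> A" for z
    using assms(1,2,4) assms(5)[OF that] has_field_derivative_at_within holomorphic_derivI
    by (metis centre_in_cball less_le subsetD)
  show "norm (deriv h z) \<le> B / r" if "z \<in> A" for z
    using assms(4-6) that by (intro holomorphic_deriv_bound[OF assms(1)]) blast+
qed (use assms in auto)

text \<open>
  A bound on a neighbourhood of width \<open>r\<close> bounds the variation, moving first in one variable and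
  then in the other.  The half planes to which this is applied are unbounded, hence the
  formulation without compactness.
\<close>

lemma holo_fun_Lipschitz:
  assumes u: "holo_fun u (T1 \<times> T2)" and T: "open T1" "open T2" and A: "convex A1" "convex A2" "r > 0"
    and A1: "\<And>x. x \<in> A1 \<Longrightarrow> cball x r \<subseteq> T1" and A2: "\<And>x. x \<in> A2 \<Longrightarrow> cball x r \<subseteq> T2"
    and B: "\<And>p. p \<in> T1 \<times> T2 \<Longrightarrow> norm (u p) \<le> B"
    and p: "p \<in> A1 \<times> A2" and q: "q \<in> A1 \<times> A2"
  shows "norm (u p - u q) \<le> B / r * (norm (fst p - fst q) + norm (snd p - snd q))"
proof -
  obtain x y x' y' where pq: "p = (x, y)" "q = (x', y')" by (metis surj_pair)
  have sub: "A1 \<subseteq> T1" "A2 \<subseteq> T2" using A1 A2 A(3) by (meson centre_in_cball less_imp_le subsetI subsetD)+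
  have o: "open (T1 \<times> T2)" using T by (rule open_Times)
  have "norm (u (x, y) - u (x', y)) \<le> B / r * norm (x - x')"
    by (rule holomorphic_Lipschitz[of "\<lambda>t. u (t, y)" T1 A1])
      (use p q pq sub A T A1 B in \<open>auto intro!: holo_fun_fst_slice[OF u o]\<close>)
  moreover have "norm (u (x', y) - u (x', y')) \<le> B / r * norm (y - y')"
    by (rule holomorphic_Lipschitz[of "\<lambda>t. u (x', t)" T2 A2])
      (use p q pq sub A T A2 B in \<open>auto intro!: holo_fun_snd_slice[OF u o]\<close>)
  moreover have "u p - u q = (u (x, y) - u (x', y)) + (u (x', y) - u (x', y'))"
    by (simp add: pq)
  ultimately show ?thesis
    using norm_triangle_ineq[of "u (x, y) - u (x', y)" "u (x', y) - u (x', y')"]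
    by (simp add: pq algebra_simps)
qed

lemma holomorphic_vanishing_order1:
  assumes h: "h holomorphic_on T" and T: "open T" "cball 0 \<epsilon> \<subseteq> T" and \<epsilon>: "\<epsilon> > 0"
    and B: "\<And>x. x \<in> cball 0 \<epsilon> \<Longrightarrow> norm (h x) \<le> B"
    and h0: "h 0 = 0" and z: "norm z \<le> \<epsilon> / 2"
  shows "norm (h z) \<le> 4 * B / \<epsilon> * norm z"
proof -
  have "cball x (\<epsilon>/4) \<subseteq> ball 0 \<epsilon>" if "x \<in> cball 0 (\<epsilon>/2)" for x :: complex
  proof
    fix y assume "y \<in> cball x (\<epsilon>/4)"
    then show "y \<in> ball 0 \<epsilon>"
      using that \<epsilon> norm_triangle_ineq4[of x "x - y"] by (auto simp: dist_norm)
  qed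
  then have "norm (h z - h 0) \<le> B / (\<epsilon>/4) * norm (z - 0)"
    using assms
    by (intro holomorphic_Lipschitz[of h "ball 0 \<epsilon>" "cball 0 (\<epsilon>/2)"])
      (auto intro!: holomorphic_on_subset[OF h] simp: subset_iff)
  then show ?thesis using h0 by (simp add: mult.commute)
qed

text \<open>
  Apply the first-order estimate to the derivative, then integrate along the radius.
\<close>

lemma holomorphic_vanishing_order2:
  assumes h: "h holomorphic_on T" and T: "open T" "cball 0 \<epsilon> \<subseteq> T" and \<epsilon>: "\<epsilon> > 0"
    and B: "\<And>x. x \<in> cball 0 \<epsilon> \<Longrightarrow> norm (h x) \<le> B"
    and h0: "h 0 = 0" and h1: "deriv h 0 = 0" and z: "norm z \<le> \<epsilon> / 4"
  shows "norm (h z) \<le> 16 * B / \<epsilon>\<^sup>2 * (norm z)\<^sup>2"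
proof -
  have hd: "deriv h holomorphic_on T" using holomorphic_deriv[OF h T(1)] .
  have bd: "norm (deriv h x) \<le> B / (\<epsilon>/2)" if "x \<in> cball 0 (\<epsilon>/2)" for x
  proof (rule holomorphic_deriv_bound[of h "cball 0 \<epsilon>"])
    show "cball x (\<epsilon>/2) \<subseteq> cball 0 \<epsilon>"
    proof
      fix y assume "y \<in> cball x (\<epsilon>/2)"
      then show "y \<in> cball 0 \<epsilon>"
        using that \<epsilon> norm_triangle_ineq4[of x "x - y"] by (auto simp: dist_norm)
    qed
    then show "\<And>y. y \<in> cball x (\<epsilon> / 2) \<Longrightarrow> cmod (h y) \<le> B" using B by blast
  qed (use \<epsilon> holomorphic_on_subset[OF h T(2)] in auto)
  have bd2: "norm (deriv h x) \<le> 4 * (B / (\<epsilon>/2)) / (\<epsilon>/2) * norm x" if "norm x \<le> \<epsilon>/2/2" for x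
    by (rule holomorphic_vanishing_order1[OF hd T(1)]) (use T \<epsilon> bd h1 that in \<open>auto simp: subset_iff\<close>)
  have "norm (h z - h 0) \<le> 4 * (B / (\<epsilon>/2)) / (\<epsilon>/2) * norm z * norm (z - 0)"
  proof (rule field_differentiable_bound[of "cball 0 (norm z)" h "deriv h"])
    show "(h has_field_derivative deriv h x) (at x within cball 0 (norm z))" if "x \<in> cball 0 (norm z)" for x
      using holomorphic_derivI[OF h T(1)] T(2) \<epsilon> z that by (auto simp: subset_iff)
    show "norm (deriv h x) \<le> 4 * (B / (\<epsilon>/2)) / (\<epsilon>/2) * norm z" if "x \<in> cball 0 (norm z)" for x
    proof -
      have "0 \<le> B" using B[of 0] \<epsilon> norm_ge_zero[of "h 0"] by (metis centre_in_cball less_imp_le order_trans)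
      have "norm (deriv h x) \<le> 4 * (B / (\<epsilon>/2)) / (\<epsilon>/2) * norm x" using that z by (intro bd2) auto
      also have "\<dots> \<le> 4 * (B / (\<epsilon>/2)) / (\<epsilon>/2) * norm z"
        using that \<epsilon> \<open>0 \<le> B\<close> by (intro mult_left_mono) auto
      finally show ?thesis .
    qed
  qed auto
  then show ?thesis using h0 by (simp add: power2_eq_square field_simps)
qed

section \<open>Perturbations of the identity\<close>

text \<open>
  The derivative at each point inherits the Lipschitz bound, so it differs from the identity
  by a map of norm at most \<open>1/2\<close> and is invertible.  The inverse map is continuous by invariance
  of domain, hence differentiable, and the inverse of a complex linear map is complex linear.
\<close>

lemma near_identity_inverse:
  assumes V: "open V" and h: "holo_map T V"
    and lip: "\<And>p q. p \<in> V \<Longrightarrow> q \<in> V \<Longrightarrow> norm ((T p - p) - (T q - q)) \<le> norm (p - q) / 2"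
  shows "inj_on T V" "open (T ` V)" "holo_map (inv_into V T) (T ` V)"
proof -
  show inj: "inj_on T V"
  proof (rule inj_onI)
    fix p q assume "p \<in> V" "q \<in> V" "T p = T q"
    with lip[of p q] have "norm (p - q) \<le> norm (p - q) / 2" by (simp add: norm_minus_commute)
    then show "p = q" by simp
  qed
  have cont: "continuous_on V T" using h by (rule holo_map_continuous_on)
  show op: "open (T ` V)" by (rule invariance_of_domain[OF cont V inj])
  have ci: "continuous_on (T ` V) (inv_into V T)"
    using continuous_on_inverse_open[OF V cont, of "inv_into V T"] inj by simp
  have main: "\<exists>D'. (inv_into V T has_derivative D') (at y) \<and> (\<forall>c v. D' (cscale2 c v) = cscale2 c (D' v))"
    if y: "y \<in> T ` V" for y
  proof -
    define p where "p = inv_into V T y"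
    have p: "p \<in> V" "T p = y" using y by (auto simp: p_def inv_into_into f_inv_into_f)
    obtain D E where D: "((\<lambda>p. fst (T p)) has_derivative D) (at p)" "\<And>c v. D (cscale2 c v) = c * D v"
      and E: "((\<lambda>p. snd (T p)) has_derivative E) (at p)" "\<And>c v. E (cscale2 c v) = c * E v"
      using h V p(1) unfolding holo_map_def by (metis holo_funD)
    define L where "L = (\<lambda>v. (D v, E v))"
    have L: "(T has_derivative L) (at p)"
      using has_derivative_Pair[OF D(1) E(1)] by (simp add: L_def)
    have Lc: "L (cscale2 c v) = cscale2 c (L v)" for c v
      using D(2) E(2) by (simp add: L_def cscale2_def)
    have bl: "bounded_linear L" using L has_derivative_bounded_linear by blast
    have Lb: "norm (L v - v) \<le> norm v / 2" for v
    proof -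
      have "((\<lambda>t. p + t *\<^sub>R v) has_derivative (\<lambda>t. t *\<^sub>R v)) (at (0::real))"
        by (auto intro!: derivative_eq_intros)
      from has_derivative_compose[OF this, of T L] L
      have "((\<lambda>t. T (p + t *\<^sub>R v)) has_derivative (\<lambda>t. L (t *\<^sub>R v))) (at (0::real))" by simp
      then have "((\<lambda>t. T (p + t *\<^sub>R v) - (p + t *\<^sub>R v)) has_derivative (\<lambda>t. L (t *\<^sub>R v) - t *\<^sub>R v)) (at (0::real))"
        by (auto intro!: derivative_eq_intros)
      then have "((\<lambda>t. norm (T (p + t *\<^sub>R v) - (p + t *\<^sub>R v) - (T p - p) - (L (t *\<^sub>R v) - t *\<^sub>R v)) / norm t) \<longlongrightarrow> 0) (at (0::real))"
        unfolding has_derivative_at by simp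
      moreover have "\<forall>\<^sub>F t in at (0::real). norm (L v - v) - norm v / 2
          \<le> norm (T (p + t *\<^sub>R v) - (p + t *\<^sub>R v) - (T p - p) - (L (t *\<^sub>R v) - t *\<^sub>R v)) / norm t"
      proof -
        have "((\<lambda>t. p + t *\<^sub>R v) \<longlongrightarrow> p) (at (0::real))" by (auto intro!: tendsto_eq_intros)
        then have "\<forall>\<^sub>F t in at (0::real). p + t *\<^sub>R v \<in> V" using V p(1) by (rule topological_tendstoD)
        moreover have "\<forall>\<^sub>F t in at (0::real). t \<noteq> 0" by (simp add: eventually_at_filter)
        ultimately show ?thesis
        proof eventually_elim
          case (elim t)
          define \<Delta> where "\<Delta> = T (p + t *\<^sub>R v) - (p + t *\<^sub>R v) - (T p - p)"
          have 1: "norm \<Delta> \<le> \<bar>t\<bar> * (norm v / 2)"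
            using lip[OF elim(1) p(1)] by (simp add: \<Delta>_def)
          have 2: "L (t *\<^sub>R v) - t *\<^sub>R v = t *\<^sub>R (L v - v)"
            using linear_simps(5)[OF bl] by (simp add: scaleR_diff_right)
          have "\<bar>t\<bar> * norm (L v - v) \<le> norm \<Delta> + norm (\<Delta> - t *\<^sub>R (L v - v))"
            using norm_triangle_ineq4[of \<Delta> "\<Delta> - t *\<^sub>R (L v - v)"] by simp
          with 1 have "\<bar>t\<bar> * (norm (L v - v) - norm v / 2) \<le> norm (\<Delta> - t *\<^sub>R (L v - v))"
            by (simp add: algebra_simps)
          then show ?case using elim(2) by (simp add: 2 flip: \<Delta>_def) (simp add: field_simps)
        qed
      qed
      ultimately have "norm (L v - v) - norm v / 2 \<le> 0"
        by (rule tendsto_lowerbound) simp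
      then show ?thesis by simp
    qed
    have "inj L"
    proof (subst linear_injective_0)
      show "\<forall>v. L v = 0 \<longrightarrow> v = 0"
      proof (intro allI impI)
        fix v assume "L v = 0"
        with Lb[of v] have "norm v \<le> norm v / 2" by simp
        then show "v = 0" by simp
      qed
    qed (use bl bounded_linear.linear in blast)
    then obtain M where M: "linear M" "\<And>v. M (L v) = v" "\<And>v. L (M v) = v"
      using linear_injective_isomorphism bl bounded_linear.linear by metis
    have "(inv_into V T has_derivative M) (at y)"
    proof (rule has_derivative_inverse_basic[OF _ _ _ _ op y])
      show "(T has_derivative L) (at (inv_into V T y))" using L p_def by simp
      show "bounded_linear M" using M(1) by (simp add: linear_conv_bounded_linear)
      show "M \<circ> L = id" using M(2) by auto
      show "continuous (at y) (inv_into V T)" using ci op y continuous_on_eq_continuous_at by blast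
      show "\<And>z. z \<in> T ` V \<Longrightarrow> T (inv_into V T z) = z" by (rule f_inv_into_f)
    qed
    moreover have "M (cscale2 c v) = cscale2 c (M v)" for c v
      using Lc[of c "M v"] M by metis
    ultimately show ?thesis by blast
  qed
  show "holo_map (inv_into V T) (T ` V)"
    unfolding holo_map_def
  proof (intro conjI; rule holo_funI)
    fix y assume "y \<in> T ` V"
    from main[OF this] obtain M where M: "(inv_into V T has_derivative M) (at y)"
       "\<forall>c v. M (cscale2 c v) = cscale2 c (M v)" by blast
    show "\<exists>D. ((\<lambda>p. fst (inv_into V T p)) has_derivative D) (at y) \<and> (\<forall>c v. D (cscale2 c v) = c * D v)"
      using has_derivative_fst[OF M(1)] M(2) by (intro exI[of _ "\<lambda>v. fst (M v)"]) (auto simp: cscale2_def)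
    show "\<exists>D. ((\<lambda>p. snd (inv_into V T p)) has_derivative D) (at y) \<and> (\<forall>c v. D (cscale2 c v) = c * D v)"
      using has_derivative_snd[OF M(1)] M(2) by (intro exI[of _ "\<lambda>v. snd (M v)"]) (auto simp: cscale2_def)
  qed
qed

section \<open>The cohomological equation over the rotation\<close>

text \<open>
  Bounds the loss from the small divisors by a geometric sequence, which the Taylor series of
  an entire function absorbs.
\<close>

lemma powr_le_exp_power:
  fixes r :: real
  assumes "r > 0" "n \<ge> 1"
  shows "real n powr r \<le> r powr r * exp 1 ^ n"
proof -
  have "ln (real n / r) \<le> real n / r - 1" using assms by (intro ln_le_minus_one) auto
  then have "r * ln (real n) \<le> r * ln r + real n" using assms by (simp add: ln_div field_simps)
  then have "exp (r * ln (real n)) \<le> exp (r * ln r + real n)" by simp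
  also have "\<dots> = r powr r * exp 1 ^ n"
    using assms by (simp add: exp_add powr_def flip: exp_of_nat_mult)
  finally show ?thesis using assms by (simp add: powr_def)
qed

text \<open>
  The solution is the power series with coefficients \<open>h\<^sub>n / (\<rho> ^ n - 1)\<close>, where \<open>h\<^sub>n\<close> are the Taylor
  coefficients of \<open>h\<close>.  At \<open>w\<close> it is dominated by the series of \<open>h\<close> at \<open>exp 1 * w\<close>.
\<close>

lemma coboundary_entire:
  fixes \<rho> :: complex
  assumes c: "c > 0" and r: "r > 0"
    and dio: "\<And>n::nat. n \<ge> 1 \<Longrightarrow> norm (\<rho> ^ n - 1) \<ge> c * real n powr (- r)"
    and h: "h holomorphic_on UNIV"
  obtains H where "H holomorphic_on UNIV" "\<And>w. H (\<rho> * w) - H w = h w - h 0"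
proof -
  define hn where "hn = (\<lambda>n. (deriv ^^ n) h 0 / fact n)"
  have hs: "(\<lambda>n. hn n * w ^ n) sums h w" for w
    using holomorphic_power_series[of h 0 "norm w + 1" w] h holomorphic_on_subset[OF h] 
    by (auto simp: hn_def)
  define d where "d = (\<lambda>n. if n = 0 then 0 else hn n / (\<rho> ^ n - 1))"
  have nz: "\<rho> ^ n - 1 \<noteq> 0" if "n \<ge> 1" for n
  proof -
    have "0 < c * real n powr (- r)" using c that by simp
    with dio[OF that] show ?thesis by auto
  qed
  have dn: "norm (d n * w ^ n) \<le> r powr r / c * norm (hn n * (of_real (exp 1) * w) ^ n)" for n w
  proof (cases "n = 0")
    case True
    then show ?thesis using c by (simp add: d_def)
  next
    case False
    then have n: "n \<ge> 1" by simp
    have pos: "0 < c * real n powr (- r)" using c n by simp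
    have "1 / norm (\<rho> ^ n - 1) \<le> 1 / (c * real n powr (- r))"
      using dio[OF n] pos by (intro divide_left_mono) (auto intro: mult_pos_pos order_less_le_trans)
    also have "\<dots> = real n powr r / c" using n c by (simp add: powr_minus field_simps)
    also have "\<dots> \<le> r powr r * exp 1 ^ n / c"
      using powr_le_exp_power[OF r n] c by (intro divide_right_mono) auto
    finally have "norm (hn n) * norm (w ^ n) * (1 / norm (\<rho> ^ n - 1))
        \<le> norm (hn n) * norm (w ^ n) * (r powr r * exp 1 ^ n / c)"
      by (intro mult_left_mono) auto
    then show ?thesis using False
      by (simp add: d_def norm_mult norm_divide norm_power power_mult_distrib field_simps)
  qed
  have sd: "summable (\<lambda>n. d n * w ^ n)" for w
  proof (rule summable_comparison_test)
    define x where "x = (of_real (norm (of_real (exp 1) * w) + 1) :: complex)"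
    have "norm (of_real (exp 1) * w) < norm x" by (simp add: x_def del: of_real_add)
    from powser_insidea[OF sums_summable[OF hs[of x]] this]
    show "summable (\<lambda>n. r powr r / c * norm (hn n * (of_real (exp 1) * w) ^ n))"
      by (rule summable_mult)
  qed (use dn in blast)
  define H where "H = (\<lambda>w. \<Sum>n. d n * w ^ n)"
  have "(H has_field_derivative (\<Sum>n. diffs d n * w ^ n)) (at w)" for w
    unfolding H_def by (rule termdiffs_strong_converges_everywhere[OF sd])
  then have hol: "H holomorphic_on UNIV"
    unfolding holomorphic_on_def field_differentiable_def using DERIV_subset by blast
  have "H (\<rho> * w) - H w = h w - h 0" for w
  proof -
    have 1: "(\<lambda>n. d n * (\<rho> * w) ^ n - d n * w ^ n) sums (H (\<rho> * w) - H w)"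
      unfolding H_def by (intro sums_diff summable_sums sd)
    have "(\<lambda>n. if n = 0 then h 0 else 0) sums h 0"
      using sums_single[of 0 "\<lambda>_. h 0"] by simp
    from sums_diff[OF hs[of w] this]
    have 2: "(\<lambda>n. hn n * w ^ n - (if n = 0 then h 0 else 0)) sums (h w - h 0)" .
    have "hn n * w ^ n - (if n = 0 then h 0 else 0) = d n * (\<rho> * w) ^ n - d n * w ^ n" for n
    proof (cases "n = 0")
      case True
      then show ?thesis by (simp add: d_def hn_def)
    next
      case False
      then have "d n * (\<rho> ^ n - 1) = hn n" using nz[of n] by (simp add: d_def)
      then have "d n * (\<rho> * w) ^ n - d n * w ^ n = hn n * w ^ n"
        by (metis (no_types, lifting) left_diff_distrib mult.assoc mult.commute mult_1 power_mult_distrib)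
      then show ?thesis using False by simp
    qed
    with 1 2 show ?thesis by (simp add: sums_iff)
  qed
  with hol show ?thesis by (rule that)
qed

text \<open>
  Dividing by \<open>w\<close> reduces the twisted equation to the previous one.  The quotient \<open>g w / w\<close> must
  vanish at \<open>0\<close>, for the linear term of \<open>g\<close> is resonant.
\<close>

lemma twisted_coboundary_entire:
  fixes \<rho> :: complex
  assumes c: "c > 0" and r: "r > 0" and \<rho>: "\<rho> \<noteq> 0"
    and dio: "\<And>n::nat. n \<ge> 1 \<Longrightarrow> norm (\<rho> ^ n - 1) \<ge> c * real n powr (- r)"
    and g: "g holomorphic_on UNIV" and g0: "g 0 = 0" "deriv g 0 = 0"
  obtains G where "G holomorphic_on UNIV" "\<And>w. G (\<rho> * w) - \<rho> * G w = g w"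
proof -
  define k where "k = (\<lambda>w. if w = 0 then deriv g 0 else (g w - g 0) / (w - 0))"
  have k: "k holomorphic_on UNIV"
    unfolding k_def by (rule pole_lemma_open[OF g open_UNIV])
  have k0: "k 0 = 0" and kg: "w * k w = g w" for w using g0 by (auto simp: k_def)
  obtain H where H: "H holomorphic_on UNIV" "\<And>w. H (\<rho> * w) - H w = k w - k 0"
    using coboundary_entire[OF c r dio k] by blast
  have "(\<lambda>w. w * H w / \<rho>) holomorphic_on UNIV" using H(1) \<rho> by (intro holomorphic_intros) auto
  moreover have "\<rho> * w * H (\<rho> * w) / \<rho> - \<rho> * (w * H w / \<rho>) = g w" for w
  proof -
    have "\<rho> * w * H (\<rho> * w) / \<rho> - \<rho> * (w * H w / \<rho>) = w * (H (\<rho> * w) - H w)"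
      using \<rho> by (simp add: field_simps)
    then show ?thesis using H(2) k0 kg by simp
  qed
  ultimately show ?thesis using that by blast
qed


section \<open>Functions vanishing on the invariant line\<close>

lemma compact_bidisc_bound:
  fixes u :: "complex2 \<Rightarrow> complex"
  assumes "continuous_on (cball 0 \<epsilon> \<times> cball 0 R) u"
  obtains B where "B > 0" "\<And>z w. norm z \<le> \<epsilon> \<Longrightarrow> norm w \<le> R \<Longrightarrow> norm (u (z, w)) \<le> B"
proof -
  have "compact (u ` (cball 0 \<epsilon> \<times> cball 0 R))"
    by (intro compact_continuous_image assms compact_Times compact_cball)
  then obtain B where "B > 0" "\<forall>y \<in> u ` (cball 0 \<epsilon> \<times> cball 0 R). norm y \<le> B"
    using compact_imp_bounded bounded_pos by metis
  then show ?thesis by (intro that[of B]) auto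
qed

lemma holo_fun_vanishing_order1:
  assumes u: "holo_fun u S" "open S" and sub: "cball 0 \<epsilon> \<times> cball 0 R \<subseteq> S" and \<epsilon>: "\<epsilon> > 0"
    and u0: "\<And>w. norm w \<le> R \<Longrightarrow> u (0, w) = 0"
  obtains C where "C > 0" "\<And>z w. norm z \<le> \<epsilon> / 4 \<Longrightarrow> norm w \<le> R \<Longrightarrow> norm (u (z, w)) \<le> C * norm z"
proof -
  obtain B where B: "B > 0" "\<And>z w. norm z \<le> \<epsilon> \<Longrightarrow> norm w \<le> R \<Longrightarrow> norm (u (z, w)) \<le> B"
    using compact_bidisc_bound continuous_on_subset[OF holo_fun_continuous_on[OF u(1)] sub] by metis
  have sub': "(x, w) \<in> S" if "norm x \<le> \<epsilon>" "norm w \<le> R" for x w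
    using sub that by auto
  have "norm (u (z, w)) \<le> 4 * B / \<epsilon> * norm z" if "norm z \<le> \<epsilon> / 4" "norm w \<le> R" for z w
  proof (rule holomorphic_vanishing_order1[of "\<lambda>t. u (t, w)" "(\<lambda>t. (t, w)) -` S"])
    show "(\<lambda>t. u (t, w)) holomorphic_on (\<lambda>t. (t, w)) -` S"
      by (rule holo_fun_fst_slice[OF u]) simp
    show "open ((\<lambda>t. (t, w)) -` S)" by (intro open_vimage u(2) continuous_intros)
  qed (use that sub' B \<epsilon> u0 in auto)
  then show ?thesis using that[of "4 * B / \<epsilon>"] B(1) \<epsilon> by simp
qed

lemma holo_fun_vanishing_order2:
  assumes u: "holo_fun u S" "open S" and sub: "cball 0 \<epsilon> \<times> cball 0 R \<subseteq> S" and \<epsilon>: "\<epsilon> > 0"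
    and u0: "\<And>w. norm w \<le> R \<Longrightarrow> u (0, w) = 0"
    and u1: "\<And>w. norm w \<le> R \<Longrightarrow> deriv (\<lambda>t. u (t, w)) 0 = 0"
  obtains C where "C > 0" "\<And>z w. norm z \<le> \<epsilon> / 4 \<Longrightarrow> norm w \<le> R \<Longrightarrow> norm (u (z, w)) \<le> C * (norm z)\<^sup>2"
proof -
  obtain B where B: "B > 0" "\<And>z w. norm z \<le> \<epsilon> \<Longrightarrow> norm w \<le> R \<Longrightarrow> norm (u (z, w)) \<le> B"
    using compact_bidisc_bound continuous_on_subset[OF holo_fun_continuous_on[OF u(1)] sub] by metis
  have sub': "(x, w) \<in> S" if "norm x \<le> \<epsilon>" "norm w \<le> R" for x w
    using sub that by auto
  have "norm (u (z, w)) \<le> 16 * B / \<epsilon>\<^sup>2 * (norm z)\<^sup>2" if "norm z \<le> \<epsilon> / 4" "norm w \<le> R" for z w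
  proof (rule holomorphic_vanishing_order2[of "\<lambda>t. u (t, w)" "(\<lambda>t. (t, w)) -` S"])
    show "(\<lambda>t. u (t, w)) holomorphic_on (\<lambda>t. (t, w)) -` S"
      by (rule holo_fun_fst_slice[OF u]) simp
    show "open ((\<lambda>t. (t, w)) -` S)" by (intro open_vimage u(2) continuous_intros)
  qed (use that sub' B \<epsilon> u0 u1 in auto)
  then show ?thesis using that[of "16 * B / \<epsilon>\<^sup>2"] B(1) \<epsilon> by simp
qed

section \<open>The normal form near the invariant line\<close>

text \<open>
  The functions \<open>H\<close>, \<open>G\<close>, \<open>K\<close> solve the three cohomological equations that remove the dependence on
  \<open>w\<close> from the terms of lowest order.  The right-hand side for \<open>K\<close> is, up to sign, the coefficient
  of \<open>z\<close> that is left in the first component after the corrections by \<open>H\<close> and by \<open>\<beta>\<close> times a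
  logarithm; the logarithm accounts for the mean value, which no function of \<open>w\<close> can remove.
\<close>

locale parabolic_map =
  fixes F :: "complex2 \<Rightarrow> complex2" and \<rho> \<kappa> \<beta> :: complex
    and f g H G K :: "complex \<Rightarrow> complex" and a b :: "complex2 \<Rightarrow> complex"
  assumes aut: "automorphism_C2 F"
    and hol_f: "f holomorphic_on UNIV" and hol_g: "g holomorphic_on UNIV"
    and hol_a: "holo_fun a UNIV" and hol_b: "holo_fun b UNIV"
    and F_eq: "\<And>z w. F (z, w) =
           (z + f w * z ^ 2 + z ^ 3 * a (z, w), \<rho> * w + g w * z + z ^ 2 * b (z, w))"
    and \<kappa>: "\<kappa> \<noteq> 0" and \<rho>: "norm \<rho> = 1"
    and hol_H: "H holomorphic_on UNIV" and hol_G: "G holomorphic_on UNIV" and hol_K: "K holomorphic_on UNIV"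
    and H_eq: "\<And>w. H (\<rho> * w) - H w = 1 - f w / \<kappa>"
    and G_eq: "\<And>w. G (\<rho> * w) - \<rho> * G w = g w"
    and K_eq: "\<And>w. K (\<rho> * w) - K w =
                \<beta> * f w - (a (0, w) - f w ^ 2) / \<kappa> - deriv H (\<rho> * w) * g w"
begin

text \<open>
  The first component of \<open>F p\<close> is \<open>fst p * (1 + s p)\<close>.  In the coordinate \<open>U\<close> the parabolic fixed
  point sits at infinity; \<open>X\<close> moves by \<open>1 + O(z)\<close> and \<open>A\<close> by \<open>1 + O(z\<^sup>2)\<close>, and \<open>Y\<close> is rotated up to
  \<open>O(z\<^sup>2)\<close>.  The deviations \<open>X_err\<close> and \<open>A_err\<close> are given by formulas in which the pole of \<open>U\<close> has
  cancelled, so that they make sense and are holomorphic across the line \<open>z = 0\<close>.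
\<close>

definition s where "s p = f (snd p) * fst p + a p * fst p ^ 2"
definition U where "U p = - 1 / (\<kappa> * fst p)"
definition X where "X p = U p + H (snd p)"
definition A where "A p = X p + K (snd p) * fst p + \<beta> * Ln (U p)"
definition Y where "Y p = snd p - fst p * G (snd p)"
definition X_err where "X_err p = (f (snd p) + a p * fst p) / (\<kappa> * (1 + s p)) + H (snd (F p)) - H (snd p) - 1"
definition A_err where
  "A_err p = X_err p + K (snd (F p)) * fst (F p) - K (snd p) * fst p - \<beta> * Ln (1 + s p)"
definition Y_err where "Y_err p = Y (F p) - \<rho> * Y p"

lemma \<rho>_nz: "\<rho> \<noteq> 0" using \<rho> by auto

lemma fst_F: "fst (F p) = fst p * (1 + s p)"
  by (cases p) (simp add: F_eq s_def algebra_simps power2_eq_square power3_eq_cube)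

lemma snd_F: "snd (F (z, w)) = \<rho> * w + g w * z + z ^ 2 * b (z, w)"
  by (simp add: F_eq)

lemma holo_F: "holo_map F UNIV"
  using aut by (simp add: automorphism_C2_def biholomorphic_map_def)

lemma bij_F: "bij F"
  using aut by (simp add: automorphism_C2_def biholomorphic_map_def)

lemma holo_F_inv: "holo_map (inv F) UNIV"
  using aut by (simp add: automorphism_C2_def biholomorphic_map_def)

lemma holo_fst_F: "holo_fun (\<lambda>p. fst (F p)) UNIV" and holo_snd_F: "holo_fun (\<lambda>p. snd (F p)) UNIV"
  using holo_F by (auto simp: holo_map_def)

lemma holo_s: "holo_fun s UNIV"
  unfolding s_def by (intro holo_fun_intros holo_fun_entire[OF hol_f] hol_a)

lemma open_s: "open {p. norm (s p) < 1}"
proof -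
  have "continuous_on UNIV (\<lambda>p. norm (s p))"
    using holo_fun_continuous_on[OF holo_s] by (intro continuous_intros)
  then show ?thesis using open_Collect_less[of "\<lambda>p. norm (s p)" "\<lambda>_. 1"] by simp
qed

lemma one_plus_s_slit: "norm (s p) < 1 \<Longrightarrow> 1 + s p \<notin> \<real>\<^sub>\<le>\<^sub>0"
  using abs_Re_le_cmod[of "s p"] by (auto simp: complex_nonpos_Reals_iff)

lemma holo_X_err: "holo_fun X_err {p. norm (s p) < 1}"
proof -
  have "1 + s p \<noteq> 0" if "norm (s p) < 1" for p
    using one_plus_s_slit[OF that] by auto
  then show ?thesis unfolding X_err_def
    by (intro holo_fun_intros holo_fun_divide holo_fun_entire[OF hol_f] holo_fun_entire[OF hol_H]
        holo_fun_subset[OF hol_a] holo_fun_subset[OF holo_s] holo_fun_subset[OF holo_snd_F])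
      (auto simp: \<kappa>)
qed

lemma holo_A_err: "holo_fun A_err {p. norm (s p) < 1}"
proof -
  have "holo_fun (\<lambda>p. Ln (1 + s p)) {p. norm (s p) < 1}"
    by (rule holo_fun_comp[of "\<lambda>p. 1 + s p" _ Ln "- \<real>\<^sub>\<le>\<^sub>0"])
      (use one_plus_s_slit in \<open>auto intro!: holo_fun_intros holo_fun_subset[OF holo_s] holomorphic_intros\<close>)
  then show ?thesis unfolding A_err_def
    by (intro holo_fun_intros holo_X_err holo_fun_entire[OF hol_K]
        holo_fun_subset[OF holo_fst_F] holo_fun_subset[OF holo_snd_F]) auto
qed

lemma holo_Y: "holo_fun Y UNIV"
  unfolding Y_def by (intro holo_fun_intros holo_fun_entire[OF hol_G])

lemma holo_Y_err: "holo_fun Y_err UNIV"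
  unfolding Y_err_def by (intro holo_fun_intros holo_Y holo_fun_compose[OF holo_Y holo_F]) auto

lemma X_F:
  assumes "fst p \<noteq> 0" "1 + s p \<noteq> 0"
  shows "X (F p) = X p + 1 + X_err p"
proof -
  have "U (F p) - U p = (f (snd p) + a p * fst p) / (\<kappa> * (1 + s p))"
  proof -
    define S where "S = 1 + s p"
    have "f (snd p) + a p * fst p = (S - 1) / fst p"
      using assms(1) by (simp add: S_def s_def field_simps power2_eq_square)
    moreover have "S \<noteq> 0" using assms(2) by (simp add: S_def)
    ultimately show ?thesis using assms(1) \<kappa>
      by (simp add: U_def fst_F flip: S_def) (simp add: field_simps)
  qed
  then show ?thesis by (simp add: X_def X_err_def algebra_simps)
qed

text \<open>
  The real parts are positive to keep the principal logarithms of \<open>U p = U (F p) * (1 + s p)\<close>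
  additive.
\<close>

lemma A_F:
  assumes "fst p \<noteq> 0" "norm (s p) < 1" "Re (U p) > 0" "Re (U (F p)) > 0"
  shows "A (F p) = A p + 1 + A_err p"
proof -
  have s0: "1 + s p \<noteq> 0" using one_plus_s_slit[OF assms(2)] by auto
  have Re1: "Re (1 + s p) > 0" using assms(2) abs_Re_le_cmod[of "s p"] by simp
  have "U p = U (F p) * (1 + s p)"
    using assms(1) \<kappa> s0 by (simp add: U_def fst_F)
  moreover have "Ln (U (F p) * (1 + s p)) = Ln (U (F p)) + Ln (1 + s p)"
    using Re_Ln_pos_lt_imp[OF Re1] Re_Ln_pos_lt_imp[OF assms(4)] s0 assms(4)
    by (intro Ln_times_simple) auto
  ultimately have "Ln (U (F p)) = Ln (U p) - Ln (1 + s p)" by simp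
  then show ?thesis
    using X_F[OF assms(1) s0] by (simp add: A_def A_err_def right_diff_distrib)
qed

lemma entire_DERIV: "h holomorphic_on UNIV \<Longrightarrow> (h has_field_derivative deriv h x) (at x)"
  by (simp add: holomorphic_derivI)

lemma slice_DERIV:
  assumes "holo_fun u UNIV"
  shows "((\<lambda>t. u (t, w)) has_field_derivative deriv (\<lambda>t. u (t, w)) z) (at z)"
  by (rule entire_DERIV, rule holo_fun_fst_slice[OF assms]) auto

lemma s_line: "s (0, w) = 0"
  by (simp add: s_def)

lemma s_DERIV: "((\<lambda>t. s (t, w)) has_field_derivative f w) (at 0)"
  unfolding s_def by (auto intro!: derivative_eq_intros slice_DERIV[OF hol_a])

lemma snd_F_DERIV: "((\<lambda>t. snd (F (t, w))) has_field_derivative g w) (at 0)"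
  unfolding snd_F by (auto intro!: derivative_eq_intros slice_DERIV[OF hol_b])

lemma fst_F_DERIV: "((\<lambda>t. fst (F (t, w))) has_field_derivative 1) (at 0)"
proof -
  have "((\<lambda>t. t * (1 + s (t, w))) has_field_derivative 1) (at 0)"
    by (auto intro!: derivative_eq_intros s_DERIV simp: s_line)
  then show ?thesis by (simp add: fst_F)
qed

lemma comp_snd_F_DERIV:
  assumes "h holomorphic_on UNIV"
  shows "((\<lambda>t. h (snd (F (t, w)))) has_field_derivative deriv h (\<rho> * w) * g w) (at 0)"
  using DERIV_chain2[OF entire_DERIV[OF assms] snd_F_DERIV[of w]] by (simp add: snd_F)

lemma X_err_line: "X_err (0, w) = 0"
  using H_eq[of w] \<kappa> by (simp add: X_err_def s_def snd_F algebra_simps)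

lemma A_err_line: "A_err (0, w) = 0"
  by (simp add: A_err_def X_err_line fst_F s_def)

lemma Y_err_line: "Y_err (0, w) = 0"
  by (simp add: Y_err_def Y_def fst_F snd_F)

text \<open>
  Together with \<open>A_err_line\<close> this is where the equations for \<open>H\<close>, \<open>K\<close> and \<open>\<beta>\<close> are used: the expansion
  of \<open>A_err\<close> in powers of \<open>z\<close> has no terms of order less than two.
\<close>

lemma A_err_deriv: "deriv (\<lambda>t. A_err (t, w)) 0 = 0"
proof (rule DERIV_imp_deriv)
  have Ln: "((\<lambda>t. Ln (1 + s (t, w))) has_field_derivative f w) (at 0)"
    by (auto intro!: derivative_eq_intros s_DERIV simp: s_line)
  have num: "((\<lambda>t. f w + a (t, w) * t) has_field_derivative a (0, w)) (at 0)"
    by (auto intro!: derivative_eq_intros slice_DERIV[OF hol_a])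
  have den: "((\<lambda>t. \<kappa> * (1 + s (t, w))) has_field_derivative \<kappa> * f w) (at 0)"
    by (auto intro!: derivative_eq_intros s_DERIV)
  have quot: "((\<lambda>t. (f w + a (t, w) * t) / (\<kappa> * (1 + s (t, w)))) has_field_derivative
      (a (0, w) - f w ^ 2) / \<kappa>) (at 0)"
    by (rule DERIV_cong[OF DERIV_divide[OF num den]]) (use \<kappa> in \<open>auto simp: s_line field_simps power2_eq_square\<close>)
  have KF: "((\<lambda>t. K (snd (F (t, w))) * fst (F (t, w))) has_field_derivative K (\<rho> * w)) (at 0)"
    using DERIV_mult[OF comp_snd_F_DERIV[OF hol_K] fst_F_DERIV] by (simp add: fst_F snd_F)
  have Kt: "((\<lambda>t. K w * t) has_field_derivative K w) (at 0)"
    by (auto intro!: derivative_eq_intros)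
  have "((\<lambda>t. (f w + a (t, w) * t) / (\<kappa> * (1 + s (t, w))) + H (snd (F (t, w))) - H w - 1
      + K (snd (F (t, w))) * fst (F (t, w)) - K w * t - \<beta> * Ln (1 + s (t, w))) has_field_derivative
      (a (0, w) - f w ^ 2) / \<kappa> + deriv H (\<rho> * w) * g w - 0 - 0 + K (\<rho> * w) - K w - \<beta> * f w) (at 0)"
    by (intro DERIV_add DERIV_diff DERIV_const quot comp_snd_F_DERIV[OF hol_H] KF Kt DERIV_cmult Ln)
  then show "((\<lambda>t. A_err (t, w)) has_field_derivative 0) (at 0)"
    using K_eq[of w] by (simp add: A_err_def X_err_def algebra_simps)
qed

lemma Y_err_deriv: "deriv (\<lambda>t. Y_err (t, w)) 0 = 0"
proof (rule DERIV_imp_deriv)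
  have GF: "((\<lambda>t. fst (F (t, w)) * G (snd (F (t, w)))) has_field_derivative G (\<rho> * w)) (at 0)"
    using DERIV_mult[OF fst_F_DERIV comp_snd_F_DERIV[OF hol_G]] by (simp add: fst_F snd_F)
  have Y: "((\<lambda>t. \<rho> * (w - t * G w)) has_field_derivative \<rho> * - G w) (at 0)"
    by (auto intro!: derivative_eq_intros)
  show "((\<lambda>t. Y_err (t, w)) has_field_derivative 0) (at 0)"
    unfolding Y_err_def Y_def fst_conv snd_conv
    by (rule DERIV_cong[OF DERIV_diff[OF DERIV_diff[OF snd_F_DERIV[of w] GF] Y]])
      (simp add: algebra_simps flip: G_eq[of w])
qed

text \<open>
  Vanishing on the line to first or second order turns, by compactness, into estimates that
  are uniform for bounded \<open>w\<close>.
\<close>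

lemma local_bounds:
  assumes "R > 0"
  obtains \<epsilon> C where "\<epsilon> > 0" "C > 0"
    "\<And>w. norm w \<le> R \<Longrightarrow> norm (H w) \<le> C \<and> norm (G w) \<le> C \<and> norm (K w) \<le> C"
    "\<And>p. norm (fst p) \<le> \<epsilon> \<Longrightarrow> norm (snd p) \<le> R \<Longrightarrow>
        norm (s p) \<le> 1 / 2 \<and> norm (X_err p) \<le> C * norm (fst p)
      \<and> norm (A_err p) \<le> C * (norm (fst p))\<^sup>2 \<and> norm (Y_err p) \<le> C * (norm (fst p))\<^sup>2
      \<and> norm (snd (F p) - \<rho> * snd p) \<le> C * norm (fst p)"
proof -
  obtain Cs where Cs: "Cs > 0" "\<And>z w. norm z \<le> 1 / 4 \<Longrightarrow> norm w \<le> R \<Longrightarrow> norm (s (z, w)) \<le> Cs * norm z"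
    using holo_fun_vanishing_order1[OF holo_s open_UNIV, of 1 R] by (auto simp: s_def)
  define e where "e = min (1 / 4) (1 / (2 * Cs))"
  have e: "e > 0" using Cs(1) by (simp add: e_def)
  have se: "norm (s (z, w)) \<le> 1 / 2" if "norm z \<le> e" "norm w \<le> R" for z w
  proof -
    have "norm (s (z, w)) \<le> Cs * norm z" using that by (intro Cs(2)) (auto simp: e_def)
    also have "\<dots> \<le> Cs * (1 / (2 * Cs))" using that Cs(1) by (intro mult_left_mono) (auto simp: e_def)
    finally show ?thesis using Cs(1) by simp
  qed
  have sub: "cball 0 e \<times> cball 0 R \<subseteq> {p. norm (s p) < 1}"
    using se by fastforce
  obtain C0 where C0: "C0 > 0" "\<And>z w. norm z \<le> e / 4 \<Longrightarrow> norm w \<le> R \<Longrightarrow> norm (X_err (z, w)) \<le> C0 * norm z"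
    using holo_fun_vanishing_order1[OF holo_X_err open_s sub e X_err_line] by blast
  obtain C1 where C1: "C1 > 0" "\<And>z w. norm z \<le> e / 4 \<Longrightarrow> norm w \<le> R \<Longrightarrow> norm (A_err (z, w)) \<le> C1 * (norm z)\<^sup>2"
    using holo_fun_vanishing_order2[OF holo_A_err open_s sub e A_err_line A_err_deriv] by blast
  obtain C2 where C2: "C2 > 0" "\<And>z w. norm z \<le> e / 4 \<Longrightarrow> norm w \<le> R \<Longrightarrow> norm (Y_err (z, w)) \<le> C2 * (norm z)\<^sup>2"
    using holo_fun_vanishing_order2[OF holo_Y_err open_UNIV _ e Y_err_line Y_err_deriv] by blast
  have "holo_fun (\<lambda>p. snd (F p) - \<rho> * snd p) UNIV"
    by (intro holo_fun_intros holo_snd_F)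
  then obtain C3 where C3: "C3 > 0" "\<And>z w. norm z \<le> e / 4 \<Longrightarrow> norm w \<le> R \<Longrightarrow> norm (snd (F (z, w)) - \<rho> * w) \<le> C3 * norm z"
    using holo_fun_vanishing_order1[OF _ open_UNIV _ e, of "\<lambda>p. snd (F p) - \<rho> * snd p" R] by (auto simp: snd_F)
  have bd: "\<exists>B>0. \<forall>w. norm w \<le> R \<longrightarrow> norm (h w) \<le> B" if "h holomorphic_on UNIV" for h :: "complex \<Rightarrow> complex"
  proof -
    have "compact (h ` cball 0 R)"
      by (intro compact_continuous_image compact_cball holomorphic_on_imp_continuous_on holomorphic_on_subset[OF that]) auto
    then obtain B where "B > 0" "\<forall>y \<in> h ` cball 0 R. norm y \<le> B"
      using compact_imp_bounded bounded_pos by metis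
    then show ?thesis by (intro exI[of _ B]) auto
  qed
  obtain C4 C5 C6 where C4: "C4 > 0" "\<And>w. norm w \<le> R \<Longrightarrow> norm (H w) \<le> C4"
    and C5: "C5 > 0" "\<And>w. norm w \<le> R \<Longrightarrow> norm (G w) \<le> C5"
    and C6: "C6 > 0" "\<And>w. norm w \<le> R \<Longrightarrow> norm (K w) \<le> C6"
    using bd[OF hol_H] bd[OF hol_G] bd[OF hol_K] by blast
  define C where "C = C0 + C1 + C2 + C3 + C4 + C5 + C6"
  have le: "C0 \<le> C" "C1 \<le> C" "C2 \<le> C" "C3 \<le> C" "C4 \<le> C" "C5 \<le> C" "C6 \<le> C"
    using C0(1) C1(1) C2(1) C3(1) C4(1) C5(1) C6(1) by (simp_all add: C_def)
  show ?thesis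
  proof (rule that[of "e / 4" C])
    show "e / 4 > 0" using e by simp
    show "C > 0" using le(1) C0(1) by simp
    show "norm (H w) \<le> C \<and> norm (G w) \<le> C \<and> norm (K w) \<le> C" if "norm w \<le> R" for w
      using C4(2)[OF that] C5(2)[OF that] C6(2)[OF that] le by linarith
    fix p :: complex2 assume p: "norm (fst p) \<le> e / 4" "norm (snd p) \<le> R"
    obtain z w where zw: "p = (z, w)" by (cases p)
    have z: "norm z \<le> e / 4" "norm z \<le> e" "norm w \<le> R" using p e by (auto simp: zw)
    have m: "Ci * norm z \<le> C * norm z" "Ci * (norm z)\<^sup>2 \<le> C * (norm z)\<^sup>2" if "Ci \<le> C" for Ci
      using that by (auto intro!: mult_right_mono)
    show "norm (s p) \<le> 1 / 2 \<and> norm (X_err p) \<le> C * norm (fst p)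
      \<and> norm (A_err p) \<le> C * (norm (fst p))\<^sup>2 \<and> norm (Y_err p) \<le> C * (norm (fst p))\<^sup>2
      \<and> norm (snd (F p) - \<rho> * snd p) \<le> C * norm (fst p)"
      using se[OF z(2,3)] order_trans[OF C0(2)[OF z(1,3)] m(1)[OF le(1)]]
        order_trans[OF C1(2)[OF z(1,3)] m(2)[OF le(2)]] order_trans[OF C2(2)[OF z(1,3)] m(2)[OF le(3)]]
        order_trans[OF C3(2)[OF z(1,3)] m(1)[OF le(4)]]
      by (simp add: zw)
  qed
qed

text \<open>
  Orbits that start far to the right with \<open>w\<close> bounded stay there.  What has to be controlled is
  the modulus of \<open>w\<close>: it could grow by the accumulated errors of \<open>Y\<close>.  The quantity
  \<open>norm (Y p) + \<Gamma> / x\<close>, where \<open>x\<close> is a lower bound of \<open>Re (X p)\<close> that grows by \<open>1/2\<close> in each step,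
  does not increase along orbits; it plays the role of a Lyapunov function.
\<close>

lemma trapping:
  assumes R: "R > 0"
  obtains M q C where "M \<ge> 1" "q > 0" "C > 0"
    "\<And>w. norm w \<le> R + 2 \<Longrightarrow> norm (H w) \<le> C \<and> norm (G w) \<le> C \<and> norm (K w) \<le> C"
    "\<And>p n. fst p \<noteq> 0 \<Longrightarrow> norm (snd p) \<le> R \<Longrightarrow> Re (X p) \<ge> M \<Longrightarrow>
       fst ((F ^^ n) p) \<noteq> 0 \<and> norm (snd ((F ^^ n) p)) \<le> R + 2
     \<and> Re (X ((F ^^ n) p)) \<ge> Re (X p) + real n / 2
     \<and> Re (U ((F ^^ n) p)) > (Re (X p) + real n / 2) / 2
     \<and> norm (fst ((F ^^ n) p)) \<le> q / (Re (X p) + real n / 2)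
     \<and> norm (A_err ((F ^^ n) p)) \<le> C / (Re (X p) + real n / 2)\<^sup>2
     \<and> norm (Y_err ((F ^^ n) p)) \<le> C / (Re (X p) + real n / 2)\<^sup>2
     \<and> A ((F ^^ Suc n) p) = A ((F ^^ n) p) + 1 + A_err ((F ^^ n) p)"
proof -
  have "R + 3 > 0" using R by simp
  from local_bounds[OF this] obtain \<epsilon> C where \<epsilon>: "\<epsilon> > 0" and C: "C > 0"
    and HG: "\<And>w. norm w \<le> R + 3 \<Longrightarrow> norm (H w) \<le> C \<and> norm (G w) \<le> C \<and> norm (K w) \<le> C"
    and bds: "\<And>p. norm (fst p) \<le> \<epsilon> \<Longrightarrow> norm (snd p) \<le> R + 3 \<Longrightarrow>
        norm (s p) \<le> 1 / 2 \<and> norm (X_err p) \<le> C * norm (fst p)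
      \<and> norm (A_err p) \<le> C * (norm (fst p))\<^sup>2 \<and> norm (Y_err p) \<le> C * (norm (fst p))\<^sup>2
      \<and> norm (snd (F p) - \<rho> * snd p) \<le> C * norm (fst p)" by blast
  define q where "q = 2 / norm \<kappa>"
  have q: "q > 0" using \<kappa> by (simp add: q_def)
  (* The gain \<Gamma> / x - \<Gamma> / (x + 1/2) is at least \<Gamma> / (4 x^2), which must cover the
     error C (q / x)^2 of Y. *)
  define \<Gamma> where "\<Gamma> = 4 * (C * q\<^sup>2)"
  have \<Gamma>: "\<Gamma> > 0" using C q by (simp add: \<Gamma>_def)
  define M where "M = 1 + (2 * C + 1) + q / \<epsilon> + 2 * C * q + 2 * \<Gamma>"
  have M: "M \<ge> 1" "M \<ge> 2 * C + 1" "M \<ge> q / \<epsilon>" "M \<ge> 2 * C * q" "M \<ge> 2 * \<Gamma>"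
    using C q \<epsilon> \<Gamma> by (simp_all add: M_def)
  have small: "q / x \<le> \<epsilon>" "C * (q / x) \<le> 1 / 2" "\<Gamma> / x \<le> 1 / 2" if "x \<ge> M" for x
  proof -
    have x: "x > 0" using that M(1) by simp
    show "q / x \<le> \<epsilon>" using M(3) that x \<epsilon> order_trans[OF M(3) that] by (simp add: field_simps)
    show "C * (q / x) \<le> 1 / 2" using order_trans[OF M(4) that] x by (simp add: field_simps)
    show "\<Gamma> / x \<le> 1 / 2" using order_trans[OF M(5) that] x by (simp add: field_simps)
  qed
  have far: "Re (U p) > x / 2 \<and> norm (fst p) \<le> q / x"
    if "fst p \<noteq> 0" "norm (snd p) \<le> R + 3" "Re (X p) \<ge> x" "x \<ge> M" for p x
  proof -
    have x: "x > 0" using that M(1) by simp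
    have "Re (X p) = Re (U p) + Re (H (snd p))" by (simp add: X_def)
    moreover have "\<bar>Re (H (snd p))\<bar> \<le> C" using HG[OF that(2)] abs_Re_le_cmod order_trans by blast
    ultimately have 1: "Re (U p) > x / 2" using that M(2) by linarith
    then have "x / 2 \<le> norm (U p)" using complex_Re_le_cmod[of "U p"] by linarith
    also have "norm (U p) = 1 / (norm \<kappa> * norm (fst p))" by (simp add: U_def norm_divide norm_mult)
    finally have "norm (fst p) \<le> q / x" using x \<kappa> that(1) by (simp add: q_def field_simps)
    with 1 show ?thesis by simp
  qed
  (* The bound on w is only a consequence of the bound on Y once z is small; it is carried along
     because the estimates require it. *)
  define P where "P = (\<lambda>p x. fst p \<noteq> 0 \<and> norm (snd p) \<le> R + 2 \<and> Re (X p) \<ge> x \<and> norm (Y p) + \<Gamma> / x \<le> R + 1)"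
  have step: "P (F p) (x + 1 / 2) \<and> Re (U p) > x / 2 \<and> norm (fst p) \<le> q / x
     \<and> norm (A_err p) \<le> C * q\<^sup>2 / x\<^sup>2 \<and> norm (Y_err p) \<le> C * q\<^sup>2 / x\<^sup>2
     \<and> A (F p) = A p + 1 + A_err p" if P: "P p x" and x: "x \<ge> M" for p x
  proof -
    have x0: "x \<ge> 1" using x M(1) by simp
    have p: "fst p \<noteq> 0" "norm (snd p) \<le> R + 2" "norm (snd p) \<le> R + 3" "Re (X p) \<ge> x" "norm (Y p) + \<Gamma> / x \<le> R + 1"
      using P by (auto simp: P_def)
    note far1 = far[OF p(1,3,4) x]
    have z: "norm (fst p) \<le> q / x" "norm (fst p) \<le> \<epsilon>" using far1 small(1)[OF x] by auto
    note b = bds[OF z(2) p(3)]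
    have Cz: "C * norm (fst p) \<le> 1 / 2"
      using order_trans[OF mult_left_mono[OF z(1), of C] small(2)[OF x]] C by simp
    have "C * (norm (fst p))\<^sup>2 \<le> C * (q / x)\<^sup>2" using z C by (intro mult_left_mono power_mono) auto
    then have Cz2: "C * (norm (fst p))\<^sup>2 \<le> C * q\<^sup>2 / x\<^sup>2" by (simp add: power_divide)
    have s0: "1 + s p \<noteq> 0"
    proof
      assume "1 + s p = 0"
      then have "s p = - 1" by (simp add: add_eq_0_iff)
      with b show False by simp
    qed
    have s1: "norm (s p) < 1" using b by simp
    have F1: "fst (F p) \<noteq> 0" using p(1) s0 by (simp add: fst_F)
    have "\<bar>Re (X_err p)\<bar> \<le> 1 / 2" using b Cz abs_Re_le_cmod[of "X_err p"] by linarith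
    then have F2: "Re (X (F p)) \<ge> x + 1 / 2" using X_F[OF p(1) s0] p(4) by simp
    have "norm (snd (F p)) \<le> norm (\<rho> * snd p) + norm (snd (F p) - \<rho> * snd p)"
      by (metis norm_triangle_sub)
    then have F3: "norm (snd (F p)) \<le> R + 3" using b Cz p(2) \<rho> by (simp add: norm_mult)
    have x': "x + 1 / 2 \<ge> M" using x by simp
    note far2 = far[OF F1 F3 F2 x']
    have "Y (F p) = \<rho> * Y p + Y_err p" by (simp add: Y_err_def)
    then have "norm (Y (F p)) \<le> norm (Y p) + norm (Y_err p)"
      using norm_triangle_ineq[of "\<rho> * Y p" "Y_err p"] \<rho> by (simp add: norm_mult)
    moreover have "norm (Y_err p) \<le> C * q\<^sup>2 / x\<^sup>2" using b Cz2 by linarith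
    moreover have "\<Gamma> / (x + 1 / 2) + C * q\<^sup>2 / x\<^sup>2 \<le> \<Gamma> / x"
    proof -
      have "\<Gamma> / x - \<Gamma> / (x + 1 / 2) = 2 * (C * q\<^sup>2) / (x * (x + 1 / 2))"
        using x0 by (simp add: \<Gamma>_def field_simps)
      also have "\<dots> \<ge> 2 * (C * q\<^sup>2) / (x * (2 * x))"
        using x0 C by (intro divide_left_mono mult_left_mono mult_pos_pos) auto
      finally show ?thesis by (simp add: power2_eq_square)
    qed
    ultimately have F4: "norm (Y (F p)) + \<Gamma> / (x + 1 / 2) \<le> R + 1" using p(5) by linarith
    have "norm (fst (F p) * G (snd (F p))) \<le> q / (x + 1 / 2) * C"
      unfolding norm_mult using far2 HG[OF F3] q x0 by (intro mult_mono) auto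
    also have "\<dots> \<le> 1 / 2" using small(2)[OF x'] by (simp add: mult.commute)
    finally have "norm (fst (F p) * G (snd (F p))) \<le> 1 / 2" .
    moreover have "snd (F p) = Y (F p) + fst (F p) * G (snd (F p))" by (simp add: Y_def)
    ultimately have "norm (snd (F p)) \<le> norm (Y (F p)) + 1 / 2"
      by (metis (no_types, lifting) add_left_mono norm_triangle_ineq order_trans)
    moreover have "\<Gamma> / (x + 1 / 2) \<ge> 0" using \<Gamma> x0 by simp
    ultimately have F5: "norm (snd (F p)) \<le> R + 2" using F4 by linarith
    have "P (F p) (x + 1 / 2)" using F1 F2 F4 F5 by (simp add: P_def)
    moreover have "A (F p) = A p + 1 + A_err p"
      using conjunct1[OF far1] conjunct1[OF far2] x0 by (intro A_F p s1) simp_all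
    ultimately show ?thesis using far1 b Cz2 by auto
  qed
  show ?thesis
  proof (rule that[of M q "C + C * q\<^sup>2"])
    show "M \<ge> 1" "q > 0" by fact+
    show "C + C * q\<^sup>2 > 0" using C q by (simp add: add_pos_pos)
    have le: "C \<le> C + C * q\<^sup>2" using C q by simp
    show "norm (H w) \<le> C + C * q\<^sup>2 \<and> norm (G w) \<le> C + C * q\<^sup>2 \<and> norm (K w) \<le> C + C * q\<^sup>2" if "norm w \<le> R + 2" for w
      using HG[of w] that le by auto
    fix p n assume p: "fst p \<noteq> 0" "norm (snd p) \<le> R" "Re (X p) \<ge> M"
    have "P p (Re (X p))"
    proof -
      have z: "norm (fst p) \<le> q / Re (X p)" using far[of p "Re (X p)"] p by simp
      have "norm (fst p * G (snd p)) \<le> q / Re (X p) * C"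
        unfolding norm_mult using z HG[of "snd p"] p q M(1) by (intro mult_mono) auto
      also have "\<dots> \<le> 1 / 2" using small(2)[OF p(3)] by (simp add: mult.commute)
      finally have "norm (Y p) \<le> R + 1 / 2"
        using norm_triangle_ineq4[of "snd p" "fst p * G (snd p)"] p(2) by (simp add: Y_def)
      with small(3)[OF p(3)] have "norm (Y p) + \<Gamma> / Re (X p) \<le> R + 1" by linarith
      then show ?thesis using p by (simp add: P_def)
    qed
    note P0 = this
    have Pn: "P ((F ^^ n) p) (Re (X p) + real n / 2)" for n
    proof (induction n)
      case 0
      then show ?case using P0 by simp
    next
      case (Suc n)
      have "P (F ((F ^^ n) p)) (Re (X p) + real n / 2 + 1 / 2)"
        using step[OF Suc.IH] p(3) by simp
      then show ?case by (simp add: add_divide_distrib algebra_simps)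
    qed
    define x where "x = Re (X p) + real n / 2"
    have x: "x \<ge> M" using p(3) by (simp add: x_def)
    have le2: "C * q\<^sup>2 / x\<^sup>2 \<le> (C + C * q\<^sup>2) / x\<^sup>2" using C by (intro divide_right_mono) auto
    show "fst ((F ^^ n) p) \<noteq> 0 \<and> norm (snd ((F ^^ n) p)) \<le> R + 2
     \<and> Re (X ((F ^^ n) p)) \<ge> Re (X p) + real n / 2
     \<and> Re (U ((F ^^ n) p)) > (Re (X p) + real n / 2) / 2
     \<and> norm (fst ((F ^^ n) p)) \<le> q / (Re (X p) + real n / 2)
     \<and> norm (A_err ((F ^^ n) p)) \<le> (C + C * q\<^sup>2) / (Re (X p) + real n / 2)\<^sup>2
     \<and> norm (Y_err ((F ^^ n) p)) \<le> (C + C * q\<^sup>2) / (Re (X p) + real n / 2)\<^sup>2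
     \<and> A ((F ^^ Suc n) p) = A ((F ^^ n) p) + 1 + A_err ((F ^^ n) p)"
      using Pn[of n] step[OF Pn[of n, folded x_def] x] le2 unfolding x_def[symmetric] P_def by auto
  qed
qed

end

section \<open>Fatou coordinates\<close>

lemma half_seq_tendsto: "(\<lambda>n. C / (x + real n / 2)) \<longlonglongrightarrow> (0::real)"
proof (rule real_tendsto_divide_at_top[OF tendsto_const])
  have "filterlim (\<lambda>n. (1 / 2) * real n) at_top sequentially"
    by (rule filterlim_tendsto_pos_mult_at_top[OF tendsto_const _ filterlim_real_sequentially]) simp
  from filterlim_tendsto_add_at_top[OF tendsto_const this, of x]
  show "filterlim (\<lambda>n. x + real n / 2) at_top sequentially" by simp
qed

text \<open>
  Since \<open>1 / t\<^sup>2 \<le> 4 * (1 / t - 1 / (t + 1/2))\<close> for \<open>t \<ge> 1\<close>, the increments are dominated by a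
  telescoping series.  The explicit rate gives uniform convergence and closeness of the limit
  to the initial term at once.
\<close>

lemma telescoping_limit:
  fixes c :: "nat \<Rightarrow> 'a::banach"
  assumes x: "x \<ge> 1" and C: "C \<ge> 0"
    and step: "\<And>n. norm (c (Suc n) - c n) \<le> C / (x + real n / 2)\<^sup>2"
  shows "convergent c" "norm (lim c - c n) \<le> 4 * C / (x + real n / 2)"
proof -
  define t where "t = (\<lambda>n. x + real n / 2)"
  have t: "t n \<ge> 1" "t (Suc n) = t n + 1 / 2" for n
    using x by (simp_all add: t_def add_divide_distrib)
  have one: "1 / (t n)\<^sup>2 \<le> 4 * (1 / t n - 1 / t (Suc n))" for n
  proof -
    have "4 * (1 / t n - 1 / t (Suc n)) = 2 / (t n * (t n + 1 / 2))"
      using t(1)[of n] unfolding t(2) by (simp add: field_simps)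
    also have "\<dots> \<ge> 2 / (t n * (2 * t n))"
      using t(1)[of n] by (intro divide_left_mono mult_left_mono mult_pos_pos) auto
    finally show ?thesis by (simp add: power2_eq_square)
  qed
  have tel: "norm (c (n + m) - c n) \<le> 4 * C * (1 / t n - 1 / t (n + m))" for n m
  proof (induction m)
    case 0
    then show ?case by simp
  next
    case (Suc m)
    have "norm (c (n + Suc m) - c n) \<le> norm (c (Suc (n + m)) - c (n + m)) + norm (c (n + m) - c n)"
      using norm_triangle_ineq[of "c (Suc (n + m)) - c (n + m)" "c (n + m) - c n"] by simp
    also have "norm (c (Suc (n + m)) - c (n + m)) \<le> C * (1 / (t (n + m))\<^sup>2)"
      using step[of "n + m"] by (simp add: t_def)
    also have "\<dots> \<le> C * (4 * (1 / t (n + m) - 1 / t (Suc (n + m))))"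
      using one C by (intro mult_left_mono) auto
    finally show ?case using Suc by (simp add: algebra_simps)
  qed
  have bnd: "norm (c m - c n) \<le> 4 * C / t n" if "m \<ge> n" for n m
  proof -
    have "norm (c m - c n) \<le> 4 * C * (1 / t n - 1 / t m)" using tel[of n "m - n"] that by simp
    also have "\<dots> \<le> 4 * C * (1 / t n)" using C t(1)[of m] by (intro mult_left_mono) auto
    finally show ?thesis by simp
  qed
  have t_lim: "(\<lambda>n. 4 * C / t n) \<longlonglongrightarrow> 0"
    unfolding t_def by (rule half_seq_tendsto)
  have "Cauchy c"
  proof (rule CauchyI')
    fix e :: real assume "e > 0"
    then have "\<forall>\<^sub>F n in sequentially. 4 * C / t n < e" using t_lim order_tendstoD(2) by blast
    then obtain N where N: "\<And>n. n \<ge> N \<Longrightarrow> 4 * C / t n < e" unfolding eventually_sequentially by blast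
    have "dist (c m) (c n) < e" if "m \<ge> N" "n > m" for m n
      using bnd[of m n] N[of m] that by (simp add: dist_norm norm_minus_commute)
    then show "\<exists>M. \<forall>m\<ge>M. \<forall>n>m. dist (c m) (c n) < e" by blast
  qed
  then show conv: "convergent c" by (rule Cauchy_convergent)
  have "(\<lambda>m. norm (c m - c n)) \<longlonglongrightarrow> norm (lim c - c n)"
    using conv by (intro tendsto_intros) (simp add: convergent_LIMSEQ_iff)
  moreover have "\<forall>\<^sub>F m in sequentially. norm (c m - c n) \<le> 4 * C / t n"
    using bnd unfolding eventually_sequentially by blast
  ultimately have "norm (lim c - c n) \<le> 4 * C / t n"
    by (rule tendsto_upperbound) simp
  then show "norm (lim c - c n) \<le> 4 * C / (x + real n / 2)" by (simp add: t_def)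
qed

context parabolic_map
begin

text \<open>
  The Fatou coordinates \<open>\<Phi>1\<close> and \<open>\<Phi>2\<close> are defined everywhere by the default value of \<open>lim\<close>, but
  meaningful on \<open>\<Omega>\<close> only.
\<close>

definition \<Phi>1n where "\<Phi>1n n p = A ((F ^^ n) p) - of_nat n"
definition \<Phi>2n where "\<Phi>2n n p = Y ((F ^^ n) p) / \<rho> ^ n"
definition \<Phi>1 where "\<Phi>1 p = lim (\<lambda>n. \<Phi>1n n p)"
definition \<Phi>2 where "\<Phi>2 p = lim (\<lambda>n. \<Phi>2n n p)"

text \<open>
  That such orbits approach the line within sectors follows (\<open>eventually_in_sector\<close>).  In this
  form the definition is visibly invariant, and it can be checked for limits of iterates near
  Fatou points.
\<close>

definition \<Omega> :: "complex2 set" where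
  "\<Omega> = {p. fst p \<noteq> 0 \<and> (\<lambda>n. fst ((F ^^ n) p)) \<longlonglongrightarrow> 0 \<and> bounded (range (\<lambda>n. snd ((F ^^ n) p)))}"

definition sector :: "real \<Rightarrow> real \<Rightarrow> complex2 set" where
  "sector R M = {p. fst p \<noteq> 0 \<and> norm (snd p) < R \<and> Re (X p) > M}"

text \<open>
  The estimates along all orbits that start in a sector, with one constant.  As a predicate it
  can be carried over from \<open>M\<close> to larger values (\<open>tame_mono\<close>).
\<close>

definition tame :: "real \<Rightarrow> real \<Rightarrow> real \<Rightarrow> bool" where
  "tame R M C \<longleftrightarrow> M \<ge> 1 \<and> C > 0 \<and>
     (\<forall>w. norm w \<le> R + 2 \<longrightarrow> norm (H w) \<le> C \<and> norm (G w) \<le> C \<and> norm (K w) \<le> C) \<and>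
     (\<forall>p \<in> sector R M. (\<forall>n.
         norm (\<Phi>1 p - \<Phi>1n n p) \<le> C / (Re (X p) + real n / 2)
       \<and> norm (\<Phi>2 p - \<Phi>2n n p) \<le> C / (Re (X p) + real n / 2)
       \<and> norm (fst ((F ^^ n) p)) \<le> C / (Re (X p) + real n / 2)
       \<and> norm (snd ((F ^^ n) p) - \<rho> ^ n * \<Phi>2 p) \<le> C / (Re (X p) + real n / 2)
       \<and> Re (U ((F ^^ n) p)) > 0 \<and> fst ((F ^^ n) p) \<noteq> 0)
       \<and> (\<lambda>n. \<Phi>1n n p) \<longlonglongrightarrow> \<Phi>1 p \<and> (\<lambda>n. \<Phi>2n n p) \<longlonglongrightarrow> \<Phi>2 p \<and> p \<in> \<Omega>)"

lemma tame_mono: "tame R M C \<Longrightarrow> M \<le> M' \<Longrightarrow> tame R M' C"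
  unfolding tame_def by (fastforce simp: sector_def)

lemma tame_constants:
  assumes "tame R M C"
  shows "M \<ge> 1" "C > 0" "norm w \<le> R + 2 \<Longrightarrow> norm (H w) \<le> C \<and> norm (G w) \<le> C \<and> norm (K w) \<le> C"
  using assms by (simp_all add: tame_def)

lemma tame_bounds:
  assumes "tame R M C" "p \<in> sector R M"
  shows "norm (\<Phi>1 p - \<Phi>1n n p) \<le> C / (Re (X p) + real n / 2)"
    "norm (\<Phi>2 p - \<Phi>2n n p) \<le> C / (Re (X p) + real n / 2)"
    "norm (fst ((F ^^ n) p)) \<le> C / (Re (X p) + real n / 2)"
    "norm (snd ((F ^^ n) p) - \<rho> ^ n * \<Phi>2 p) \<le> C / (Re (X p) + real n / 2)"
    "Re (U ((F ^^ n) p)) > 0" "fst ((F ^^ n) p) \<noteq> 0"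
  using assms unfolding tame_def by blast+

lemma tame_limits:
  assumes "tame R M C" "p \<in> sector R M"
  shows "(\<lambda>n. \<Phi>1n n p) \<longlonglongrightarrow> \<Phi>1 p" "(\<lambda>n. \<Phi>2n n p) \<longlonglongrightarrow> \<Phi>2 p" "p \<in> \<Omega>"
  using assms unfolding tame_def by blast+

lemma tame_exists:
  assumes R: "R > 0"
  obtains M C where "tame R M C"
proof -
  obtain M q C where M: "M \<ge> 1" and q: "q > 0" and C: "C > 0"
    and HG: "\<And>w. norm w \<le> R + 2 \<Longrightarrow> norm (H w) \<le> C \<and> norm (G w) \<le> C \<and> norm (K w) \<le> C"
    and tr: "\<And>p n. fst p \<noteq> 0 \<Longrightarrow> norm (snd p) \<le> R \<Longrightarrow> Re (X p) \<ge> M \<Longrightarrow>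
       fst ((F ^^ n) p) \<noteq> 0 \<and> norm (snd ((F ^^ n) p)) \<le> R + 2
     \<and> Re (X ((F ^^ n) p)) \<ge> Re (X p) + real n / 2
     \<and> Re (U ((F ^^ n) p)) > (Re (X p) + real n / 2) / 2
     \<and> norm (fst ((F ^^ n) p)) \<le> q / (Re (X p) + real n / 2)
     \<and> norm (A_err ((F ^^ n) p)) \<le> C / (Re (X p) + real n / 2)\<^sup>2
     \<and> norm (Y_err ((F ^^ n) p)) \<le> C / (Re (X p) + real n / 2)\<^sup>2
     \<and> A ((F ^^ Suc n) p) = A ((F ^^ n) p) + 1 + A_err ((F ^^ n) p)"
    by (rule trapping[OF R]) blast
  define C' where "C' = 4 * C + q + q * C"
  have C': "C \<le> C'" "4 * C \<le> C'" "q \<le> C'" "4 * C + q * C \<le> C'" "C' > 0"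
    using C q by (simp_all add: C'_def add_pos_pos)
  have rn: "norm (\<rho> ^ n) = 1" for n by (simp add: norm_power \<rho>)
  have main: "norm (\<Phi>1 p - \<Phi>1n n p) \<le> C' / (Re (X p) + real n / 2)
     \<and> norm (\<Phi>2 p - \<Phi>2n n p) \<le> C' / (Re (X p) + real n / 2)
     \<and> norm (fst ((F ^^ n) p)) \<le> C' / (Re (X p) + real n / 2)
     \<and> norm (snd ((F ^^ n) p) - \<rho> ^ n * \<Phi>2 p) \<le> C' / (Re (X p) + real n / 2)
     \<and> Re (U ((F ^^ n) p)) > 0 \<and> fst ((F ^^ n) p) \<noteq> 0
     \<and> convergent (\<lambda>n. \<Phi>1n n p) \<and> convergent (\<lambda>n. \<Phi>2n n p) \<and> norm (snd ((F ^^ n) p)) \<le> R + 2"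
    if p: "p \<in> sector R M" for p n
  proof -
    have p': "fst p \<noteq> 0" "norm (snd p) \<le> R" "Re (X p) \<ge> M" using p by (auto simp: sector_def)
    note t = tr[OF p']
    have x: "Re (X p) \<ge> 1" using p'(3) M by simp
    define y where "y = Re (X p) + real n / 2"
    have y: "y \<ge> 1" using x by (simp add: y_def)
    have "norm (\<Phi>1n (Suc n) p - \<Phi>1n n p) \<le> C / (Re (X p) + real n / 2)\<^sup>2" for n
      using t[of n] by (simp add: \<Phi>1n_def)
    from telescoping_limit[OF x _ this] C
    have 1: "convergent (\<lambda>n. \<Phi>1n n p)" "norm (\<Phi>1 p - \<Phi>1n n p) \<le> 4 * C / y"
      by (simp_all add: \<Phi>1_def y_def)
    have "norm (\<Phi>2n (Suc n) p - \<Phi>2n n p) \<le> C / (Re (X p) + real n / 2)\<^sup>2" for n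
    proof -
      have "\<Phi>2n (Suc n) p - \<Phi>2n n p = Y_err ((F ^^ n) p) / \<rho> ^ Suc n"
        using \<rho>_nz by (simp add: \<Phi>2n_def Y_err_def field_simps)
      then show ?thesis using t[of n] by (simp add: norm_divide rn del: power_Suc)
    qed
    from telescoping_limit[OF x _ this] C
    have 2: "convergent (\<lambda>n. \<Phi>2n n p)" "norm (\<Phi>2 p - \<Phi>2n n p) \<le> 4 * C / y"
      by (simp_all add: \<Phi>2_def y_def)
    have z: "norm (fst ((F ^^ n) p)) \<le> q / y" using t[of n] by (simp add: y_def)
    define w where "w = snd ((F ^^ n) p)"
    define z' where "z' = fst ((F ^^ n) p)"
    have w: "norm w \<le> R + 2" using t[of n] by (simp add: w_def)
    (* w differs from Y by a multiple of z, and Y from \<rho>^n \<Phi>2 by the tail of the series. *)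
    have "w - \<rho> ^ n * \<Phi>2 p = z' * G w - \<rho> ^ n * (\<Phi>2 p - \<Phi>2n n p)"
      using \<rho>_nz by (simp add: \<Phi>2n_def Y_def w_def z'_def field_simps)
    then have "norm (w - \<rho> ^ n * \<Phi>2 p) \<le> norm z' * norm (G w) + norm (\<Phi>2 p - \<Phi>2n n p)"
      using norm_triangle_ineq4[of "z' * G w" "\<rho> ^ n * (\<Phi>2 p - \<Phi>2n n p)"] by (simp add: norm_mult rn)
    also have "\<dots> \<le> q / y * C + 4 * C / y"
      using z 2(2) HG[OF w] q y C by (intro add_mono mult_mono) (auto simp: z'_def)
    also have "\<dots> = (4 * C + q * C) / y" by (simp add: add_divide_distrib)
    finally have 3: "norm (w - \<rho> ^ n * \<Phi>2 p) \<le> (4 * C + q * C) / y" .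
    have mono: "k / y \<le> C' / y" if "k \<le> C'" for k using that y by (intro divide_right_mono) auto
    have "Re (U ((F ^^ n) p)) > 0" using t[of n] y by (simp add: y_def)
    then show ?thesis
      using 1(1) 2(1) order_trans[OF 1(2) mono[OF C'(2)]] order_trans[OF 2(2) mono[OF C'(2)]] 
        order_trans[OF z mono[OF C'(3)]] order_trans[OF 3 mono[OF C'(4)]] w t[of n]
      unfolding w_def y_def by blast
  qed
  show ?thesis
  proof (rule that[of M C'])
    have "norm (H w) \<le> C' \<and> norm (G w) \<le> C' \<and> norm (K w) \<le> C'" if "norm w \<le> R + 2" for w
      using HG[OF that] C'(1) by auto
    moreover have "(\<lambda>n. \<Phi>1n n p) \<longlonglongrightarrow> \<Phi>1 p \<and> (\<lambda>n. \<Phi>2n n p) \<longlonglongrightarrow> \<Phi>2 p \<and> p \<in> \<Omega>" if p: "p \<in> sector R M" for p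
    proof (intro conjI)
      show "(\<lambda>n. \<Phi>1n n p) \<longlonglongrightarrow> \<Phi>1 p" "(\<lambda>n. \<Phi>2n n p) \<longlonglongrightarrow> \<Phi>2 p"
        using main[OF p] unfolding \<Phi>1_def \<Phi>2_def by (simp_all add: convergent_LIMSEQ_iff)
      have "(\<lambda>n. fst ((F ^^ n) p)) \<longlonglongrightarrow> 0"
        using main[OF p] by (intro Lim_null_comparison[OF _ half_seq_tendsto[of C' "Re (X p)"]]) auto
      moreover have "bounded (range (\<lambda>n. snd ((F ^^ n) p)))"
        using main[OF p] by (auto simp: bounded_iff)
      ultimately show "p \<in> \<Omega>" using p by (simp add: \<Omega>_def sector_def)
    qed
    ultimately show "tame R M C'"
      using M C'(5) main unfolding tame_def by blast
  qed
qed

lemma U_holo: "holo_fun U {p. fst p \<noteq> 0}"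
  unfolding U_def by (intro holo_fun_divide holo_fun_intros) (auto simp: \<kappa>)

lemma X_holo: "holo_fun X {p. fst p \<noteq> 0}"
  unfolding X_def by (intro holo_fun_intros U_holo holo_fun_entire[OF hol_H])

lemma A_holo: "holo_fun A {p. fst p \<noteq> 0 \<and> Re (U p) > 0}"
proof -
  have "holo_fun (\<lambda>p. Ln (U p)) {p. fst p \<noteq> 0 \<and> Re (U p) > 0}"
  proof (rule holo_fun_comp[of U _ Ln "- \<real>\<^sub>\<le>\<^sub>0"])
    show "holo_fun U {p. fst p \<noteq> 0 \<and> Re (U p) > 0}" by (rule holo_fun_subset[OF U_holo]) auto
    show "Ln holomorphic_on - \<real>\<^sub>\<le>\<^sub>0" by (intro holomorphic_intros) auto
  qed (auto simp: complex_nonpos_Reals_iff)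
  then show ?thesis unfolding A_def
    by (intro holo_fun_intros holo_fun_subset[OF X_holo] holo_fun_entire[OF hol_K]) auto
qed

lemma open_fst_nz: "open {p::complex2. fst p \<noteq> 0}"
  by (intro open_Collect_neq continuous_intros)

lemma open_sector: "open (sector R M)"
proof -
  have "open ({p. fst p \<noteq> 0} \<inter> {p. norm (snd p) < R \<and> Re (X p) > M})"
  proof -
    have "open ({p. fst p \<noteq> 0} \<inter> (\<lambda>p. (norm (snd p), Re (X p))) -` ({..<R} \<times> {M<..}))"
      by (intro continuous_open_preimage continuous_intros open_fst_nz open_Times
          holo_fun_continuous_on[OF X_holo])
    moreover have "(\<lambda>p. (norm (snd p), Re (X p))) -` ({..<R} \<times> {M<..}) = {p. norm (snd p) < R \<and> Re (X p) > M}"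
      by auto
    ultimately show ?thesis by simp
  qed
  moreover have "{p. fst p \<noteq> 0} \<inter> {p. norm (snd p) < R \<and> Re (X p) > M} = sector R M"
    by (auto simp: sector_def)
  ultimately show ?thesis by simp
qed

lemma Fn_holo: "holo_map (F ^^ n) S"
  using holo_map_subset[OF holo_map_funpow[OF holo_F]] by simp

lemma Fn_continuous: "continuous_on S (F ^^ n)"
  using Fn_holo holo_map_continuous_on by blast

lemma tame_holo:
  assumes t: "tame R M C"
  shows "holo_fun \<Phi>1 (sector R M)" "holo_fun \<Phi>2 (sector R M)"
proof -
  note M = tame_constants[OF t]
  note c = tame_bounds[OF t]
  have le: "C / (Re (X p) + real n / 2) \<le> C / (M + real n / 2)" if "p \<in> sector R M" for p n
    using that M by (intro divide_left_mono mult_pos_pos) (auto simp: sector_def)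
  have ul: "uniform_limit (sector R M) u v sequentially"
    if "\<And>p n. p \<in> sector R M \<Longrightarrow> norm (v p - u n p) \<le> C / (M + real n / 2)" for u and v :: "_ \<Rightarrow> complex"
  proof (rule uniform_limitI)
    fix e :: real assume "e > 0"
    then have "\<forall>\<^sub>F n in sequentially. C / (M + real n / 2) < e"
      using half_seq_tendsto order_tendstoD(2) by blast
    then show "\<forall>\<^sub>F n in sequentially. \<forall>p\<in>sector R M. dist (u n p) (v p) < e"
    proof eventually_elim
      case (elim n)
      show ?case
      proof
        fix p assume "p \<in> sector R M"
        from that[OF this, of n] elim show "dist (u n p) (v p) < e"
          by (simp add: dist_norm norm_minus_commute)
      qed
    qed
  qed
  show "holo_fun \<Phi>1 (sector R M)"
  proof (rule holo_fun_uniform_limit[OF open_sector])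
    show "holo_fun (\<Phi>1n n) (sector R M)" for n
      unfolding \<Phi>1n_def using c(5,6) by (intro holo_fun_intros holo_fun_compose[OF A_holo Fn_holo]) auto
    show "uniform_limit (sector R M) \<Phi>1n \<Phi>1 sequentially"
      by (rule ul) (rule order_trans[OF c(1) le])
  qed
  show "holo_fun \<Phi>2 (sector R M)"
  proof (rule holo_fun_uniform_limit[OF open_sector])
    show "holo_fun (\<Phi>2n n) (sector R M)" for n
      unfolding \<Phi>2n_def using \<rho>_nz by (intro holo_fun_divide holo_fun_intros holo_fun_compose[OF holo_Y Fn_holo]) auto
    show "uniform_limit (sector R M) \<Phi>2n \<Phi>2 sequentially"
      by (rule ul) (rule order_trans[OF c(2) le])
  qed
qed

subsection \<open>The basin\<close>

lemma inj_F: "inj F" using bij_F bij_is_inj by blast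

lemma F_line: "F (0, w) = (0, \<rho> * w)" by (simp add: F_eq)

text \<open>
  The line is mapped onto itself, so by injectivity nothing else is mapped into it.
\<close>

lemma fst_F_eq_0_iff: "fst (F p) = 0 \<longleftrightarrow> fst p = 0"
proof
  assume "fst (F p) = 0"
  then have "F p = F (0, snd (F p) / \<rho>)" using \<rho>_nz by (simp add: F_line prod_eq_iff)
  then show "fst p = 0" using inj_F by (metis fst_conv injD)
qed (simp add: fst_F)

lemma fst_Fn_eq_0_iff: "fst ((F ^^ n) p) = 0 \<longleftrightarrow> fst p = 0"
  by (induction n) (auto simp: fst_F_eq_0_iff)

lemma Fn_add: "(F ^^ m) ((F ^^ n) p) = (F ^^ (m + n)) p"
  by (simp add: funpow_add)

lemma Fn_\<Omega>_iff: "(F ^^ n) p \<in> \<Omega> \<longleftrightarrow> p \<in> \<Omega>"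
proof -
  have "(\<lambda>m. fst ((F ^^ (m + n)) p)) \<longlonglongrightarrow> 0 \<longleftrightarrow> (\<lambda>m. fst ((F ^^ m) p)) \<longlonglongrightarrow> 0"
  proof
    show "(\<lambda>m. fst ((F ^^ (m + n)) p)) \<longlonglongrightarrow> 0 \<Longrightarrow> (\<lambda>m. fst ((F ^^ m) p)) \<longlonglongrightarrow> 0"
      by (rule LIMSEQ_offset)
    show "(\<lambda>m. fst ((F ^^ m) p)) \<longlonglongrightarrow> 0 \<Longrightarrow> (\<lambda>m. fst ((F ^^ (m + n)) p)) \<longlonglongrightarrow> 0"
      by (rule LIMSEQ_ignore_initial_segment)
  qed
  moreover have "bounded (range (\<lambda>m. snd ((F ^^ (m + n)) p))) \<longleftrightarrow> bounded (range (\<lambda>m. snd ((F ^^ m) p)))"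
  proof
    assume b: "bounded (range (\<lambda>m. snd ((F ^^ (m + n)) p)))"
    have "range (\<lambda>m. snd ((F ^^ m) p)) \<subseteq> range (\<lambda>m. snd ((F ^^ (m + n)) p)) \<union> (\<lambda>m. snd ((F ^^ m) p)) ` {..<n}"
    proof
      fix y assume "y \<in> range (\<lambda>m. snd ((F ^^ m) p))"
      then obtain m where m: "y = snd ((F ^^ m) p)" by blast
      show "y \<in> range (\<lambda>m. snd ((F ^^ (m + n)) p)) \<union> (\<lambda>m. snd ((F ^^ m) p)) ` {..<n}"
      proof (cases "m < n")
        case False
        then have "y = snd ((F ^^ ((m - n) + n)) p)" using m by simp
        then show ?thesis by blast
      qed (use m in auto)
    qed
    then show "bounded (range (\<lambda>m. snd ((F ^^ m) p)))"
      by (rule bounded_subset[rotated]) (simp add: b finite_imp_bounded)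
  next
    assume b: "bounded (range (\<lambda>m. snd ((F ^^ m) p)))"
    show "bounded (range (\<lambda>m. snd ((F ^^ (m + n)) p)))"
      by (rule bounded_subset[OF b]) auto
  qed
  ultimately show ?thesis by (simp add: \<Omega>_def fst_Fn_eq_0_iff Fn_add)
qed

lemma F_\<Omega>_iff: "F p \<in> \<Omega> \<longleftrightarrow> p \<in> \<Omega>"
  using Fn_\<Omega>_iff[of 1 p] by simp

lemma \<Omega>_bound:
  assumes "p \<in> \<Omega>"
  obtains R where "R > 0" "\<forall>n. norm (snd ((F ^^ n) p)) < R"
proof -
  obtain B where "B > 0" "\<And>n. norm (snd ((F ^^ n) p)) \<le> B"
    using assms unfolding \<Omega>_def bounded_pos by auto
  moreover from this have "norm (snd ((F ^^ n) p)) < B + 1" for n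
    by (meson le_less_trans less_add_one)
  ultimately show ?thesis using that[of "B + 1"] by simp
qed

text \<open>
  When \<open>z\<close> is small and \<open>w\<close> bounded, the real part of \<open>X\<close> increases by at least \<open>1/2\<close> in each step, so
  it tends to infinity.
\<close>

lemma eventually_in_sector:
  assumes p: "p \<in> \<Omega>" and R: "\<And>n. norm (snd ((F ^^ n) p)) < R"
  shows "\<forall>\<^sub>F n in sequentially. (F ^^ n) p \<in> sector R M"
proof -
  have "R > 0" by (rule le_less_trans[OF norm_ge_zero R[of 0]])
  then obtain \<epsilon> C where \<epsilon>: "\<epsilon> > 0" and C: "C > 0"
    and b: "\<forall>p. norm (fst p) \<le> \<epsilon> \<longrightarrow> norm (snd p) \<le> R \<longrightarrow>
        norm (s p) \<le> 1 / 2 \<and> norm (X_err p) \<le> C * norm (fst p)"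
    by (rule local_bounds) blast
  have nz: "fst ((F ^^ n) p) \<noteq> 0" for n using p by (simp add: fst_Fn_eq_0_iff \<Omega>_def)
  have "(\<lambda>n. fst ((F ^^ n) p)) \<longlonglongrightarrow> 0" using p by (simp add: \<Omega>_def)
  then have "\<forall>\<^sub>F n in sequentially. dist (fst ((F ^^ n) p)) 0 < min \<epsilon> (1 / (2 * C))"
    using \<epsilon> C by (intro tendstoD) auto
  then obtain N where N: "\<And>n. n \<ge> N \<Longrightarrow> norm (fst ((F ^^ n) p)) < min \<epsilon> (1 / (2 * C))"
    unfolding eventually_sequentially dist_0_norm by (metis dist_norm diff_zero)
  have inc: "Re (X ((F ^^ Suc n) p)) \<ge> Re (X ((F ^^ n) p)) + 1 / 2" if n: "n \<ge> N" for n
  proof -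
    define p' where "p' = (F ^^ n) p"
    have z: "norm (fst p') \<le> \<epsilon>" "norm (fst p') \<le> 1 / (2 * C)" "norm (snd p') \<le> R"
      using N[OF n] R[of n] by (auto simp: p'_def)
    note b' = b[rule_format, OF z(1,3)]
    have "C * norm (fst p') \<le> C * (1 / (2 * C))" using z(2) C by (intro mult_left_mono) auto
    then have e: "norm (X_err p') \<le> 1 / 2" using b' C by simp
    have "1 + s p' \<noteq> 0"
    proof
      assume "1 + s p' = 0"
      then have "s p' = - 1" by (simp add: add_eq_0_iff)
      with b' show False by simp
    qed
    from X_F[OF _ this] have "X (F p') = X p' + 1 + X_err p'" using nz[of n] by (simp add: p'_def)
    then have "Re (X (F p')) = Re (X p') + 1 + Re (X_err p')" by simp
    moreover have "\<bar>Re (X_err p')\<bar> \<le> 1 / 2" using e abs_Re_le_cmod[of "X_err p'"] by linarith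
    moreover have "(F ^^ Suc n) p = F p'" by (simp add: p'_def)
    ultimately show ?thesis unfolding p'_def[symmetric] by simp
  qed
  have grow: "Re (X ((F ^^ (N + k)) p)) \<ge> Re (X ((F ^^ N) p)) + real k / 2" for k
  proof (induction k)
    case (Suc k)
    have "Re (X ((F ^^ (N + Suc k)) p)) \<ge> Re (X ((F ^^ (N + k)) p)) + 1 / 2"
      using inc[of "N + k"] by (metis add_Suc_right le_add1)
    moreover have "real (Suc k) / 2 = real k / 2 + 1 / 2" by (simp add: add_divide_distrib)
    ultimately show ?case using Suc by linarith
  qed simp
  obtain k0 :: nat where k0: "real k0 > 2 * (M - Re (X ((F ^^ N) p)))" using reals_Archimedean2 by blast
  have "(F ^^ n) p \<in> sector R M" if n: "n \<ge> N + k0" for n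
  proof -
    obtain m where m: "n = N + m"
      using le_Suc_ex[OF add_leD1[OF n]] by blast
    then have "real m \<ge> real k0" using n by simp
    then have "M < Re (X ((F ^^ N) p)) + real m / 2" using k0 by (simp add: field_simps)
    with grow[of m] have "Re (X ((F ^^ n) p)) > M" unfolding m by (rule order_less_le_trans[rotated])
    then show ?thesis using nz R by (simp add: sector_def)
  qed
  then show ?thesis unfolding eventually_sequentially by blast
qed

lemma \<Omega>_limits:
  assumes p: "p \<in> \<Omega>"
  shows "(\<lambda>n. \<Phi>1n n p) \<longlonglongrightarrow> \<Phi>1 p" "(\<lambda>n. \<Phi>2n n p) \<longlonglongrightarrow> \<Phi>2 p"
    "(\<lambda>n. snd ((F ^^ n) p) - \<rho> ^ n * \<Phi>2 p) \<longlonglongrightarrow> 0"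
proof -
  obtain R where R: "R > 0" "\<forall>n. norm (snd ((F ^^ n) p)) < R" by (rule \<Omega>_bound[OF p])
  obtain M C where t: "tame R M C" by (rule tame_exists[OF R(1)])
  obtain N where N: "(F ^^ N) p \<in> sector R M"
    using eventually_in_sector[OF p R(2)[rule_format]] unfolding eventually_sequentially by blast
  define q where "q = (F ^^ N) p"
  have q: "q \<in> sector R M" using N q_def by simp
  have "(\<lambda>n. \<Phi>1n n q - of_nat N) \<longlonglongrightarrow> \<Phi>1 q - of_nat N" by (rule tendsto_diff[OF tame_limits(1)[OF t q] tendsto_const])
  then have 1: "(\<lambda>n. \<Phi>1n (n + N) p) \<longlonglongrightarrow> \<Phi>1 q - of_nat N" by (simp add: \<Phi>1n_def q_def Fn_add algebra_simps)
  then show "(\<lambda>n. \<Phi>1n n p) \<longlonglongrightarrow> \<Phi>1 p"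
    unfolding \<Phi>1_def[of p] using LIMSEQ_offset[OF 1] by (simp add: limI)
  have "(\<lambda>n. \<Phi>2n n q / \<rho> ^ N) \<longlonglongrightarrow> \<Phi>2 q / \<rho> ^ N" by (rule tendsto_divide[OF tame_limits(2)[OF t q] tendsto_const]) (simp add: \<rho>_nz)
  then have 2: "(\<lambda>n. \<Phi>2n (n + N) p) \<longlonglongrightarrow> \<Phi>2 q / \<rho> ^ N" by (simp add: \<Phi>2n_def q_def Fn_add power_add)
  then have 3: "(\<lambda>n. \<Phi>2n n p) \<longlonglongrightarrow> \<Phi>2 q / \<rho> ^ N" by (rule LIMSEQ_offset)
  then have eq: "\<Phi>2 p = \<Phi>2 q / \<rho> ^ N" unfolding \<Phi>2_def[of p] by (rule limI)
  with 3 show "(\<lambda>n. \<Phi>2n n p) \<longlonglongrightarrow> \<Phi>2 p" by simp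
  have "(\<lambda>n. snd ((F ^^ n) q) - \<rho> ^ n * \<Phi>2 q) \<longlonglongrightarrow> 0"
    by (rule Lim_null_comparison[OF _ half_seq_tendsto[of C "Re (X q)"]]) (use tame_bounds(4)[OF t q] in auto)
  moreover have "snd ((F ^^ n) q) - \<rho> ^ n * \<Phi>2 q = snd ((F ^^ (n + N)) p) - \<rho> ^ (n + N) * \<Phi>2 p" for n
  proof -
    have "\<rho> ^ n * \<Phi>2 q = \<rho> ^ (n + N) * \<Phi>2 p"
      unfolding eq power_add using \<rho>_nz by simp
    then show ?thesis by (simp only: q_def Fn_add)
  qed
  ultimately have "(\<lambda>n. snd ((F ^^ (n + N)) p) - \<rho> ^ (n + N) * \<Phi>2 p) \<longlonglongrightarrow> 0"
    by (simp only:)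
  then show "(\<lambda>n. snd ((F ^^ n) p) - \<rho> ^ n * \<Phi>2 p) \<longlonglongrightarrow> 0" by (rule LIMSEQ_offset)
qed

lemma \<Phi>_Fn:
  assumes p: "p \<in> \<Omega>"
  shows "\<Phi>1 ((F ^^ n) p) = \<Phi>1 p + of_nat n" "\<Phi>2 ((F ^^ n) p) = \<rho> ^ n * \<Phi>2 p"
proof -
  have "(\<lambda>m. \<Phi>1n (m + n) p + of_nat n) \<longlonglongrightarrow> \<Phi>1 p + of_nat n"
    by (rule tendsto_add[OF LIMSEQ_ignore_initial_segment[OF \<Omega>_limits(1)[OF p]] tendsto_const])
  then have "(\<lambda>m. \<Phi>1n m ((F ^^ n) p)) \<longlonglongrightarrow> \<Phi>1 p + of_nat n" by (simp add: \<Phi>1n_def Fn_add)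
  then show "\<Phi>1 ((F ^^ n) p) = \<Phi>1 p + of_nat n" unfolding \<Phi>1_def[of "(F ^^ n) p"] by (rule limI)
  have "(\<lambda>m. \<rho> ^ n * \<Phi>2n (m + n) p) \<longlonglongrightarrow> \<rho> ^ n * \<Phi>2 p"
    by (rule tendsto_mult[OF tendsto_const LIMSEQ_ignore_initial_segment[OF \<Omega>_limits(2)[OF p]]])
  then have "(\<lambda>m. \<Phi>2n m ((F ^^ n) p)) \<longlonglongrightarrow> \<rho> ^ n * \<Phi>2 p"
    using \<rho>_nz by (simp add: \<Phi>2n_def Fn_add power_add)
  then show "\<Phi>2 ((F ^^ n) p) = \<rho> ^ n * \<Phi>2 p" unfolding \<Phi>2_def[of "(F ^^ n) p"] by (rule limI)
qed

text \<open>
  A point of \<open>\<Omega>\<close> has a neighbourhood which some iterate maps into a single sector.  So the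
  uniform estimates on sectors spread to neighbourhoods of all points of \<open>\<Omega>\<close>, with the time \<open>N\<close> as
  the only loss.
\<close>

lemma \<Omega>_local:
  assumes p: "p \<in> \<Omega>"
  obtains M N C V where "open V" "p \<in> V" "V \<subseteq> \<Omega>" "holo_fun \<Phi>1 V" "holo_fun \<Phi>2 V" "C > 0"
    "\<And>q n. q \<in> V \<Longrightarrow> n \<ge> N \<Longrightarrow> norm (fst ((F ^^ n) q)) \<le> C / (M + real (n - N) / 2)
        \<and> norm (snd ((F ^^ n) q) - \<rho> ^ n * \<Phi>2 q) \<le> C / (M + real (n - N) / 2)"
proof -
  obtain R where R: "R > 0" "\<forall>n. norm (snd ((F ^^ n) p)) < R" by (rule \<Omega>_bound[OF p])
  obtain M C where t: "tame R M C" by (rule tame_exists[OF R(1)])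
  note M = tame_constants[OF t]
  obtain N where N: "(F ^^ N) p \<in> sector R M"
    using eventually_in_sector[OF p R(2)[rule_format]] unfolding eventually_sequentially by blast
  define V where "V = (F ^^ N) -` sector R M"
  have VD: "(F ^^ N) q \<in> sector R M" if "q \<in> V" for q using that by (auto simp: V_def)
  have V\<Omega>: "V \<subseteq> \<Omega>" using VD tame_limits(3)[OF t] Fn_\<Omega>_iff by blast
  have im: "(F ^^ N) ` V \<subseteq> sector R M" by (auto simp: V_def)
  show ?thesis
  proof (rule that[of V C N M])
    show "open V" unfolding V_def by (intro open_vimage open_sector Fn_continuous)
    show "p \<in> V" using N by (simp add: V_def)
    show "V \<subseteq> \<Omega>" "C > 0" using V\<Omega> M by auto
    have "holo_fun (\<lambda>q. \<Phi>1 ((F ^^ N) q) - of_nat N) V"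
      by (intro holo_fun_intros holo_fun_compose[OF tame_holo(1)[OF t] Fn_holo im])
    then show "holo_fun \<Phi>1 V" by (rule holo_fun_cong) (use V\<Omega> \<Phi>_Fn in auto)
    have "holo_fun (\<lambda>q. \<Phi>2 ((F ^^ N) q) / \<rho> ^ N) V"
      using \<rho>_nz by (intro holo_fun_divide holo_fun_intros holo_fun_compose[OF tame_holo(2)[OF t] Fn_holo im]) auto
    then show "holo_fun \<Phi>2 V" by (rule holo_fun_cong) (use V\<Omega> \<Phi>_Fn \<rho>_nz in auto)
    fix q n assume q: "q \<in> V" and n: "n \<ge> N"
    define q' where "q' = (F ^^ N) q"
    have q': "q' \<in> sector R M" using VD[OF q] by (simp add: q'_def)
    have e: "(F ^^ n) q = (F ^^ (n - N)) q'" using n by (simp add: q'_def Fn_add)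
    have "\<rho> ^ n * \<Phi>2 q = \<rho> ^ (n - N) * \<Phi>2 q'"
      using n V\<Omega> q \<Phi>_Fn(2)[of q N] by (auto simp: q'_def mult.assoc[symmetric] power_add[symmetric])
    moreover have "C / (Re (X q') + real (n - N) / 2) \<le> C / (M + real (n - N) / 2)"
      using q' M by (intro divide_left_mono mult_pos_pos) (auto simp: sector_def)
    ultimately show "norm (fst ((F ^^ n) q)) \<le> C / (M + real (n - N) / 2)
        \<and> norm (snd ((F ^^ n) q) - \<rho> ^ n * \<Phi>2 q) \<le> C / (M + real (n - N) / 2)"
      using tame_bounds(3,4)[OF t q', of "n - N"] unfolding e by fastforce
  qed
qed

lemma open_\<Omega>: "open \<Omega>"
  using open_subopen \<Omega>_local by metis

lemma holo_\<Phi>1: "holo_fun \<Phi>1 \<Omega>" and holo_\<Phi>2: "holo_fun \<Phi>2 \<Omega>"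
  by (rule holo_fun_local; metis \<Omega>_local)+

end

section \<open>The Fatou coordinates are biholomorphic\<close>

lemma holo_map_cong:
  assumes "holo_map G S" "\<And>p. p \<in> S \<Longrightarrow> G p = G' p"
  shows "holo_map G' S"
  using assms holo_fun_cong[of "\<lambda>p. fst (G p)" S "\<lambda>p. fst (G' p)"]
    holo_fun_cong[of "\<lambda>p. snd (G p)" S "\<lambda>p. snd (G' p)"] by (simp add: holo_map_def)

lemma holo_map_local:
  assumes "\<And>p. p \<in> S \<Longrightarrow> \<exists>U. open U \<and> p \<in> U \<and> holo_map G U"
  shows "holo_map G S"
  unfolding holo_map_def using assms by (intro conjI holo_fun_local) (auto simp: holo_map_def)

lemma norm_le_fst_snd: "norm p \<le> norm (fst p) + norm (snd p)"
  using norm_Pair_le[of "fst p" "snd p"] by simp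

lemma Ln_Lipschitz:
  assumes "m > 0" "Re u > m" "Re v > m"
  shows "norm (Ln u - Ln v) \<le> 1 / m * norm (u - v)"
proof (rule field_differentiable_bound[of "{z. Re z > m}"])
  show "convex {z. Re z > m}" by (rule convex_halfspace_Re_gt)
  fix z assume z: "z \<in> {z. Re z > m}"
  then have "z \<notin> \<real>\<^sub>\<le>\<^sub>0" using assms(1) by (auto simp: complex_nonpos_Reals_iff)
  then show "(Ln has_field_derivative inverse z) (at z within {z. Re z > m})"
    by (rule has_field_derivative_at_within[OF has_field_derivative_Ln])
  have "m \<le> norm z" using z complex_Re_le_cmod[of z] by simp
  then show "norm (inverse z) \<le> 1 / m"
    using assms(1) by (simp add: norm_inverse inverse_eq_divide norm_divide frac_le)
qed (use assms in auto)

context parabolic_map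
begin

text \<open>
  In the coordinates \<open>(X, w)\<close> a sector becomes a product of convex sets, on which Cauchy
  estimates give Lipschitz bounds; \<open>\<sigma>\<close> is the change back to the original coordinates, and \<open>\<Theta>\<close> is
  \<open>\<Phi>\<close> in these coordinates.
\<close>

definition strip :: "real \<Rightarrow> real \<Rightarrow> complex2 set" where
  "strip R M = {x. Re x > M} \<times> ball 0 R"

definition \<sigma> :: "complex2 \<Rightarrow> complex2" where
  "\<sigma> v = (- 1 / (\<kappa> * (fst v - H (snd v))), snd v)"

definition \<Phi> :: "complex2 \<Rightarrow> complex2" where "\<Phi> p = (\<Phi>1 p, \<Phi>2 p)"

definition \<Theta> :: "complex2 \<Rightarrow> complex2" where "\<Theta> v = \<Phi> (\<sigma> v)"

text \<open>
  The two components are estimated separately, because the contraction argument in \<open>surj_\<Phi>\<close>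
  needs a rectangle and the components behave differently: \<open>fst (\<Theta> v - v)\<close> contains \<open>\<beta>\<close> times a
  logarithm, while \<open>snd (\<Theta> v - v)\<close> is bounded.
\<close>

definition chart :: "real \<Rightarrow> real \<Rightarrow> bool" where
  "chart R M \<longleftrightarrow> \<sigma> ` strip R M \<subseteq> \<Omega> \<and> holo_map \<sigma> (strip R M) \<and> holo_map \<Theta> (strip R M) \<and>
     (\<forall>v\<in>strip R M. \<forall>v'\<in>strip R M.
        norm (fst (\<Theta> v - v) - fst (\<Theta> v' - v')) \<le> (norm (fst v - fst v') + norm (snd v - snd v')) / 8
      \<and> norm (snd (\<Theta> v - v) - snd (\<Theta> v' - v')) \<le> (norm (fst v - fst v') + norm (snd v - snd v')) / 8) \<and>
     (\<forall>v\<in>strip R M. norm (snd (\<Theta> v - v)) \<le> 1)"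

lemma open_strip: "open (strip R M)"
  unfolding strip_def by (intro open_Times open_halfspace_Re_gt open_ball)

lemma \<sigma>_facts:
  assumes "fst v \<noteq> H (snd v)"
  shows "fst (\<sigma> v) \<noteq> 0" "U (\<sigma> v) = fst v - H (snd v)" "X (\<sigma> v) = fst v" "snd (\<sigma> v) = snd v"
  using assms \<kappa> by (auto simp: \<sigma>_def U_def X_def)

lemma \<sigma>_X: "fst p \<noteq> 0 \<Longrightarrow> \<sigma> (X p, snd p) = p"
  using \<kappa> by (cases p) (simp add: \<sigma>_def X_def U_def)

text \<open>
  Up to the logarithm, \<open>\<Theta> v - v\<close> is \<open>O(1 / Re X)\<close>, so a Cauchy estimate makes its Lipschitz
  constant small far to the right.  The logarithm is unbounded but has small derivative there.
\<close>

lemma chart_exists: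
  assumes R: "R > 0"
  obtains M where "chart R M"
proof -
  have R1: "R + 1 > 0" using R by simp
  obtain M0 C where t0: "tame (R + 1) M0 C" by (rule tame_exists[OF R1])
  have C: "C > 0" and M0: "M0 \<ge> 1" using tame_constants(1,2)[OF t0] by auto
  have HG: "norm (H w) \<le> C" "norm (G w) \<le> C" "norm (K w) \<le> C" if "norm w \<le> R + 3" for w
    using tame_constants(3)[OF t0, of w] that by auto
  (* B / Re X bounds the part of \<Theta> v - v without the logarithm, and k collects the factors in the
     Lipschitz constant of the logarithmic term; M1 makes each contribute at most 1/16. *)
  define B where "B = C + C * C"
  have B: "B > 0" "C \<le> B" using C by (simp_all add: B_def add_pos_pos)
  define k where "k = norm \<beta> * (1 + C)"
  have k: "k \<ge> 0" using C by (simp add: k_def)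
  define M1 where "M1 = M0 + 2 * C + 16 * B + 32 * k"
  have M1: "M1 \<ge> M0" "M1 \<ge> 2 * C + 1" "M1 \<ge> 16 * B" "M1 \<ge> 32 * k" "M1 \<ge> 1"
    using C B k M0 by (simp_all add: M1_def)
  have BM: "B / M1 \<le> 1 / 16" and kM: "k / (M1 / 2) \<le> 1 / 16"
    using M1 by (simp_all add: field_simps)
  have t: "tame (R + 1) M1 C" using tame_mono[OF t0 M1(1)] .
  define V' where "V' = strip (R + 1) M1"
  have V': "norm (snd v) < R + 1" "Re (fst v) > M1" "Re (fst v - H (snd v)) > M1 / 2"
    "fst v \<noteq> H (snd v)" if "v \<in> V'" for v
  proof -
    show 1: "norm (snd v) < R + 1" "Re (fst v) > M1" using that by (auto simp: V'_def strip_def)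
    have "norm (H (snd v)) \<le> C" using HG(1)[of "snd v"] 1 by simp
    then show 2: "Re (fst v - H (snd v)) > M1 / 2"
      using abs_Re_le_cmod[of "H (snd v)"] 1 M1(2) by simp
    then show "fst v \<noteq> H (snd v)" using M1(5) by auto
  qed
  have \<sigma>D: "\<sigma> v \<in> sector (R + 1) M1" if "v \<in> V'" for v
    using \<sigma>_facts[OF V'(4)[OF that]] V'(1,2)[OF that] by (simp add: sector_def)
  have \<sigma>h: "holo_map \<sigma> V'"
    unfolding \<sigma>_def using V'(4) \<kappa>
    by (intro holo_map_Pair holo_fun_divide holo_fun_intros holo_fun_entire[OF hol_H]) auto
  have \<Phi>h: "holo_fun (\<lambda>v. \<Phi>1 (\<sigma> v)) V'" "holo_fun (\<lambda>v. \<Phi>2 (\<sigma> v)) V'"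
    using \<sigma>D by (auto intro!: holo_fun_compose[OF tame_holo(1)[OF t] \<sigma>h] holo_fun_compose[OF tame_holo(2)[OF t] \<sigma>h])
  define T1 where "T1 = (\<lambda>v. \<Phi>1 (\<sigma> v) - fst v - \<beta> * Ln (fst v - H (snd v)))"
  define T2 where "T2 = (\<lambda>v. \<Phi>2 (\<sigma> v) - snd v)"
  have "holo_fun (\<lambda>v. Ln (fst v - H (snd v))) V'"
  proof (rule holo_fun_comp[of _ _ Ln "- \<real>\<^sub>\<le>\<^sub>0"])
    show "holo_fun (\<lambda>v. fst v - H (snd v)) V'" by (intro holo_fun_intros holo_fun_entire[OF hol_H])
    show "Ln holomorphic_on - \<real>\<^sub>\<le>\<^sub>0" by (intro holomorphic_intros) auto
    show "(\<lambda>v. fst v - H (snd v)) ` V' \<subseteq> - \<real>\<^sub>\<le>\<^sub>0"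
      using V'(3) M1(5) by (fastforce simp: complex_nonpos_Reals_iff)
  qed
  then have T1h: "holo_fun T1 V'" unfolding T1_def by (intro holo_fun_intros \<Phi>h)
  have T2h: "holo_fun T2 V'" unfolding T2_def by (intro holo_fun_intros \<Phi>h)
  have Tb: "norm (T1 v) \<le> B / M1" "norm (T2 v) \<le> B / M1" if v: "v \<in> V'" for v
  proof -
    note sf = \<sigma>_facts[OF V'(4)[OF v]] and d = \<sigma>D[OF v]
    have le: "C / Re (fst v) \<le> C / M1" using V'(2)[OF v] C M1(5) by (intro divide_left_mono) auto
    have z: "norm (fst (\<sigma> v)) \<le> C / M1" using tame_bounds(3)[OF t d, of 0] sf le by simp
    have "norm (\<Phi>1 (\<sigma> v) - A (\<sigma> v)) \<le> C / M1"
      using tame_bounds(1)[OF t d, of 0] sf le by (simp add: \<Phi>1n_def)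
    moreover have "norm (K (snd v) * fst (\<sigma> v)) \<le> C * (C / M1)"
      unfolding norm_mult using HG(3)[of "snd v"] V'(1)[OF v] z C by (intro mult_mono) auto
    moreover have "T1 v = (\<Phi>1 (\<sigma> v) - A (\<sigma> v)) + K (snd v) * fst (\<sigma> v)"
      using sf by (simp add: T1_def A_def)
    ultimately have "norm (T1 v) \<le> C / M1 + C * (C / M1)"
      by (metis add_mono norm_triangle_ineq order_trans)
    then show "norm (T1 v) \<le> B / M1" by (simp add: B_def add_divide_distrib)
    have "norm (T2 v) \<le> C / M1"
      using tame_bounds(4)[OF t d, of 0] sf le by (simp add: T2_def norm_minus_commute)
    also have "\<dots> \<le> B / M1" using B(2) M1(5) by (intro divide_right_mono) auto
    finally show "norm (T2 v) \<le> B / M1" .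
  qed
  (* The Cauchy estimates use discs of radius 1, hence the loss of 1 in M and R. *)
  define M where "M = M1 + 1"
  have VV': "strip R M \<subseteq> V'" by (auto simp: strip_def V'_def M_def)
  have lip: "norm (T v - T v') \<le> B / M1 * (norm (fst v - fst v') + norm (snd v - snd v'))"
    if T: "holo_fun T V'" "\<And>v. v \<in> V' \<Longrightarrow> norm (T v) \<le> B / M1" and v: "v \<in> strip R M" "v' \<in> strip R M" for T v v'
  proof -
    have "norm (T v - T v') \<le> (B / M1) / 1 * (norm (fst v - fst v') + norm (snd v - snd v'))"
    proof (rule holo_fun_Lipschitz[where ?T1.0 = "{x. Re x > M1}" and ?T2.0 = "ball 0 (R + 1)"
          and ?A1.0 = "{x. Re x > M}" and ?A2.0 = "ball 0 R"])
      show "cball x 1 \<subseteq> {x. Re x > M1}" if "x \<in> {x. Re x > M}" for x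
      proof
        fix y assume "y \<in> cball x 1"
        then have "\<bar>Re (x - y)\<bar> \<le> 1" using abs_Re_le_cmod[of "x - y"] by (simp add: dist_norm)
        then show "y \<in> {x. Re x > M1}" using that by (simp add: M_def)
      qed
      show "cball x 1 \<subseteq> ball 0 (R + 1)" if "x \<in> ball 0 R" for x :: complex
      proof
        fix y assume "y \<in> cball x 1"
        then show "y \<in> ball 0 (R + 1)" using that norm_triangle_ineq4[of x "x - y"] by (simp add: dist_norm)
      qed
    qed (use T v in \<open>auto simp: V'_def strip_def open_halfspace_Re_gt convex_halfspace_Re_gt\<close>)
    then show ?thesis by simp
  qed
  have lipH: "norm (H w - H w') \<le> C * norm (w - w')" if "norm w < R" "norm w' < R" for w w'
  proof -
    have "norm (H w - H w') \<le> C / 1 * norm (w - w')"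
    proof (rule holomorphic_Lipschitz[of H "ball 0 (R + 1)" "ball 0 R"])
      show "cball x 1 \<subseteq> ball 0 (R + 1)" if "x \<in> ball 0 R" for x :: complex
      proof
        fix y assume "y \<in> cball x 1"
        then show "y \<in> ball 0 (R + 1)" using that norm_triangle_ineq4[of x "x - y"] by (simp add: dist_norm)
      qed
    qed (use that HG holomorphic_on_subset[OF hol_H] in auto)
    then show ?thesis by simp
  qed
  have lipL: "norm (\<beta> * Ln (fst v - H (snd v)) - \<beta> * Ln (fst v' - H (snd v')))
      \<le> 1 / 16 * (norm (fst v - fst v') + norm (snd v - snd v'))"
    if v: "v \<in> strip R M" "v' \<in> strip R M" for v v'
  proof -
    define n where "n = norm (fst v - fst v') + norm (snd v - snd v')"
    have n: "n \<ge> 0" by (simp add: n_def)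
    have w: "norm (snd v) < R" "norm (snd v') < R" using v by (auto simp: strip_def)
    have "norm (Ln (fst v - H (snd v)) - Ln (fst v' - H (snd v')))
        \<le> 1 / (M1 / 2) * norm ((fst v - H (snd v)) - (fst v' - H (snd v')))"
      using V'(3)[of v] V'(3)[of v'] v VV' M1(5) by (intro Ln_Lipschitz) auto
    also have "\<dots> \<le> 1 / (M1 / 2) * ((1 + C) * n)"
    proof (rule mult_left_mono)
      have "norm ((fst v - H (snd v)) - (fst v' - H (snd v'))) \<le> norm (fst v - fst v') + norm (H (snd v) - H (snd v'))"
        using norm_triangle_ineq4[of "fst v - fst v'" "H (snd v) - H (snd v')"] by (simp add: algebra_simps)
      also have "\<dots> \<le> norm (fst v - fst v') + C * norm (snd v - snd v')" using lipH[OF w] by simp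
      also have "\<dots> \<le> (1 + C) * n" using C by (simp add: n_def algebra_simps)
      finally show "norm ((fst v - H (snd v)) - (fst v' - H (snd v'))) \<le> (1 + C) * n" .
    qed (use M1 in auto)
    finally have "norm \<beta> * norm (Ln (fst v - H (snd v)) - Ln (fst v' - H (snd v')))
        \<le> norm \<beta> * (1 / (M1 / 2) * ((1 + C) * n))" by (rule mult_left_mono) simp
    also have "\<dots> = k / (M1 / 2) * n" by (simp add: k_def)
    also have "\<dots> \<le> 1 / 16 * n" using kM n by (intro mult_right_mono) auto
    finally show ?thesis by (simp add: n_def norm_mult flip: right_diff_distrib)
  qed
  have \<Theta>1: "fst (\<Theta> v - v) = T1 v + \<beta> * Ln (fst v - H (snd v))" and \<Theta>2: "snd (\<Theta> v - v) = T2 v" for v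
    by (simp_all add: \<Theta>_def \<Phi>_def T1_def T2_def)
  have main: "norm (fst (\<Theta> v - v) - fst (\<Theta> v' - v')) \<le> (norm (fst v - fst v') + norm (snd v - snd v')) / 8
      \<and> norm (snd (\<Theta> v - v) - snd (\<Theta> v' - v')) \<le> (norm (fst v - fst v') + norm (snd v - snd v')) / 8"
    if v: "v \<in> strip R M" "v' \<in> strip R M" for v v'
  proof -
    define n where "n = norm (fst v - fst v') + norm (snd v - snd v')"
    have n: "n \<ge> 0" by (simp add: n_def)
    have "B / M1 * n \<le> 1 / 16 * n" using BM n by (intro mult_right_mono) auto
    then have 1: "norm (T1 v - T1 v') \<le> 1 / 16 * n" "norm (T2 v - T2 v') \<le> 1 / 16 * n"
      using order_trans[OF lip[OF T1h Tb(1) v, folded n_def]] order_trans[OF lip[OF T2h Tb(2) v, folded n_def]]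
      by blast+
    have "fst (\<Theta> v - v) - fst (\<Theta> v' - v') = (T1 v - T1 v') +
        (\<beta> * Ln (fst v - H (snd v)) - \<beta> * Ln (fst v' - H (snd v')))"
      unfolding \<Theta>1 by simp
    also have "norm \<dots> \<le> norm (T1 v - T1 v') + norm (\<beta> * Ln (fst v - H (snd v)) - \<beta> * Ln (fst v' - H (snd v')))"
      by (rule norm_triangle_ineq)
    also have "\<dots> \<le> 1 / 16 * n + 1 / 16 * n"
      by (rule add_mono[OF 1(1) lipL[OF v, folded n_def]])
    finally have "norm (fst (\<Theta> v - v) - fst (\<Theta> v' - v')) \<le> 1 / 16 * n + 1 / 16 * n" .
    then have "norm (fst (\<Theta> v - v) - fst (\<Theta> v' - v')) \<le> n / 8" by simp
    moreover have "norm (T2 v - T2 v') \<le> n / 8" using 1(2) n by linarith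
    ultimately show ?thesis unfolding \<Theta>2 n_def by (rule conjI)
  qed
  have "chart R M"
    unfolding chart_def
  proof (intro conjI ballI)
    show "\<sigma> ` strip R M \<subseteq> \<Omega>" using \<sigma>D VV' tame_limits(3)[OF t] by blast
    show "holo_map \<sigma> (strip R M)" by (rule holo_map_subset[OF \<sigma>h VV'])
    have "holo_map \<Theta> V'" unfolding \<Theta>_def \<Phi>_def by (rule holo_map_Pair[OF \<Phi>h])
    then show "holo_map \<Theta> (strip R M)" by (rule holo_map_subset[OF _ VV'])
    show "norm (snd (\<Theta> v - v)) \<le> 1" if "v \<in> strip R M" for v
    proof -
      have "norm (T2 v) \<le> B / M1" using Tb(2) that VV' by blast
      then show ?thesis using BM unfolding \<Theta>2 by linarith
    qed
  qed (use main in blast)+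
  then show ?thesis by (rule that)
qed

lemma chart_Lipschitz:
  assumes "chart R M" "v \<in> strip R M" "v' \<in> strip R M"
  shows "norm ((\<Theta> v - v) - (\<Theta> v' - v')) \<le> norm (v - v') / 2"
proof -
  have "norm ((\<Theta> v - v) - (\<Theta> v' - v')) \<le> norm (fst (\<Theta> v - v) - fst (\<Theta> v' - v')) + norm (snd (\<Theta> v - v) - snd (\<Theta> v' - v'))"
    using norm_le_fst_snd[of "(\<Theta> v - v) - (\<Theta> v' - v')"] unfolding fst_diff snd_diff .
  also have "\<dots> \<le> (norm (fst v - fst v') + norm (snd v - snd v')) / 8 + (norm (fst v - fst v') + norm (snd v - snd v')) / 8"
    using assms unfolding chart_def by (intro add_mono) blast+
  also have "\<dots> \<le> norm (v - v') / 2"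
    using norm_fst_le[of "fst v - fst v'" "snd v - snd v'"] norm_snd_le[of "snd v - snd v'" "fst v - fst v'"]
    unfolding minus_prod_def[symmetric] by (simp add: field_simps)
  finally show ?thesis .
qed

lemma chart_inverse:
  assumes "chart R M"
  shows "inj_on \<Theta> (strip R M)" "open (\<Theta> ` strip R M)" "holo_map (inv_into (strip R M) \<Theta>) (\<Theta> ` strip R M)"
  using near_identity_inverse[OF open_strip _ chart_Lipschitz[OF assms]] assms by (auto simp: chart_def)

lemma sector_to_strip: "p \<in> sector R M \<Longrightarrow> (X p, snd p) \<in> strip R M \<and> \<sigma> (X p, snd p) = p \<and> \<Theta> (X p, snd p) = \<Phi> p"
  using \<sigma>_X[of p] by (auto simp: sector_def strip_def \<Theta>_def)

lemma \<Phi>_iterate: "p \<in> \<Omega> \<Longrightarrow> \<Phi> ((F ^^ n) p) = (fst (\<Phi> p) + of_nat n, \<rho> ^ n * snd (\<Phi> p))"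
  by (simp add: \<Phi>_def \<Phi>_Fn)

lemma inj_Fn: "inj (F ^^ n)" using inj_fn inj_F by blast

text \<open>
  Two orbits with the same coordinates enter a common sector, where the chart is injective.
\<close>

lemma inj_\<Phi>: "inj_on \<Phi> \<Omega>"
proof (rule inj_onI)
  fix p q assume p: "p \<in> \<Omega>" and q: "q \<in> \<Omega>" and eq: "\<Phi> p = \<Phi> q"
  obtain R1 where R1: "R1 > 0" "\<forall>n. norm (snd ((F ^^ n) p)) < R1" by (rule \<Omega>_bound[OF p])
  obtain R2 where R2: "R2 > 0" "\<forall>n. norm (snd ((F ^^ n) q)) < R2" by (rule \<Omega>_bound[OF q])
  define R where "R = max R1 R2"
  have R: "R > 0" "norm (snd ((F ^^ n) p)) < R" "norm (snd ((F ^^ n) q)) < R" for n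
    using R1 R2 by (auto simp: R_def less_max_iff_disj)
  obtain M where M: "chart R M" by (rule chart_exists[OF R(1)])
  have "\<forall>\<^sub>F n in sequentially. (F ^^ n) p \<in> sector R M \<and> (F ^^ n) q \<in> sector R M"
    by (intro eventually_conj eventually_in_sector p q R)
  then obtain n where n: "(F ^^ n) p \<in> sector R M" "(F ^^ n) q \<in> sector R M"
    unfolding eventually_sequentially by blast
  note vp = sector_to_strip[OF n(1)] and vq = sector_to_strip[OF n(2)]
  have "\<Phi> ((F ^^ n) p) = \<Phi> ((F ^^ n) q)" using \<Phi>_iterate p q eq by simp
  then have "\<Theta> (X ((F ^^ n) p), snd ((F ^^ n) p)) = \<Theta> (X ((F ^^ n) q), snd ((F ^^ n) q))"
    using vp vq by simp
  then have "(X ((F ^^ n) p), snd ((F ^^ n) p)) = (X ((F ^^ n) q), snd ((F ^^ n) q))"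
    using inj_onD[OF chart_inverse(1)[OF M]] vp vq by blast
  then have "(F ^^ n) p = (F ^^ n) q" using vp vq by metis
  then show "p = q" using inj_Fn by (metis injD)
qed

text \<open>
  The coordinates of a given point are translated far to the right by some \<open>n\<close>; there the
  equation \<open>\<Theta> v = y\<close> is the fixed point equation of the contraction \<open>v \<mapsto> y - (\<Theta> v - v)\<close>.  Its
  displacement is bounded in the second component, and in the first component it grows with
  slope at most \<open>1/8\<close>, which is less than the growth of the radius \<open>r\<close> that is available inside
  the strip.
\<close>

lemma surj_\<Phi>: "\<Phi> ` \<Omega> = UNIV"
proof -
  have "\<exists>p\<in>\<Omega>. \<Phi> p = (\<zeta>, \<omega>)" for \<zeta> \<omega>
  proof -
    define R where "R = norm \<omega> + 2"
    have R: "R > 0" by (simp add: R_def add_nonneg_pos)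
    obtain M where M: "chart R M" by (rule chart_exists[OF R])
    define v0 where "v0 = (of_real (M + 1) :: complex, 0 :: complex)"
    have v0: "v0 \<in> strip R M" using R by (simp add: v0_def strip_def)
    define e0 where "e0 = norm (fst (\<Theta> v0 - v0))"
    obtain n :: nat where n: "real n > M + 1 - Re \<zeta> + 2 * (e0 + (\<bar>Im \<zeta>\<bar> + R) / 4)"
      using reals_Archimedean2 by blast
    (* The disc of radius r about \<zeta> + n touches the line Re = M + 1, inside the strip; v0 is a
       reference point at which the displacement does not depend on n. *)
    define r where "r = Re \<zeta> + real n - M - 1"
    have r: "r > 2 * (e0 + (\<bar>Im \<zeta>\<bar> + R) / 4)" using n by (simp add: r_def)
    have r0: "r > 0" using r R by (simp add: e0_def add_nonneg_pos order_le_less_trans[rotated])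
    define y where "y = (\<zeta> + of_nat n, \<rho> ^ n * \<omega>)"
    define S where "S = cball (\<zeta> + of_nat n) r \<times> cball (0::complex) (norm \<omega> + 1)"
    have SV: "S \<subseteq> strip R M"
    proof
      fix v assume v: "v \<in> S"
      then have "\<bar>Re (\<zeta> + of_nat n - fst v)\<bar> \<le> r"
        using abs_Re_le_cmod[of "\<zeta> + of_nat n - fst v"] by (auto simp: S_def dist_norm)
      then have "Re (fst v) > M" by (simp add: r_def)
      then show "v \<in> strip R M" using v by (auto simp: strip_def S_def R_def)
    qed
    define P where "P = (\<lambda>v. y - (\<Theta> v - v))"
    have "\<exists>!v\<in>S. P v = v"
    proof (rule Banach_fix)
      show "complete S" unfolding S_def by (intro compact_imp_complete compact_Times compact_cball)
      have "(\<zeta> + of_nat n, 0) \<in> S" using r0 by (simp add: S_def)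
      then show "S \<noteq> {}" by blast
      show "0 \<le> (1/2::real)" "(1/2::real) < 1" by simp_all
      show "dist (P v) (P v') \<le> 1 / 2 * dist v v'" if "v \<in> S" "v' \<in> S" for v v'
        using chart_Lipschitz[OF M, of v v'] that SV
        by (auto simp: P_def dist_norm norm_minus_commute algebra_simps)
      show "P ` S \<subseteq> S"
      proof (rule image_subsetI)
        fix v assume v: "v \<in> S"
        have vV: "v \<in> strip R M" using v SV by blast
        have w: "norm (snd v) \<le> R" "norm (fst v - (\<zeta> + of_nat n)) \<le> r"
          using v by (auto simp: S_def R_def dist_norm norm_minus_commute)
        have "norm (fst v - of_real (M + 1)) \<le> norm (fst v - (\<zeta> + of_nat n)) + norm (\<zeta> + of_nat n - of_real (M + 1))"
          using norm_triangle_ineq[of "fst v - (\<zeta> + of_nat n)" "\<zeta> + of_nat n - of_real (M + 1)"]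
          by (simp only: diff_add_cancel add_diff_eq)
        also have "norm (\<zeta> + of_nat n - of_real (M + 1)) \<le> \<bar>r\<bar> + \<bar>Im \<zeta>\<bar>"
          using cmod_le[of "\<zeta> + of_nat n - of_real (M + 1)"] by (simp add: r_def diff_diff_eq)
        finally have d: "norm (fst v - fst v0) \<le> 2 * r + \<bar>Im \<zeta>\<bar>" using w(2) r0 by (simp add: v0_def)
        have "norm (fst (\<Theta> v - v) - fst (\<Theta> v0 - v0)) \<le> (norm (fst v - fst v0) + norm (snd v - snd v0)) / 8"
          using M vV v0 unfolding chart_def by blast
        also have "\<dots> \<le> (2 * r + \<bar>Im \<zeta>\<bar> + R) / 8" using d w(1) by (simp add: v0_def)
        finally have "norm (fst (\<Theta> v - v)) \<le> e0 + (2 * r + \<bar>Im \<zeta>\<bar> + R) / 8"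
          using norm_triangle_sub[of "fst (\<Theta> v - v)" "fst (\<Theta> v0 - v0)"] unfolding e0_def by linarith
        also have "\<dots> \<le> r" using r r0 R abs_ge_zero[of "Im \<zeta>"] by (simp add: field_simps)
        finally have 1: "norm (fst (\<Theta> v - v)) \<le> r" .
        have "norm (snd (\<Theta> v - v)) \<le> 1" using M vV unfolding chart_def by blast
        then have 2: "norm (\<rho> ^ n * \<omega> - snd (\<Theta> v - v)) \<le> norm \<omega> + 1"
          using norm_triangle_ineq4[of "\<rho> ^ n * \<omega>" "snd (\<Theta> v - v)"] by (simp add: norm_mult norm_power \<rho>)
        have "P v = (\<zeta> + of_nat n - fst (\<Theta> v - v), \<rho> ^ n * \<omega> - snd (\<Theta> v - v))"
          by (simp add: P_def y_def prod_eq_iff)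
        moreover have "x - y \<in> cball x e" if "norm y \<le> e" for x y :: complex and e
          using that by (simp add: dist_norm)
        ultimately show "P v \<in> S" using 1 2 by (simp add: S_def)
      qed
    qed
    then obtain v where v: "v \<in> S" "P v = v" by blast
    then have \<Theta>v: "\<Theta> v = y" by (simp add: P_def algebra_simps)
    have "\<sigma> v \<in> \<Omega>" using M v(1) SV unfolding chart_def by blast
    moreover obtain p where p: "(F ^^ n) p = \<sigma> v"
      using bij_is_surj[OF bij_fn[OF bij_F, of n]] unfolding surj_def by metis
    ultimately have p\<Omega>: "p \<in> \<Omega>" using Fn_\<Omega>_iff by metis
    have "\<Phi> ((F ^^ n) p) = y" using p \<Theta>v by (simp add: \<Theta>_def)
    then have "\<Phi> p = (\<zeta>, \<omega>)"
      using \<Phi>_iterate[OF p\<Omega>, of n] \<rho>_nz by (simp add: y_def prod_eq_iff)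
    then show ?thesis using p\<Omega> by blast
  qed
  note ex = this
  have "y \<in> \<Phi> ` \<Omega>" for y using ex[of "fst y" "snd y"] by force
  then show ?thesis by blast
qed

lemma Fn_inverse: "(F ^^ n) ((inv F ^^ n) p) = p"
  unfolding inv_fn[OF bij_F, symmetric] by (rule surj_f_inv_f[OF bij_is_surj[OF bij_fn[OF bij_F]]])

text \<open>
  Near \<open>y\<close> the inverse is \<open>F\<^sup>-\<^sup>N \<circ> \<sigma> \<circ> \<Theta>\<^sup>-\<^sup>1 \<circ> T\<close>, where \<open>T\<close> is the effect of \<open>F\<^sup>N\<close> on the coordinates.
\<close>

lemma holo_\<Phi>_inverse: "holo_map (inv_into \<Omega> \<Phi>) UNIV"
proof (rule holo_map_local)
  fix y :: complex2
  define p where "p = inv_into \<Omega> \<Phi> y"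
  have p: "p \<in> \<Omega>" "\<Phi> p = y"
    using surj_\<Phi> by (auto simp: p_def inv_into_into f_inv_into_f)
  obtain R where R: "R > 0" "\<forall>n. norm (snd ((F ^^ n) p)) < R" by (rule \<Omega>_bound[OF p(1)])
  obtain M where M: "chart R M" by (rule chart_exists[OF R(1)])
  obtain N where N: "(F ^^ N) p \<in> sector R M"
    using eventually_in_sector[OF p(1) R(2)[rule_format]] unfolding eventually_sequentially by blast
  define T where "T = (\<lambda>y::complex2. (fst y + of_nat N, \<rho> ^ N * snd y))"
  define W where "W = T -` (\<Theta> ` strip R M)"
  have hT: "holo_map T S" for S
    unfolding T_def by (intro holo_map_Pair holo_fun_intros)
  have W: "open W" unfolding W_def
    by (intro open_vimage chart_inverse[OF M] holo_map_continuous_on hT)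
  have yW: "y \<in> W"
    using \<Phi>_iterate[OF p(1), of N] sector_to_strip[OF N] p(2) by (force simp: W_def T_def)
  have "holo_map (\<lambda>y. (inv F ^^ N) (\<sigma> (inv_into (strip R M) \<Theta> (T y)))) W"
  proof (rule holo_map_compose[where T = UNIV, OF holo_map_funpow[OF holo_F_inv]])
    have "holo_map (\<lambda>y. inv_into (strip R M) \<Theta> (T y)) W"
      by (rule holo_map_compose[OF chart_inverse(3)[OF M] hT]) (auto simp: W_def)
    note hinv = this
    have h\<sigma>: "holo_map \<sigma> (strip R M)" using M by (simp add: chart_def)
    have "(\<lambda>y. inv_into (strip R M) \<Theta> (T y)) ` W \<subseteq> strip R M"
      by (rule image_subsetI) (simp add: W_def inv_into_into)
    then show "holo_map (\<lambda>y. \<sigma> (inv_into (strip R M) \<Theta> (T y))) W"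
      by (rule holo_map_compose[OF h\<sigma> hinv])
  qed simp
  moreover have "(inv F ^^ N) (\<sigma> (inv_into (strip R M) \<Theta> (T y'))) = inv_into \<Omega> \<Phi> y'" if y': "y' \<in> W" for y'
  proof -
    define v where "v = inv_into (strip R M) \<Theta> (T y')"
    have v: "v \<in> strip R M" "\<Theta> v = T y'"
      using y' by (auto simp: v_def W_def inv_into_into f_inv_into_f)
    define q where "q = (inv F ^^ N) (\<sigma> v)"
    have Fq: "(F ^^ N) q = \<sigma> v" by (simp add: q_def Fn_inverse)
    have "\<sigma> v \<in> \<Omega>" using M v(1) unfolding chart_def by blast
    then have q: "q \<in> \<Omega>" using Fq Fn_\<Omega>_iff by metis
    have "\<Phi> ((F ^^ N) q) = T y'" using Fq v(2) by (simp add: \<Theta>_def)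
    then have "\<Phi> q = y'" using \<Phi>_iterate[OF q, of N] \<rho>_nz by (simp add: T_def prod_eq_iff)
    then show ?thesis using inv_into_f_eq[OF inj_\<Phi> q] by (simp add: q_def v_def)
  qed
  ultimately have "holo_map (inv_into \<Omega> \<Phi>) W" by (rule holo_map_cong)
  with W yW show "\<exists>U. open U \<and> y \<in> U \<and> holo_map (inv_into \<Omega> \<Phi>) U" by blast
qed

lemma holo_\<Phi>: "holo_map \<Phi> \<Omega>"
  unfolding \<Phi>_def by (rule holo_map_Pair[OF holo_\<Phi>1 holo_\<Phi>2])

lemma biholomorphic_\<Phi>: "biholomorphic_map \<Phi> \<Omega> UNIV"
  unfolding biholomorphic_map_def bij_betw_def
  using holo_\<Phi> inj_\<Phi> surj_\<Phi> holo_\<Phi>_inverse by blast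

lemma connected_\<Omega>: "connected \<Omega>"
proof -
  have "inv_into \<Omega> \<Phi> ` UNIV = \<Omega>"
    using inj_\<Phi> surj_\<Phi> by (metis bij_betw_def bij_betw_inv_into)
  moreover have "connected (inv_into \<Omega> \<Phi> ` UNIV)"
    by (intro connected_continuous_image holo_map_continuous_on holo_\<Phi>_inverse connected_UNIV)
  ultimately show ?thesis by simp
qed

text \<open>
  Untwisting the second coordinate by \<open>exp (- c * \<Phi>1)\<close> turns the rotation into the identity.
\<close>

lemma translation_coordinate:
  assumes c: "exp c = \<rho>"
  shows "\<exists>\<Phi>'. univalent \<Phi>' \<Omega> \<and> (\<forall>p\<in>\<Omega>. \<Phi>' (F p) = \<Phi>' p + (1, 0))"
proof -
  define \<Phi>' where "\<Phi>' = (\<lambda>p. (\<Phi>1 p, exp (- c * \<Phi>1 p) * \<Phi>2 p))"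
  have "holo_map \<Phi>' \<Omega>" unfolding \<Phi>'_def
    by (intro holo_map_Pair holo_fun_mult holo_fun_constant holo_\<Phi>1 holo_\<Phi>2
        holo_fun_entire[OF holomorphic_on_exp])
  moreover have "inj_on \<Phi>' \<Omega>"
  proof (rule inj_onI)
    fix p q assume pq: "p \<in> \<Omega>" "q \<in> \<Omega>" and eq: "\<Phi>' p = \<Phi>' q"
    from arg_cong[OF eq, of fst] arg_cong[OF eq, of snd]
    have "\<Phi>1 p = \<Phi>1 q" "exp (- c * \<Phi>1 p) * \<Phi>2 p = exp (- c * \<Phi>1 q) * \<Phi>2 q"
      unfolding \<Phi>'_def fst_conv snd_conv .
    moreover from this have "exp (- c * \<Phi>1 q) * \<Phi>2 p = exp (- c * \<Phi>1 q) * \<Phi>2 q" by (simp only:)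
    then have "\<Phi>2 p = \<Phi>2 q" using exp_not_eq_zero mult_left_cancel by blast
    ultimately have "\<Phi> p = \<Phi> q" by (simp add: \<Phi>_def)
    then show "p = q" by (rule inj_onD[OF inj_\<Phi> _ pq])
  qed
  moreover have "\<Phi>' (F p) = \<Phi>' p + (1, 0)" if "p \<in> \<Omega>" for p
  proof -
    have "exp (- c * (\<Phi>1 p + 1)) * \<rho> = exp (- c * \<Phi>1 p)"
    proof -
      have "exp (- c * (\<Phi>1 p + 1)) * \<rho> = exp (- c * (\<Phi>1 p + 1) + c)" unfolding exp_add c ..
      also have "- c * (\<Phi>1 p + 1) + c = - c * \<Phi>1 p" by (simp add: algebra_simps)
      finally show ?thesis .
    qed
    moreover have "\<Phi>1 (F p) = \<Phi>1 p + 1" "\<Phi>2 (F p) = \<rho> * \<Phi>2 p" using \<Phi>_Fn[OF that, of 1] by simp_all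
    ultimately show ?thesis by (simp only: \<Phi>'_def mult.assoc[symmetric]) simp
  qed
  ultimately show ?thesis unfolding univalent_def by blast
qed

end

section \<open>The basin is a Fatou component\<close>

lemma normal_family_subset:
  assumes "normal_family U \<F>" "V \<subseteq> U"
  shows "normal_family V \<F>"
  unfolding normal_family_def
proof (intro allI impI)
  fix G :: "nat \<Rightarrow> _" assume "\<forall>k. G k \<in> \<F>"
  then obtain r :: "nat \<Rightarrow> nat" where r: "strict_mono r"
      "(\<exists>h. converges_on_compacta U (G \<circ> r) h) \<or> compactly_diverges U (G \<circ> r)"
    using assms(1) unfolding normal_family_def by blast
  have "converges_on_compacta V (G \<circ> r) h" if "converges_on_compacta U (G \<circ> r) h" for h
    using that assms(2) unfolding converges_on_compacta_def by (meson order_trans)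
  moreover have "compactly_diverges V (G \<circ> r)" if "compactly_diverges U (G \<circ> r)"
    using that assms(2) unfolding compactly_diverges_def by (meson order_trans)
  ultimately show "\<exists>r. strict_mono r \<and> ((\<exists>h. converges_on_compacta V (G \<circ> r) h) \<or> compactly_diverges V (G \<circ> r))"
    using r by blast
qed

lemma converges_on_compacta_pointwise:
  assumes "converges_on_compacta U G h" "x \<in> U"
  shows "(\<lambda>k. G k x) \<longlonglongrightarrow> h x"
proof -
  have "uniform_limit {x} G h sequentially"
    using assms unfolding converges_on_compacta_def by (metis compact_sing empty_subsetI insert_subset)
  then show ?thesis by (rule tendsto_uniform_limitI) simp
qed

lemma strict_mono_choice:
  fixes P :: "nat \<Rightarrow> nat \<Rightarrow> bool"
  assumes "\<And>k N. \<exists>n>N. P k n"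
  obtains m :: "nat \<Rightarrow> nat" where "strict_mono m" "\<And>k. P k (m k)"
proof -
  have "\<exists>m. \<forall>k. P k (m k) \<and> m k < m (Suc k)"
    by (rule dependent_nat_choice) (use assms in blast)+
  then obtain m where "\<forall>k. P k (m k) \<and> m k < m (Suc k)" ..
  then show ?thesis using that[of m] by (simp add: strict_mono_Suc_iff)
qed

lemma tendsto_0_if_subsequences:
  fixes x :: "nat \<Rightarrow> complex"
  assumes "\<And>m::nat \<Rightarrow> nat. strict_mono m \<Longrightarrow> \<exists>r. strict_mono r \<and> (\<lambda>k. x (m (r k))) \<longlonglongrightarrow> 0"
  shows "x \<longlonglongrightarrow> 0"
proof (rule ccontr)
  assume "\<not> x \<longlonglongrightarrow> 0"
  then obtain e where e: "e > 0" "\<And>N. \<exists>n\<ge>N. \<not> dist (x n) 0 < e"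
    unfolding lim_sequentially by blast
  have "\<exists>n>N. \<not> dist (x n) 0 < e" for N using e(2)[of "Suc N"] by (auto simp: Suc_le_eq)
  then obtain m :: "nat \<Rightarrow> nat" where m: "strict_mono m" "\<And>k. \<not> dist (x (m k)) 0 < e"
    using strict_mono_choice[of "\<lambda>k n. \<not> dist (x n) 0 < e"] by blast
  obtain r where "(\<lambda>k. x (m (r k))) \<longlonglongrightarrow> 0" using assms[OF m(1)] by blast
  then have "\<forall>\<^sub>F k in sequentially. dist (x (m (r k))) 0 < e" using e(1) by (rule tendstoD)
  then show False using m(2) unfolding eventually_sequentially by blast
qed

lemma bounded_if_subsequences:
  fixes x :: "nat \<Rightarrow> complex"
  assumes "\<And>m::nat \<Rightarrow> nat. strict_mono m \<Longrightarrow> \<exists>r. strict_mono r \<and> convergent (\<lambda>k. x (m (r k)))"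
  shows "bounded (range x)"
proof (rule ccontr)
  assume nb: "\<not> bounded (range x)"
  have "\<exists>n>N. norm (x n) > real k" for k N
  proof (rule ccontr)
    assume "\<not> (\<exists>n>N. norm (x n) > real k)"
    then have "norm (x n) \<le> real k" if "n > N" for n using that by (meson not_less)
    then have "x ` {N<..} \<subseteq> cball 0 (real k)" by auto
    then have "bounded (x ` {N<..})" using bounded_cball bounded_subset by blast
    moreover have "bounded (x ` {..N})" by (intro finite_imp_bounded) auto
    ultimately have "bounded (x ` ({N<..} \<union> {..N}))" unfolding image_Un bounded_Un ..
    moreover have "{N<..} \<union> {..N} = (UNIV :: nat set)" by auto
    ultimately show False using nb by simp
  qed
  then obtain m :: "nat \<Rightarrow> nat" where m: "strict_mono m" "\<And>k. norm (x (m k)) > real k"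
    using strict_mono_choice[of "\<lambda>k n. norm (x n) > real k"] by blast
  obtain r where r: "strict_mono r" "convergent (\<lambda>k. x (m (r k)))" using assms[OF m(1)] by blast
  then have "Bseq (\<lambda>k. x (m (r k)))" by (intro convergent_imp_Bseq)
  then obtain B where B: "\<And>k. norm (x (m (r k))) \<le> B" unfolding Bseq_def by blast
  obtain k :: nat where "real k > B" using reals_Archimedean2 by blast
  moreover have "k \<le> r k" using r(1) by (rule strict_mono_imp_increasing)
  ultimately show False using m(2)[of "r k"] B[of k] by (smt (verit) of_nat_mono)
qed

text \<open>
  The identity theorem on a ball: a complex line through \<open>p\<close> and \<open>x\<close> meets the ball in a convex
  set, on which the limit is a holomorphic function of one variable.
\<close>

lemma line_identity:
  fixes h :: "complex2 \<Rightarrow> complex"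
  assumes B: "B = ball q e" and p: "p \<in> B" and x: "x \<in> B"
    and u: "\<And>n. holo_fun (u n) UNIV"
    and lim: "\<And>K. compact K \<Longrightarrow> K \<subseteq> B \<Longrightarrow> uniform_limit K u h sequentially"
    and W: "open W" "p \<in> W" and zero: "\<And>y. y \<in> W \<inter> B \<Longrightarrow> h y = 0"
  shows "h x = 0"
proof -
  define l where "l = (\<lambda>t. (fst p + t * (fst x - fst p), snd p + t * (snd x - snd p)))"
  have lc: "continuous_on S l" for S unfolding l_def by (intro continuous_intros)
  define T where "T = l -` B"
  have oT: "open T" unfolding T_def B by (intro open_vimage lc open_ball)
  have cT: "convex T"
  proof (rule convexI)
    fix s t and a b :: real assume st: "s \<in> T" "t \<in> T" and ab: "0 \<le> a" "0 \<le> b" "a + b = 1"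
    have "l (a *\<^sub>R s + b *\<^sub>R t) = a *\<^sub>R l s + b *\<^sub>R l t"
    proof -
      have b: "complex_of_real b = 1 - of_real a" using ab(3) by (metis add_diff_cancel_left' of_real_1 of_real_diff)
      show ?thesis unfolding l_def by (simp add: scaleR_conv_of_real b algebra_simps)
    qed
    moreover have "a *\<^sub>R l s + b *\<^sub>R l t \<in> B"
      using st unfolding T_def B vimage_eq by (intro convexD[OF convex_ball] ab)
    ultimately show "a *\<^sub>R s + b *\<^sub>R t \<in> T" by (simp add: T_def)
  qed
  have hol: "(\<lambda>t. h (l t)) holomorphic_on T"
  proof (rule holomorphic_uniform_sequence[OF oT])
    show "(\<lambda>t. u n (l t)) holomorphic_on T" for n
      unfolding l_def by (rule holo_fun_on_line[OF u]) auto
    show "\<exists>d>0. cball t d \<subseteq> T \<and> uniform_limit (cball t d) (\<lambda>n t. u n (l t)) (\<lambda>t. h (l t)) sequentially"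
      if t: "t \<in> T" for t
    proof -
      obtain d where d: "d > 0" "cball t d \<subseteq> T" using oT t open_contains_cball by metis
      have "uniform_limit (l ` cball t d) u h sequentially"
        using d by (intro lim compact_continuous_image lc compact_cball) (auto simp: T_def)
      then have "uniform_limit (cball t d) (\<lambda>n t. u n (l t)) (\<lambda>t. h (l t)) sequentially"
        by (rule uniform_limit_compose') auto
      with d show ?thesis by blast
    qed
  qed
  have l0: "l 0 = p" and l1: "l 1 = x" by (simp_all add: l_def)
  define Z where "Z = T \<inter> l -` W"
  have Z: "open Z" "0 \<in> Z" using oT p W l0 by (auto simp: Z_def T_def intro!: open_vimage lc)
  have "h (l 1) = 0"
  proof (rule analytic_continuation[OF hol oT])
    show "connected T" using cT convex_connected by blast
    show "Z \<subseteq> T" "0 \<in> T" using Z(2) by (auto simp: Z_def)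
    show "0 islimpt Z" using Z by (simp add: interior_limit_point interior_open)
    show "h (l t) = 0" if "t \<in> Z" for t using that zero by (auto simp: Z_def T_def)
    show "1 \<in> T" using x l1 by (simp add: T_def)
  qed
  then show ?thesis by (simp add: l1)
qed

context parabolic_map
begin

text \<open>
  A sequence of iterates either repeats one iterate infinitely often, or its exponents tend to
  infinity.  In the second case a subsequence along which \<open>\<rho>\<^sup>n\<close> converges to some \<open>\<mu>\<close> makes the
  iterates converge to \<open>(0, \<mu> * \<Phi>2)\<close>.
\<close>

lemma normal_on_basin:
  assumes S: "S \<subseteq> \<Omega>" and C: "C > 0"
    and est: "\<And>q n. q \<in> S \<Longrightarrow> n \<ge> N \<Longrightarrow> norm (fst ((F ^^ n) q)) \<le> C / (M + real (n - N) / 2)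
        \<and> norm (snd ((F ^^ n) q) - \<rho> ^ n * \<Phi>2 q) \<le> C / (M + real (n - N) / 2)"
  shows "normal_family S (range (\<lambda>n. F ^^ n))"
  unfolding normal_family_def
proof (intro allI impI)
  fix G :: "nat \<Rightarrow> complex2 \<Rightarrow> complex2" assume "\<forall>k. G k \<in> range (\<lambda>n. F ^^ n)"
  then have "\<forall>k. \<exists>n. G k = F ^^ n" by blast
  then obtain m where m: "\<And>k. G k = F ^^ m k" by metis
  show "\<exists>r. strict_mono r \<and> ((\<exists>h. converges_on_compacta S (G \<circ> r) h) \<or> compactly_diverges S (G \<circ> r))"
  proof (cases "\<exists>j. infinite {k. m k = j}")
    case True
    then obtain j where j: "infinite {k. m k = j}" by blast
    define r where "r = enumerate {k. m k = j}"
    have r: "strict_mono r" unfolding r_def by (rule strict_mono_enumerate[OF j])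
    have "m (r k) = j" for k using enumerate_in_set[OF j, of k] by (simp add: r_def)
    then have "G \<circ> r = (\<lambda>k. F ^^ j)" by (auto simp: m)
    then have "converges_on_compacta S (G \<circ> r) (F ^^ j)"
      unfolding converges_on_compacta_def by (simp add: uniform_limit_const)
    with r show ?thesis by blast
  next
    case False
    then have fin: "finite {k. m k = j}" for j by blast
    have mtop: "filterlim m at_top sequentially"
      unfolding filterlim_at_top
    proof
      fix Z
      have "{k. m k < Z} = (\<Union>j\<in>{..<Z}. {k. m k = j})" by auto
      then have "finite {k. m k < Z}" using fin by auto
      then have "\<forall>\<^sub>F k in cofinite. m k \<ge> Z"
        unfolding eventually_cofinite by (simp add: not_le)
      then show "\<forall>\<^sub>F k in sequentially. m k \<ge> Z" by (simp add: cofinite_eq_sequentially)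
    qed
    have "\<forall>k. \<rho> ^ m k \<in> sphere 0 1" by (simp add: norm_power \<rho>)
    then obtain \<mu> r where r: "strict_mono r" "((\<lambda>k. \<rho> ^ m k) \<circ> r) \<longlonglongrightarrow> \<mu>"
      using compact_sphere[of "0::complex" 1] unfolding compact_def by metis
    define n where "n = m \<circ> r"
    have ntop: "filterlim n at_top sequentially"
      unfolding n_def comp_def by (rule filterlim_compose[OF mtop filterlim_subseq[OF r(1)]])
    have \<mu>: "(\<lambda>k. \<rho> ^ n k) \<longlonglongrightarrow> \<mu>" using r(2) by (simp add: n_def comp_def)
    have "converges_on_compacta S (G \<circ> r) (\<lambda>q. (0, \<mu> * \<Phi>2 q))"
      unfolding converges_on_compacta_def
    proof (intro allI impI)
      fix K assume K: "compact K \<and> K \<subseteq> S"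
      have "continuous_on K \<Phi>2"
        using holo_fun_continuous_on[OF holo_\<Phi>2] K S continuous_on_subset by blast
      then have "bounded (\<Phi>2 ` K)" using K compact_continuous_image compact_imp_bounded by blast
      then obtain B where B: "B > 0" "\<And>q. q \<in> K \<Longrightarrow> norm (\<Phi>2 q) \<le> B" unfolding bounded_pos by blast
      define d where "d = (\<lambda>k. 2 * (C / (M + real (n k - N) / 2)) + norm (\<rho> ^ n k - \<mu>) * B)"
      have "filterlim (\<lambda>k. n k - N) at_top sequentially"
        by (rule filterlim_compose[OF filterlim_minus_const_nat_at_top ntop])
      then have "(\<lambda>k. C / (M + real (n k - N) / 2)) \<longlonglongrightarrow> 0"
        using filterlim_compose[OF half_seq_tendsto] by blast
      moreover have "(\<lambda>k. norm (\<rho> ^ n k - \<mu>)) \<longlonglongrightarrow> 0"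
        using \<mu> by (simp add: LIM_zero tendsto_norm_zero)
      ultimately have d0: "d \<longlonglongrightarrow> 2 * 0 + 0 * B"
        unfolding d_def by (intro tendsto_add tendsto_mult tendsto_const)
      show "uniform_limit K (G \<circ> r) (\<lambda>q. (0, \<mu> * \<Phi>2 q)) sequentially"
      proof (rule uniform_limitI)
        fix e :: real assume "e > 0"
        with d0 have "\<forall>\<^sub>F k in sequentially. d k < e" using order_tendstoD(2) by fastforce
        moreover have "\<forall>\<^sub>F k in sequentially. n k \<ge> N" using ntop by (simp add: filterlim_at_top)
        ultimately show "\<forall>\<^sub>F k in sequentially. \<forall>q\<in>K. dist ((G \<circ> r) k q) (0, \<mu> * \<Phi>2 q) < e"
        proof eventually_elim
          case (elim k)
          show ?case
          proof
            fix q assume q: "q \<in> K"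
            define y where "y = (F ^^ n k) q"
            have es: "norm (fst y) \<le> C / (M + real (n k - N) / 2)"
              "norm (snd y - \<rho> ^ n k * \<Phi>2 q) \<le> C / (M + real (n k - N) / 2)"
              using est[of q "n k"] q K elim(2) by (auto simp: y_def)
            have "norm (snd y - \<mu> * \<Phi>2 q) \<le> norm (snd y - \<rho> ^ n k * \<Phi>2 q) + norm ((\<rho> ^ n k - \<mu>) * \<Phi>2 q)"
              using norm_triangle_ineq[of "snd y - \<rho> ^ n k * \<Phi>2 q" "(\<rho> ^ n k - \<mu>) * \<Phi>2 q"]
              by (simp add: algebra_simps)
            also have "norm ((\<rho> ^ n k - \<mu>) * \<Phi>2 q) \<le> norm (\<rho> ^ n k - \<mu>) * B"
              unfolding norm_mult using B(2)[OF q] by (intro mult_left_mono) auto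
            finally have "norm (snd y - \<mu> * \<Phi>2 q) \<le> C / (M + real (n k - N) / 2) + norm (\<rho> ^ n k - \<mu>) * B"
              using es(2) by linarith
            moreover have "norm (y - (0, \<mu> * \<Phi>2 q)) \<le> norm (fst y) + norm (snd y - \<mu> * \<Phi>2 q)"
              using norm_le_fst_snd[of "y - (0, \<mu> * \<Phi>2 q)"] by simp
            ultimately have "norm (y - (0, \<mu> * \<Phi>2 q)) \<le> d k" using es(1) unfolding d_def by linarith
            then show "dist ((G \<circ> r) k q) (0, \<mu> * \<Phi>2 q) < e"
              using elim(1) by (simp add: dist_norm m y_def n_def)
          qed
        qed
      qed
    qed
    with r(1) show ?thesis by blast
  qed
qed

lemma \<Omega>_subset_fatou: "\<Omega> \<subseteq> fatou_set F"
proof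
  fix p assume p: "p \<in> \<Omega>"
  obtain S M N C where S: "open S" "p \<in> S" "S \<subseteq> \<Omega>" and C: "C > 0"
    and est: "\<forall>q n. q \<in> S \<longrightarrow> n \<ge> N \<longrightarrow> norm (fst ((F ^^ n) q)) \<le> C / (M + real (n - N) / 2)
        \<and> norm (snd ((F ^^ n) q) - \<rho> ^ n * \<Phi>2 q) \<le> C / (M + real (n - N) / 2)"
    by (rule \<Omega>_local[OF p]) blast
  have "normal_family S (range (\<lambda>n. F ^^ n))"
    by (rule normal_on_basin[OF S(3) C]) (use est in blast)
  then show "p \<in> fatou_set F" using S(1,2) unfolding fatou_set_def by blast
qed

lemma fst_Fn_DERIV: "((\<lambda>t. fst ((F ^^ n) (t, w))) has_field_derivative 1) (at 0)"
proof (induction n)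
  case 0
  then show ?case by simp
next
  case (Suc n)
  have "holo_fun (\<lambda>p. s ((F ^^ n) p)) UNIV" by (rule holo_fun_compose[OF holo_s Fn_holo]) auto
  from DERIV_mult[OF Suc DERIV_add[OF DERIV_const slice_DERIV[OF this]], of 1 w]
  have "((\<lambda>t. fst ((F ^^ n) (t, w)) * (1 + s ((F ^^ n) (t, w)))) has_field_derivative
      1 * (1 + s ((F ^^ n) (0, w))) + (0 + deriv (\<lambda>t. s ((F ^^ n) (t, w))) 0) * fst ((F ^^ n) (0, w))) (at 0)" .
  moreover have z: "fst ((F ^^ n) (0, w)) = 0" by (simp add: fst_Fn_eq_0_iff)
  moreover have "s ((F ^^ n) (0, w)) = 0" using z by (simp add: s_def)
  ultimately show ?case by (simp add: fst_F)
qed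

lemma bounded_orbit:
  assumes p: "p \<in> \<Omega>"
  obtains B where "\<forall>n. (F ^^ n) p \<in> cball 0 B"
proof -
  obtain R where R: "R > 0" "\<forall>n. norm (snd ((F ^^ n) p)) < R" by (rule \<Omega>_bound[OF p])
  have "convergent (\<lambda>n. fst ((F ^^ n) p))" using p unfolding \<Omega>_def convergent_def by blast
  then have "Bseq (\<lambda>n. fst ((F ^^ n) p))" by (rule convergent_imp_Bseq)
  then obtain B where B: "\<And>n. norm (fst ((F ^^ n) p)) \<le> B" unfolding Bseq_def by blast
  have "norm ((F ^^ n) p) \<le> B + R" for n
    using norm_le_fst_snd[of "(F ^^ n) p"] B[of n] R(2)[rule_format, of n] by linarith
  then show ?thesis by (intro that[of "B + R"]) simp
qed

text \<open>
  Orbits in \<open>\<Omega>\<close> are bounded, so iterates cannot diverge on a set that meets \<open>\<Omega>\<close>.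
\<close>

lemma no_divergence:
  assumes "p \<in> \<Omega>" "p \<in> W" "compactly_diverges W (\<lambda>k. F ^^ m k)"
  shows False
proof -
  obtain B where B: "\<forall>n. (F ^^ n) p \<in> cball 0 B" by (rule bounded_orbit[OF assms(1)])
  have "\<forall>\<^sub>F k in sequentially. (F ^^ m k) ` {p} \<inter> cball 0 B = {}"
    using assms(2,3) unfolding compactly_diverges_def by (metis compact_cball compact_sing empty_subsetI insert_subset)
  then show False using B by (auto simp: eventually_sequentially)
qed

text \<open>
  Every subsequence of the iterates has a further subsequence that converges on a ball \<open>B\<close> about
  \<open>q\<close>.  The limit is finite, since \<open>B\<close> contains a point \<open>p\<close> of \<open>\<Omega>\<close>, and its first component vanishes
  on \<open>B \<inter> \<Omega>\<close>, hence on \<open>B\<close>.  This gives \<open>z \<longlonglongrightarrow> 0\<close> and \<open>w\<close> bounded along the orbit of \<open>q\<close>.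
\<close>

lemma fatou_boundary_point:
  assumes q: "q \<in> fatou_set F" "q \<in> closure \<Omega>"
  shows "q \<in> \<Omega>"
proof -
  obtain U where U: "open U" "q \<in> U" "normal_family U (range (\<lambda>n. F ^^ n))"
    using q(1) unfolding fatou_set_def by blast
  obtain e where e: "e > 0" "ball q e \<subseteq> U" using U open_contains_ball by metis
  define B where "B = ball q e"
  have nB: "normal_family B (range (\<lambda>n. F ^^ n))"
    unfolding B_def by (rule normal_family_subset[OF U(3) e(2)])
  obtain p where p: "p \<in> \<Omega>" "p \<in> B"
    using q(2) e(1) unfolding closure_approachable B_def by (metis dist_commute mem_ball)
  have sub: "\<exists>r h. strict_mono r \<and> converges_on_compacta B (\<lambda>k. F ^^ m (r k)) h \<and> (\<forall>x\<in>B. fst (h x) = 0)"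
    if m: "strict_mono m" for m :: "nat \<Rightarrow> nat"
  proof -
    have "\<forall>k. F ^^ m k \<in> range (\<lambda>n. F ^^ n)" by blast
    then obtain r :: "nat \<Rightarrow> nat" where r: "strict_mono r"
      "(\<exists>h. converges_on_compacta B ((\<lambda>k. F ^^ m k) \<circ> r) h) \<or> compactly_diverges B ((\<lambda>k. F ^^ m k) \<circ> r)"
      using nB unfolding normal_family_def by meson
    have comp: "(\<lambda>k. F ^^ m k) \<circ> r = (\<lambda>k. F ^^ m (r k))" by (simp add: comp_def)
    from r(2) no_divergence[OF p, of "\<lambda>k. m (r k)"] obtain h where h: "converges_on_compacta B (\<lambda>k. F ^^ m (r k)) h"
      unfolding comp by blast
    have mr: "strict_mono (\<lambda>k. m (r k))" using m r(1) by (simp add: strict_mono_def)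
    have "fst (h x) = 0" if x: "x \<in> B" for x
    proof (rule line_identity[OF B_def p(2) x])
      show "holo_fun (\<lambda>p. fst ((F ^^ m (r n)) p)) UNIV" for n
        using Fn_holo unfolding holo_map_def by blast
      show "uniform_limit K (\<lambda>n p. fst ((F ^^ m (r n)) p)) (\<lambda>x. fst (h x)) sequentially"
        if "compact K" "K \<subseteq> B" for K
      proof (rule uniform_limitI)
        fix e :: real assume "e > 0"
        moreover have "uniform_limit K (\<lambda>k. F ^^ m (r k)) h sequentially"
          using h that unfolding converges_on_compacta_def by blast
        ultimately have "\<forall>\<^sub>F n in sequentially. \<forall>x\<in>K. dist ((F ^^ m (r n)) x) (h x) < e"
          by (simp add: uniform_limit_iff)
        then show "\<forall>\<^sub>F n in sequentially. \<forall>x\<in>K. dist (fst ((F ^^ m (r n)) x)) (fst (h x)) < e"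
          by eventually_elim (meson dist_fst_le order_le_less_trans)
      qed
      show "open \<Omega>" "p \<in> \<Omega>" by (rule open_\<Omega>, rule p(1))
      show "fst (h y) = 0" if y: "y \<in> \<Omega> \<inter> B" for y
      proof -
        have "(\<lambda>k. fst ((F ^^ m (r k)) y)) \<longlonglongrightarrow> fst (h y)"
          using converges_on_compacta_pointwise[OF h] y by (intro tendsto_fst) auto
        moreover have "(\<lambda>k. fst ((F ^^ m (r k)) y)) \<longlonglongrightarrow> 0"
          using LIMSEQ_subseq_LIMSEQ[OF _ mr, of "\<lambda>n. fst ((F ^^ n) y)" 0] y
          by (simp add: \<Omega>_def comp_def)
        ultimately show ?thesis by (rule LIMSEQ_unique)
      qed
    qed
    with r(1) h show ?thesis by blast
  qed
  have qB: "q \<in> B" using e(1) by (simp add: B_def)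
  have z: "(\<lambda>n. fst ((F ^^ n) q)) \<longlonglongrightarrow> 0"
  proof (rule tendsto_0_if_subsequences)
    fix m :: "nat \<Rightarrow> nat" assume "strict_mono m"
    from sub[OF this] obtain r h where r: "strict_mono r" "converges_on_compacta B (\<lambda>k. F ^^ m (r k)) h"
      "\<forall>x\<in>B. fst (h x) = 0" by blast
    have "(\<lambda>k. fst ((F ^^ m (r k)) q)) \<longlonglongrightarrow> fst (h q)"
      by (rule tendsto_fst[OF converges_on_compacta_pointwise[OF r(2) qB]])
    then show "\<exists>r. strict_mono r \<and> (\<lambda>k. fst ((F ^^ m (r k)) q)) \<longlonglongrightarrow> 0"
      using r(1,3) qB by auto
  qed
  have w: "bounded (range (\<lambda>n. snd ((F ^^ n) q)))"
  proof (rule bounded_if_subsequences)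
    fix m :: "nat \<Rightarrow> nat" assume "strict_mono m"
    from sub[OF this] obtain r h where r: "strict_mono r" "converges_on_compacta B (\<lambda>k. F ^^ m (r k)) h" by blast
    have "(\<lambda>k. snd ((F ^^ m (r k)) q)) \<longlonglongrightarrow> snd (h q)"
      by (rule tendsto_snd[OF converges_on_compacta_pointwise[OF r(2) qB]])
    then show "\<exists>r. strict_mono r \<and> convergent (\<lambda>k. snd ((F ^^ m (r k)) q))"
      using r(1) convergentI by blast
  qed
  (* On the line the transversal derivative of every iterate is 1, but on the disc of radius e/2
     some iterate has first component at most e/4, so its derivative is at most 1/2. *)
  have "fst q \<noteq> 0"
  proof
    assume q0: "fst q = 0"
    have "strict_mono (\<lambda>n::nat. n)" by (simp add: strict_mono_def)
    from sub[OF this] obtain r h where r: "converges_on_compacta B (\<lambda>k. F ^^ r k) h" "\<forall>x\<in>B. fst (h x) = 0"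
      by blast
    define K where "K = (\<lambda>t. (t, snd q)) ` cball (0::complex) (e / 2)"
    have "compact K" unfolding K_def
      by (intro compact_continuous_image compact_cball continuous_intros)
    moreover have KB: "K \<subseteq> B"
    proof
      fix x assume "x \<in> K"
      then obtain t where t: "x = (t, snd q)" "norm t \<le> e / 2" by (auto simp: K_def)
      have "dist q x = norm t" using q0 t(1) by (cases q) (simp add: dist_Pair_Pair dist_norm)
      then show "x \<in> B" using t(2) e(1) by (simp add: B_def)
    qed
    ultimately have "uniform_limit K (\<lambda>k. F ^^ r k) h sequentially"
      using r(1) unfolding converges_on_compacta_def by blast
    then have "\<forall>\<^sub>F k in sequentially. \<forall>x\<in>K. dist ((F ^^ r k) x) (h x) < e / 4"
      by (rule uniform_limitD) (use e(1) in simp)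
    then obtain k where k: "\<And>x. x \<in> K \<Longrightarrow> dist ((F ^^ r k) x) (h x) < e / 4"
      unfolding eventually_sequentially by blast
    have small: "norm (fst ((F ^^ r k) (t, snd q))) \<le> e / 4" if "t \<in> cball 0 (e / 2)" for t
    proof -
      have x: "(t, snd q) \<in> K" using that by (auto simp: K_def)
      have "dist (fst ((F ^^ r k) (t, snd q))) (fst (h (t, snd q))) \<le> dist ((F ^^ r k) (t, snd q)) (h (t, snd q))"
        by (rule dist_fst_le)
      then show ?thesis using k[OF x] r(2) x KB by (auto simp: dist_norm)
    qed
    have "holo_fun (\<lambda>p. fst ((F ^^ r k) p)) UNIV" using Fn_holo unfolding holo_map_def by blast
    then have "(\<lambda>t. fst ((F ^^ r k) (t, snd q))) holomorphic_on UNIV"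
      by (rule holo_fun_fst_slice) auto
    then have "norm (deriv (\<lambda>t. fst ((F ^^ r k) (t, snd q))) 0) \<le> (e / 4) / (e / 2)"
      by (rule holomorphic_deriv_bound) (use e(1) small in auto)
    moreover have "deriv (\<lambda>t. fst ((F ^^ r k) (t, snd q))) 0 = 1"
      by (rule DERIV_imp_deriv[OF fst_Fn_DERIV])
    ultimately show False using e(1) by simp
  qed
  with z w show ?thesis by (simp add: \<Omega>_def)
qed

lemma \<Phi>2_surj: obtains p where "p \<in> \<Omega>" "\<Phi>2 p = w"
proof -
  have "(0, w) \<in> \<Phi> ` \<Omega>" using surj_\<Phi> by simp
  then show ?thesis using that by (auto simp: \<Phi>_def)
qed

text \<open>
  \<open>\<Omega>\<close> is open and connected, and relatively closed in the Fatou set.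
\<close>

lemma fatou_component_\<Omega>: "fatou_component F \<Omega>"
  unfolding fatou_component_def in_components_maximal
proof (intro conjI allI impI)
  show ne: "\<Omega> \<noteq> {}" using surj_\<Phi> by auto
  show "\<Omega> \<subseteq> fatou_set F" by (rule \<Omega>_subset_fatou)
  show "connected \<Omega>" by (rule connected_\<Omega>)
  fix d assume d: "d \<noteq> {} \<and> \<Omega> \<subseteq> d \<and> d \<subseteq> fatou_set F \<and> connected d"
  have "openin (top_of_set d) \<Omega>" using d open_\<Omega> by (simp add: open_subset)
  moreover have "closedin (top_of_set d) \<Omega>"
  proof -
    have "\<Omega> = d \<inter> closure \<Omega>" using d fatou_boundary_point closure_subset by blast
    with closed_closure[of \<Omega>] show ?thesis unfolding closedin_closed by blast
  qed
  ultimately show "d = \<Omega>" using d ne unfolding connected_clopen by metis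
qed

lemma F_image_\<Omega>: "F ` \<Omega> = \<Omega>"
proof
  show "F ` \<Omega> \<subseteq> \<Omega>" using F_\<Omega>_iff by blast
  show "\<Omega> \<subseteq> F ` \<Omega>"
  proof
    fix p assume "p \<in> \<Omega>"
    moreover obtain q where "p = F q" using bij_is_surj[OF bij_F] by (rule surjE)
    ultimately show "p \<in> F ` \<Omega>" using F_\<Omega>_iff by blast
  qed
qed

lemma non_recurrent_\<Omega>: "non_recurrent F \<Omega>"
  unfolding non_recurrent_def
proof (intro ballI allI impI)
  fix p K assume p: "p \<in> \<Omega>" and K: "compact K \<and> K \<subseteq> \<Omega>"
  show "\<forall>\<^sub>F n in sequentially. (F ^^ n) p \<notin> K"
  proof (cases "K = {}")
    case False
    have "continuous_on K (\<lambda>p. norm (fst p))" by (intro continuous_intros)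
    from continuous_attains_inf[OF conjunct1[OF K] False this]
    obtain x where x: "x \<in> K" "\<forall>y\<in>K. norm (fst x) \<le> norm (fst y)" ..
    have "norm (fst x) > 0" using x(1) K by (auto simp: \<Omega>_def)
    moreover have "(\<lambda>n. fst ((F ^^ n) p)) \<longlonglongrightarrow> 0" using p by (simp add: \<Omega>_def)
    ultimately have "\<forall>\<^sub>F n in sequentially. dist (fst ((F ^^ n) p)) 0 < norm (fst x)"
      by (intro tendstoD)
    then show ?thesis
    proof eventually_elim
      case (elim n)
      show ?case
      proof
        assume "(F ^^ n) p \<in> K"
        with x(2) have "norm (fst x) \<le> norm (fst ((F ^^ n) p))" by blast
        with elim show False by simp
      qed
    qed
  qed simp
qed

text \<open>
  The orbits with \<open>\<Phi>2 p = 0\<close> converge to the origin.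
\<close>

lemma origin_in_omega_limit: "(0, 0) \<in> omega_limit_set F \<Omega>"
proof -
  obtain p where p: "p \<in> \<Omega>" "\<Phi>2 p = 0" by (rule \<Phi>2_surj)
  have "(\<lambda>n. (fst ((F ^^ n) p), snd ((F ^^ n) p))) \<longlonglongrightarrow> (0, 0)"
    using p(1) \<Omega>_limits(3)[OF p(1)] p(2) by (intro tendsto_Pair) (simp_all add: \<Omega>_def)
  moreover have "strict_mono (\<lambda>n::nat. n)" by (simp add: strict_mono_def)
  ultimately show ?thesis using p(1) unfolding omega_limit_set_def prod.collapse by blast
qed

lemma origin_isolated:
  assumes "\<rho> \<noteq> 1"
  shows "(0, 0) isolated_in {q. F q = q}"
proof -
  define T where "T = {p. f (snd p) + a p * fst p \<noteq> 0}"
  have "open T" unfolding T_def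
    by (intro open_Collect_neq continuous_intros holo_fun_continuous_on
        holo_fun_intros holo_fun_entire[OF hol_f] hol_a)
  moreover have "T \<inter> {q. F q = q} = {(0, 0)}"
  proof
    show "T \<inter> {q. F q = q} \<subseteq> {(0, 0)}"
    proof
      fix p assume p: "p \<in> T \<inter> {q. F q = q}"
      then have "fst p * (1 + s p) = fst p" using fst_F[of p] by simp
      then have "fst p * (fst p * (f (snd p) + a p * fst p)) = 0"
        by (simp add: s_def algebra_simps power2_eq_square)
      then have z: "fst p = 0" using p by (simp add: T_def)
      then have "F p = (0, \<rho> * snd p)" using F_line[of "snd p"] by (cases p) simp
      then have "\<rho> * snd p = snd p" using p by (cases p) auto
      then have "(\<rho> - 1) * snd p = 0" by (simp add: algebra_simps)
      then have "snd p = 0" using assms by simp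
      with z show "p \<in> {(0, 0)}" by (cases p) simp
    qed
    have "f 0 = \<kappa>" using H_eq[of 0] \<kappa> by simp
    then show "{(0, 0)} \<subseteq> T \<inter> {q. F q = q}" using \<kappa> by (simp add: T_def F_line)
  qed
  ultimately show ?thesis unfolding isolated_in_def by blast
qed

text \<open>
  The second component along a point with \<open>\<Phi>2 = 1\<close> shows that \<open>\<rho> ^ n k\<close> converges to some \<open>\<mu>\<close> on the
  unit circle; then the limit is \<open>(0, \<mu> * \<Phi>2)\<close>, and \<open>\<Phi>2\<close> is surjective.
\<close>

lemma limit_map_image:
  assumes "limit_map F \<Omega> h"
  shows "h ` \<Omega> = Some ` ({0} \<times> UNIV)"
proof -
  obtain n :: "nat \<Rightarrow> nat" where n: "strict_mono n"
    and "(\<exists>h'. converges_on_compacta \<Omega> (\<lambda>k. F ^^ n k) h' \<and> (\<forall>p\<in>\<Omega>. h p = Some (h' p))) \<or>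
         (compactly_diverges \<Omega> (\<lambda>k. F ^^ n k) \<and> (\<forall>p\<in>\<Omega>. h p = None))"
    using assms unfolding limit_map_def by blast
  moreover obtain p1 where p1: "p1 \<in> \<Omega>" "\<Phi>2 p1 = 1" by (rule \<Phi>2_surj)
  ultimately obtain h' where h': "converges_on_compacta \<Omega> (\<lambda>k. F ^^ n k) h'" "\<forall>p\<in>\<Omega>. h p = Some (h' p)"
    using no_divergence[OF p1(1) p1(1), of n] by blast
  have fst_h: "fst (h' p) = 0" and snd_h: "(\<lambda>k. \<rho> ^ n k * \<Phi>2 p) \<longlonglongrightarrow> snd (h' p)" if p: "p \<in> \<Omega>" for p
  proof -
    note pw = converges_on_compacta_pointwise[OF h'(1) p]
    have "(\<lambda>k. fst ((F ^^ n k) p)) \<longlonglongrightarrow> 0"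
      using LIMSEQ_subseq_LIMSEQ[OF _ n, of "\<lambda>n. fst ((F ^^ n) p)" 0] p by (simp add: \<Omega>_def comp_def)
    then show "fst (h' p) = 0" using LIMSEQ_unique tendsto_fst[OF pw] by blast
    have "(\<lambda>k. snd ((F ^^ n k) p) - \<rho> ^ n k * \<Phi>2 p) \<longlonglongrightarrow> 0"
      using LIMSEQ_subseq_LIMSEQ[OF \<Omega>_limits(3)[OF p] n] by (simp add: comp_def)
    from tendsto_diff[OF tendsto_snd[OF pw] this]
    show "(\<lambda>k. \<rho> ^ n k * \<Phi>2 p) \<longlonglongrightarrow> snd (h' p)" by simp
  qed
  define \<mu> where "\<mu> = snd (h' p1)"
  have \<mu>: "(\<lambda>k. \<rho> ^ n k) \<longlonglongrightarrow> \<mu>" using snd_h[OF p1(1)] p1(2) by (simp add: \<mu>_def)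
  have "(\<lambda>k. norm (\<rho> ^ n k)) \<longlonglongrightarrow> norm \<mu>" using \<mu> by (rule tendsto_norm)
  then have "norm \<mu> = 1" by (simp add: norm_power \<rho> LIMSEQ_const_iff)
  then have \<mu>0: "\<mu> \<noteq> 0" by auto
  have h'eq: "h' p = (0, \<mu> * \<Phi>2 p)" if p: "p \<in> \<Omega>" for p
  proof -
    have "(\<lambda>k. \<rho> ^ n k * \<Phi>2 p) \<longlonglongrightarrow> \<mu> * \<Phi>2 p" by (rule tendsto_mult[OF \<mu> tendsto_const])
    then have "snd (h' p) = \<mu> * \<Phi>2 p" using LIMSEQ_unique[OF snd_h[OF p]] by blast
    then show ?thesis using fst_h[OF p] by (simp add: prod_eq_iff)
  qed
  show ?thesis
  proof
    show "h ` \<Omega> \<subseteq> Some ` ({0} \<times> UNIV)" using h'(2) h'eq by auto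
    show "Some ` ({0} \<times> UNIV) \<subseteq> h ` \<Omega>"
    proof
      fix y assume "y \<in> Some ` ({0::complex} \<times> (UNIV::complex set))"
      then obtain w where y: "y = Some (0, w)" by auto
      obtain p where p: "p \<in> \<Omega>" "\<Phi>2 p = w / \<mu>" by (rule \<Phi>2_surj)
      have "h p = y" using h'(2) h'eq[OF p(1)] p \<mu>0 y by simp
      then show "y \<in> h ` \<Omega>" using p(1) by blast
    qed
  qed
qed

end

lemma cdim_line: "cdim ({0} \<times> UNIV) = 1"
proof -
  have "interior ({0::complex} \<times> (UNIV::complex set)) = {}"
    by (simp add: interior_Times)
  moreover have "regular_disc (\<lambda>t. (0, t))"
    unfolding regular_disc_def by (auto simp: inj_on_def intro!: holomorphic_intros)
  ultimately show ?thesis unfolding cdim_def by auto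
qed

theorem theorem1p2:
  fixes \<theta> :: real and F :: "complex2 \<Rightarrow> complex2"
    and f g :: "complex \<Rightarrow> complex" and a b :: "complex2 \<Rightarrow> complex"
  assumes "\<theta> \<notin> \<rat>" and "diophantine \<theta>"
    and "automorphism_C2 F"
    and "f holomorphic_on UNIV" and "g holomorphic_on UNIV"
    and "holo_fun a UNIV" and "holo_fun b UNIV"
    and "\<And>z w. F (z, w) =
           (z + f w * z ^ 2 + z ^ 3 * a (z, w),
            multiplier \<theta> * w + g w * z + z ^ 2 * b (z, w))"
    and "f 0 \<noteq> 0" and "g 0 = 0" and "deriv g 0 = 0"
  shows "\<exists>\<Omega>. parabolic_cylinder F \<Omega> \<and> biholomorphic_sets \<Omega> UNIV \<and>
           (\<forall>h. limit_map F \<Omega> h \<longrightarrow> h ` \<Omega> = Some ` ({0} \<times> UNIV))"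
proof -
  define \<rho> where "\<rho> = multiplier \<theta>"
  define \<kappa> where "\<kappa> = f 0"
  (* The value that makes the right-hand side of the equation for K vanish at 0. *)
  define \<beta> where "\<beta> = (a (0, 0) - \<kappa>\<^sup>2) / \<kappa>\<^sup>2"
  have exp_\<rho>: "exp (2 * of_real pi * \<i> * of_real \<theta>) = \<rho>" by (simp add: \<rho>_def multiplier_def)
  have \<rho>: "norm \<rho> = 1" by (simp add: exp_\<rho>[symmetric] norm_exp)
  have \<rho>0: "\<rho> \<noteq> 0" using \<rho> by auto
  have \<kappa>: "\<kappa> \<noteq> 0" using assms(9) by (simp add: \<kappa>_def)
  obtain c r where c: "c > 0" and r: "r > 0"
    and dio: "\<And>n::nat. n \<ge> 1 \<Longrightarrow> norm (\<rho> ^ n - 1) \<ge> c * real n powr (- r)"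
    using assms(2) unfolding diophantine_def \<rho>_def by blast
  have \<rho>1: "\<rho> \<noteq> 1" using dio[of 1] c by auto
  have "(\<lambda>w. - f w / \<kappa>) holomorphic_on UNIV"
    using assms(4) \<kappa> by (intro holomorphic_intros) auto
  from coboundary_entire[OF c r dio this] obtain H
    where H: "H holomorphic_on UNIV" "\<And>w. H (\<rho> * w) - H w = - f w / \<kappa> - - f 0 / \<kappa>" by metis
  obtain G where G: "G holomorphic_on UNIV" "\<And>w. G (\<rho> * w) - \<rho> * G w = g w"
    using twisted_coboundary_entire[OF c r \<rho>0 dio assms(5,10,11)] by metis
  define k where "k = (\<lambda>w. \<beta> * f w - (a (0, w) - f w ^ 2) / \<kappa> - deriv H (\<rho> * w) * g w)"
  have "(\<lambda>w. a (0, w)) holomorphic_on UNIV" by (rule holo_fun_snd_slice[OF assms(6)]) auto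
  moreover have "(\<lambda>w. deriv H (\<rho> * w)) holomorphic_on UNIV"
    using holomorphic_on_compose_gen[OF _ holomorphic_deriv[OF H(1) open_UNIV], of "(*) \<rho>" UNIV]
    by (simp add: comp_def holomorphic_on_mult holomorphic_on_ident)
  ultimately have "k holomorphic_on UNIV"
    unfolding k_def using assms(4,5) \<kappa> by (intro holomorphic_intros) auto
  from coboundary_entire[OF c r dio this] obtain K
    where K: "K holomorphic_on UNIV" "\<And>w. K (\<rho> * w) - K w = k w - k 0" by metis
  have k0: "k 0 = 0" using \<kappa> assms(10) by (simp add: k_def \<beta>_def power2_eq_square field_simps flip: \<kappa>_def)
  interpret parabolic_map F \<rho> \<kappa> \<beta> f g H G K a b
  proof
    show "F (z, w) = (z + f w * z ^ 2 + z ^ 3 * a (z, w), \<rho> * w + g w * z + z ^ 2 * b (z, w))" for z w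
      using assms(8) by (simp add: \<rho>_def)
    show "H (\<rho> * w) - H w = 1 - f w / \<kappa>" for w using H(2)[of w] \<kappa> by (simp add: \<kappa>_def)
    show "K (\<rho> * w) - K w = \<beta> * f w - (a (0, w) - f w ^ 2) / \<kappa> - deriv H (\<rho> * w) * g w" for w
      using K(2)[of w] k0 by (simp add: k_def)
  qed (fact assms H G K \<kappa> \<rho>)+
  have lim: "h ` \<Omega> = Some ` ({0} \<times> UNIV)" if "limit_map F \<Omega> h" for h
    by (rule limit_map_image[OF that])
  have "parabolic_cylinder F \<Omega>"
    unfolding parabolic_cylinder_def
  proof (intro conjI allI impI)
    show "automorphism_C2 F" by (rule assms(3))
    show "invariant_fatou_component F \<Omega>"
      unfolding invariant_fatou_component_def using fatou_component_\<Omega> F_image_\<Omega> by blast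
    show "non_recurrent F \<Omega>" by (rule non_recurrent_\<Omega>)
    show "\<exists>p\<in>closure (omega_limit_set F \<Omega>). p isolated_in {q. F q = q}"
      using origin_in_omega_limit origin_isolated[OF \<rho>1] closure_subset by blast
    show "\<exists>\<Phi>. univalent \<Phi> \<Omega> \<and> (\<forall>p\<in>\<Omega>. \<Phi> (F p) = \<Phi> p + (1, 0))"
      by (rule translation_coordinate[OF exp_\<rho>])
    fix h assume "limit_map F \<Omega> h"
    then have "h ` \<Omega> = Some ` ({0} \<times> UNIV)" by (rule lim)
    moreover have "Some -` (Some ` ({0::complex} \<times> (UNIV::complex set))) = {0} \<times> UNIV" by auto
    ultimately show "cdim (Some -` (h ` \<Omega>)) = 1" using cdim_line by simp
  qed
  moreover have "biholomorphic_sets \<Omega> UNIV"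
    unfolding biholomorphic_sets_def using biholomorphic_\<Phi> by blast
  ultimately show ?thesis using lim by blast
qed

end
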